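(* For every $\epsilon>0$ and every integer $t\ge 2$ there is $n_0$ such that for all $n\ge n_0$, $$s(\mathbb{Z}_n,t) > \left( \frac{1-\epsilon}{t\cdot \lfloor (t+1)/2\rfloor}\, n\right)^{1/\lfloor t/2\rfloor}.$$
   Context: $\mathbb{Z}_n$ is the cyclic group of order $n$, written additively. For a non-negative integer $t$, a subset $A=\{a_1,\dots,a_m\}$ (with $m\ge1$) of an abelian group $G$ is called $t$-independent if whenever $\lambda_1a_1+\cdots+\lambda_ma_m=0$ for integers $\lambda_i$ with $\sum|\lambda_i|\le t$, we have all $\lambda_i=0$. $s(G,t)$ denotes the largest size of a $t$-independent subset of $G$ ($0$ if there is none). *)

theory Defs
  imports Complex_Main "HOL-Algebra.Elementary_Groups" "HOL-Algebra.FiniteProduct"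
begin

text \<open>
  Groups of HOL-Algebra are written multiplicatively, so a linear combination with integer
  coefficients appears as a finite product of integer powers. The coefficients
  are indexed by the elements of \<open>A\<close> themselves instead of by an enumeration.
\<close>

definition t_independent :: "('a, 'b) monoid_scheme \<Rightarrow> nat \<Rightarrow> 'a set \<Rightarrow> bool" where
  "t_independent G t A \<longleftrightarrow>
     A \<subseteq> carrier G \<and> finite A \<and> A \<noteq> {} \<and>
     (\<forall>c :: 'a \<Rightarrow> int.
        finprod G (\<lambda>a. a [^]\<^bsub>G\<^esub> c a) A = \<one>\<^bsub>G\<^esub> \<and> (\<Sum>a\<in>A. \<bar>c a\<bar>) \<le> int t
          \<longrightarrow> (\<forall>a\<in>A. c a = 0))"

text \<open>
  The inserted \<open>0\<close> is the value when no \<open>t\<close>-independent set exists; \<open>Max\<close> is meaningful as soon as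
  the sizes are bounded, in particular for every finite \<open>G\<close>.
\<close>

definition max_t_independent :: "('a, 'b) monoid_scheme \<Rightarrow> nat \<Rightarrow> nat" where
  "max_t_independent G t = Max (insert 0 {card A | A. t_independent G t A})"

end

theory Submission
  imports Defs "HOL-Complex_Analysis.Complex_Analysis" "HOL-Number_Theory.Prime_Powers"
    "HOL-Number_Theory.Cong" "HOL-Real_Asymp.Real_Asymp"
begin

text \<open>
  Put \<open>k = \<lfloor>t/2\<rfloor>\<close>, \<open>q = \<lfloor>(t - 1)/2\<rfloor>\<close> and, for a prime \<open>p\<close>, \<open>M = p\<^sup>k\<close>. A Bose--Chowla set of
  \<open>p\<close> elements of \<open>[0, M)\<close>, all of whose \<open>k\<close>-fold sums are distinct, is translated
  to the interval \<open>[qM + 1, (q + 1)M]\<close>. A combination of weight at most \<open>t\<close> then has absolute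
  value at most \<open>t (q + 1) M\<close>, so if this is less than \<open>n\<close>, vanishing modulo \<open>n\<close> means vanishing.
  The position of the interval forces the positive and negative coefficients of a vanishing
  combination to balance, hence each kind has weight at most \<open>k\<close>, and the Bose--Chowla
  property applies. As \<open>q + 1 = \<lfloor>(t + 1)/2\<rfloor>\<close>, it remains to choose \<open>p\<close> just below
  \<open>(n / (t \<lfloor>(t + 1)/2\<rfloor>))\<^sup>1\<^sup>/\<^sup>k\<close>, which requires primes in \<open>((1 - \<delta>)x, x]\<close> for every \<open>\<delta> > 0\<close> and
  large \<open>x\<close>. These come from \<open>\<psi>(x) \<sim> x\<close>, by Newman's Tauberian theorem applied to
  \<open>\<Sum> (\<psi>(n) - n) / n\<^sup>s\<^sup>+\<^sup>1\<close>.

  The field with \<open>p\<^sup>k\<close> elements enters as a residue ring of \<open>\<int>[X]\<close> at a prime ideal containing \<open>p\<close>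
  and the polynomials vanishing at a complex primitive root of unity of order \<open>p\<^sup>k - 1\<close>.
\<close>

section \<open>Newman's Tauberian theorem\<close>

text \<open>Since \<open>\<epsilon>\<close> is arbitrary, the prime may lose only a factor close to
  1 against its upper limit. Primes between \<open>x / 2\<close> and \<open>x\<close> would give a
  worse constant, hence the strength of the prime number theorem. The Tauberian theorem asks for
  bounded coefficients and for holomorphy up to the boundary line. Dividing
  \<open>psi(n) - n\<close> by \<open>n\<close> gives the first through Chebyshev's bound; the
  second comes from the absence of zeros of zeta on \<open>Re s = 1\<close>. The outcome is only the
  convergence of the sum of \<open>(psi(n) - n) / n^2\<close>, and monotonicity of
  \<open>psi\<close> turns it into the asymptotics.

  On the algebraic side neither an irreducible polynomial of degree \<open>k\<close> over the prime
  field nor the quotient ring is constructed. Congruences modulo a prime ideal containing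
  \<open>p\<close> suffice, and those that concern the order of \<open>X\<close> are inherited from
  identities at the root of unity. The obstacle is properness of the ideal: \<open>p\<close> must
  not be invertible in the ring generated by that root.\<close>

text \<open>The left half of the contour is kept free because two are needed: a semicircle for the
  partial sums, which are entire, and a shallow box for the limit function, which is holomorphic
  only a little to the left of the axis.\<close>

lemma split_circle_cauchy:
  fixes h :: "complex \<Rightarrow> complex"
  assumes R: "R > 0" and U: "open U" "convex U" "0 \<in> U" and h: "h holomorphic_on U"
    and arc: "path_image (part_circlepath 0 R (-(pi/2)) (pi/2)) \<subseteq> U"
    and \<rho>: "valid_path \<rho>" "pathstart \<rho> = \<i> * of_real R" "pathfinish \<rho> = - \<i> * of_real R"
    and im: "path_image \<rho> \<subseteq> U" "\<And>w. w \<in> path_image \<rho> \<Longrightarrow> Im w \<noteq> 0 \<or> Re w < 0"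
  shows "contour_integral (part_circlepath 0 R (-(pi/2)) (pi/2)) (\<lambda>w. h w / w) +
         contour_integral \<rho> (\<lambda>w. h w / w) = 2 * pi * \<i> * h 0"
proof -
  define A where "A = part_circlepath 0 R (-(pi/2)) (pi/2)"
  have vA: "valid_path A" by (simp add: A_def)
  have sA: "pathstart A = - \<i> * of_real R" and fA: "pathfinish A = \<i> * of_real R"
    by (simp_all add: A_def exp_eq_polar cis_conv_exp[symmetric] complex_eq_iff)
  have A0: "0 \<notin> path_image A"
    using R by (auto simp: A_def path_image_part_circlepath')
  have r0: "0 \<notin> path_image \<rho>" using im(2)[of 0] by auto
  have v: "valid_path (A +++ \<rho>)" using vA \<rho> fA by (auto intro: valid_path_join)
  have pim: "path_image (A +++ \<rho>) = path_image A \<union> path_image \<rho>"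
    using fA \<rho>(2) by (simp add: path_image_join)
  have holo: "(\<lambda>w. h w / w) holomorphic_on U - {0}"
    by (intro holomorphic_intros holomorphic_on_subset[OF h]) auto
  have U0: "open (U - {0})" using U by auto
  have intA: "g contour_integrable_on A" if "g holomorphic_on U - {0}" for g
    using contour_integrable_holomorphic_simple[OF that U0 vA] arc A0 by (auto simp: A_def)
  have intr: "g contour_integrable_on \<rho>" if "g holomorphic_on U - {0}" for g
    using contour_integrable_holomorphic_simple[OF that U0 \<rho>(1)] im r0 by auto
  have h1: "(\<lambda>w. 1 / w) holomorphic_on U - {0}" by (intro holomorphic_intros) auto
  have cA: "contour_integral A (\<lambda>w. 1/w) = \<i> * pi"
  proof -
    have "contour_integral A (\<lambda>w. 1/w) = integral {-(pi/2)..pi/2} (\<lambda>t. 1/(0 + R * cis t) * R * \<i> * cis t)"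
      unfolding A_def by (rule contour_integral_part_circlepath_eq) auto
    also have "\<dots> = integral {-(pi/2)..pi/2} (\<lambda>t. \<i>)"
      using R by (intro integral_cong) auto
    finally show ?thesis by (simp add: scaleR_conv_of_real mult.commute)
  qed
  \<comment> \<open>The path avoids the nonnegative real axis, so \<open>Ln (-w)\<close> is a
    primitive of \<open>1 / w\<close> along it and only the endpoints count. Each half of the
    contour contributes \<open>\<i> * pi\<close>, which makes the winding number 1 whatever the
    shape of \<open>\<rho>\<close>.\<close>
  have cr: "contour_integral \<rho> (\<lambda>w. 1/w) = \<i> * pi"
  proof -
    have "((\<lambda>w. 1/w) has_contour_integral (Ln (- pathfinish \<rho>) - Ln (- pathstart \<rho>))) \<rho>"
    proof (rule contour_integral_primitive[where S = "{w. Im w \<noteq> 0 \<or> Re w < 0}" and f = "\<lambda>w. Ln (-w)"])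
      fix w :: complex assume "w \<in> {w. Im w \<noteq> 0 \<or> Re w < 0}"
      then have "-w \<notin> \<real>\<^sub>\<le>\<^sub>0" "w \<noteq> 0" by (auto simp: complex_nonpos_Reals_iff)
      then show "((\<lambda>w. Ln (-w)) has_field_derivative 1/w) (at w within {w. Im w \<noteq> 0 \<or> Re w < 0})"
        by (auto intro!: derivative_eq_intros simp: field_simps)
    qed (use \<rho> im in auto)
    then have "contour_integral \<rho> (\<lambda>w. 1/w) = Ln (\<i> * of_real R) - Ln (- (\<i> * of_real R))"
      using \<rho> by (simp add: contour_integral_unique)
    also have "Ln (\<i> * of_real R) = ln R + \<i> * (pi/2)"
      using R Ln_times_of_real[of R "\<i>"] by (simp add: mult.commute Ln_of_real)
    also have "Ln (- (\<i> * of_real R)) = ln R - \<i> * (pi/2)"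
      using R Ln_times_of_real[of R "-\<i>"] by (simp add: mult.commute Ln_of_real)
    finally show ?thesis by (simp add: field_simps)
  qed
  have "contour_integral (A +++ \<rho>) (\<lambda>w. 1/w) = 2 * pi * \<i>"
    using contour_integral_join[OF intA[OF h1] intr[OF h1] vA \<rho>(1)] fA \<rho>(2) cA cr by simp
  then have wn: "winding_number (A +++ \<rho>) 0 = 1"
    using winding_number_valid_path[OF v, of 0] A0 r0 pim by simp
  have "((\<lambda>w. h w / (w - 0)) has_contour_integral 2 * pi * \<i> * winding_number (A +++ \<rho>) 0 * h 0) (A +++ \<rho>)"
    by (rule Cauchy_integral_formula_convex_simple[OF U(2) h])
       (use U v pim arc im A0 r0 sA \<rho> in \<open>auto simp: interior_open A_def[symmetric]\<close>)
  then have "contour_integral (A +++ \<rho>) (\<lambda>w. h w / w) = 2 * pi * \<i> * h 0"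
    using wn by (simp add: contour_integral_unique)
  then show ?thesis
    using contour_integral_join[OF intA[OF holo] intr[OF holo] vA \<rho>(1)] fA \<rho>(2) by (simp add: A_def)
qed

section \<open>Comparison of power sums with integrals\<close>

lemma powr_diff_mvt:
  fixes u v s :: real
  assumes "0 < u" "u < v"
  obtains x where "u < x" "x < v" "v powr s - u powr s = (v - u) * (s * x powr (s - 1))"
  using MVT2[OF assms(2), of "\<lambda>x. x powr s" "\<lambda>x. s * x powr (s - 1)"] assms(1)
  by (force intro!: has_real_derivative_powr)

text \<open>A telescoping form of the comparison with the integral of
  \<open>y powr (-1 - x)\<close>: the mean value theorem bounds each term by a difference of values
  of \<open>n powr (-x) / x\<close>.\<close>

lemma sum_powr_tail_le:
  fixes x :: real
  assumes "x > 0" "N \<ge> 1" "N \<le> M"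
  shows "(\<Sum>n=N..<M. real (Suc n) powr (-1 - x)) \<le> (real N powr (-x) - real M powr (-x)) / x"
  using assms(3)
proof (induction M rule: dec_induct)
  case base then show ?case by simp
next
  case (step M)
  obtain y where y: "real M < y" "y < real M + 1"
     "(real M + 1) powr (-x) - real M powr (-x) = (real M + 1 - real M) * (-x * y powr (-x - 1))"
    using powr_diff_mvt[of "real M" "real M + 1" "-x"] step assms by auto
  have "(real M + 1) powr (-1 - x) \<le> y powr (-x - 1)"
    using y(1,2) assms step by (subst diff_conv_add_uminus, subst add.commute) (auto intro!: powr_mono2')
  have "(real M + 1) powr (-1-x) \<le> (real M powr (-x) - (real M + 1) powr (-x)) / x"
  proof -
    have "x * (real M + 1) powr (-1-x) \<le> x * y powr (-x-1)"
      using assms \<open>(real M + 1) powr (-1 - x) \<le> y powr (-x - 1)\<close> by (intro mult_left_mono) auto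
    also have "\<dots> = real M powr (-x) - (real M + 1) powr (-x)" using y(3) by simp
    finally show ?thesis using assms by (simp add: field_simps)
  qed
  moreover have M1: "real M + 1 = real (Suc M)" by simp
  ultimately show ?case using step unfolding M1 by (simp add: diff_divide_distrib del: of_nat_Suc)
qed

text \<open>The summand decreases for \<open>y \<le> 1\<close> and increases for
  \<open>y > 1\<close>, which decides the end of each unit interval at which it is compared with the
  integral. In the increasing case the last term is left over; it is the extra
  \<open>N powr (y - 1)\<close>.\<close>

lemma sum_powr_head_le:
  fixes y :: real
  assumes "y > 0" 
  shows "(\<Sum>n<N. real (Suc n) powr (y - 1)) \<le> real N powr y / y + real N powr (y - 1)"
proof (cases "y \<le> 1")
  case True
  have "(\<Sum>n<N. real (Suc n) powr (y - 1)) \<le> real N powr y / y"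
  proof (induction N)
    case (Suc N)
    have "(real N + 1) powr (y - 1) \<le> ((real N + 1) powr y - real N powr y) / y"
    proof (cases "N = 0")
      case False
      obtain z where z: "real N < z" "z < real N + 1"
        "(real N + 1) powr y - real N powr y = (real N + 1 - real N) * (y * z powr (y - 1))"
        using powr_diff_mvt[of "real N" "real N + 1" y] False by auto
      have "(real N + 1) powr (y - 1) \<le> z powr (y - 1)"
        using z True False by (intro powr_mono2') auto
      then show ?thesis using z assms by (simp add: field_simps)
    qed (use True assms in auto)
    then show ?case using Suc by (simp add: diff_divide_distrib add.commute)
  qed simp
  then show ?thesis by (smt (verit) powr_ge_zero)
next
  case False
  have "(\<Sum>n<N. real (Suc n) powr (y - 1)) \<le> real N powr y / y + real N powr (y - 1)"
  proof (induction N)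
    case (Suc N)
    have "real N powr (y - 1) \<le> ((real N + 1) powr y - real N powr y) / y"
    proof (cases "N = 0")
      case False
      obtain z where z: "real N < z" "z < real N + 1"
        "(real N + 1) powr y - real N powr y = (real N + 1 - real N) * (y * z powr (y - 1))"
        using powr_diff_mvt[of "real N" "real N + 1" y] False by auto
      have "real N powr (y - 1) \<le> z powr (y - 1)"
        using z \<open>\<not> y \<le> 1\<close> False by (intro powr_mono2) auto
      then show ?thesis using z assms by (simp add: field_simps)
    qed (use False assms in auto)
    then show ?case using Suc by (simp add: diff_divide_distrib add.commute)
  qed simp
  then show ?thesis .
qed

lemma closed_segment_coordinates:
  assumes "w \<in> closed_segment a b"
  shows "min (Re a) (Re b) \<le> Re w" "Re w \<le> max (Re a) (Re b)"
    "min (Im a) (Im b) \<le> Im w" "Im w \<le> max (Im a) (Im b)"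
proof -
  obtain u where u: "0 \<le> u" "u \<le> 1" "w = (1 - u) *\<^sub>R a + u *\<^sub>R b"
    using assms by (auto simp: closed_segment_def)
  have *: "min x y \<le> (1 - u) * x + u * y \<and> (1 - u) * x + u * y \<le> max x y" for x y :: real
  proof -
    have "(1 - u) * min x y + u * min x y \<le> (1 - u) * x + u * y"
      using u by (intro add_mono mult_left_mono) auto
    moreover have "(1 - u) * x + u * y \<le> (1 - u) * max x y + u * max x y"
      using u by (intro add_mono mult_left_mono) auto
    ultimately show ?thesis by (simp add: algebra_simps)
  qed
  show "min (Re a) (Re b) \<le> Re w" "Re w \<le> max (Re a) (Re b)"
    "min (Im a) (Im b) \<le> Im w" "Im w \<le> max (Im a) (Im b)"
    using *[of "Re a" "Re b"] *[of "Im a" "Im b"] u(3) by simp_all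
qed

text \<open>On the circle \<open>w * cnj w = R^2\<close>, so the kernel
  \<open>1 / w + w / R^2\<close> collapses to \<open>(cnj w + w) / R^2\<close>. The resulting factor
  \<open>Re w\<close> cancels the \<open>1 / Re w\<close> in the estimates of tails and partial
  sums.\<close>

lemma newman_kernel_norm:
  assumes "norm w = R" "R > 0"
  shows "norm ((1 + w\<^sup>2 / of_real (R\<^sup>2)) / w) = 2 * \<bar>Re w\<bar> / R\<^sup>2"
proof -
  have "w \<noteq> 0" using assms by auto
  have c: "w * cnj w = of_real (R\<^sup>2)" using assms(1) complex_norm_square[of w] by simp
  have "(1 + w\<^sup>2 / of_real (R\<^sup>2)) = (cnj w + w) * w / of_real (R\<^sup>2)"
    using c assms by (simp add: field_simps power2_eq_square)
  then have "(1 + w\<^sup>2 / of_real (R\<^sup>2)) / w = (cnj w + w) / of_real (R\<^sup>2)"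
    using \<open>w \<noteq> 0\<close> by simp
  also have "cnj w + w = of_real (2 * Re w)" by (simp add: complex_eq_iff)
  finally show ?thesis by (simp add: norm_divide norm_power norm_mult)
qed

lemma norm_nat_powr: "n > 0 \<Longrightarrow> norm (of_nat n powr z :: complex) = real n powr Re z"
  by (metis norm_powr_real_powr of_nat_0_less_iff of_real_of_nat_eq Reals_of_nat Re_complex_of_real of_nat_0_le_iff)

text \<open>Newman's contour argument for Dirichlet series. On the right semicircle the tail
  \<open>F - G N\<close> is small; on the left \<open>F\<close> and \<open>G N\<close> are treated
  separately, \<open>F\<close> on a fixed box near the axis and \<open>G N\<close> on the left
  semicircle. As \<open>N\<close> grows, the semicircles cost a multiple of \<open>C / R\<close>,
  and the box costs its two short sides plus a vanishing term.\<close>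

lemma newman_tauberian:
  fixes b :: "nat \<Rightarrow> complex" and F :: "complex \<Rightarrow> complex"
  assumes bnd: "\<And>n. norm (b n) \<le> C"
    and holo: "F holomorphic_on S" "open S" "{z. Re z \<ge> 0} \<subseteq> S"
    and sums: "\<And>z. Re z > 0 \<Longrightarrow> (\<lambda>n. b n * of_nat (Suc n) powr (-1 - z)) sums F z"
  shows "(\<lambda>N. \<Sum>n<N. b n / of_nat (Suc n)) \<longlonglongrightarrow> F 0"
proof (rule LIMSEQ_I)
  fix e :: real assume e: "e > 0"
  have C: "C \<ge> 0" using bnd[of 0] norm_ge_zero order_trans by blast
  \<comment> \<open>With this radius \<open>2 * C / R \<le> e / 4\<close>, so in the limit the two
    semicircles take at most \<open>e * pi / 2\<close> of the available
    \<open>2 * pi * e\<close>.\<close>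
  define R where "R = 8 * (C + 1) / e"
  have R: "R > 0" using C e by (simp add: R_def)
  define G where "G = (\<lambda>N z. \<Sum>n<N. b n * of_nat (Suc n) powr (-1 - z))"
  \<comment> \<open>A segment of the imaginary axis slightly longer than the diameter of the circle;
    compactness gives one width \<open>d\<close> by which \<open>S\<close> extends to the left along
    all of it.\<close>
  define K where "K = (\<lambda>y. \<i> * of_real y) ` {-R-1..R+1}"
  have "compact K" unfolding K_def
    by (intro compact_continuous_image continuous_intros) auto
  moreover have "K \<subseteq> S" using holo(3) by (auto simp: K_def)
  ultimately obtain d where d: "d > 0" "(\<Union>x\<in>K. ball x d) \<subseteq> S"
    using compact_subset_open_imp_ball_epsilon_subset[OF _ holo(2)] by metis
  define U where "U = {z. Re z > -d \<and> Im z < R + 1 \<and> Im z > -R-1}"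
  have Ueq: "U = {z. Re z > -d} \<inter> ({z. Im z < R + 1} \<inter> {z. Im z > -R-1})"
    by (auto simp: U_def)
  have oU: "open U" and cU: "convex U" unfolding Ueq
    by (auto intro!: open_Int convex_Int simp: open_halfspace_Re_gt open_halfspace_Im_gt open_halfspace_Im_lt
         convex_halfspace_Re_gt convex_halfspace_Im_gt convex_halfspace_Im_lt)
  have zU: "0 \<in> U" using d R by (simp add: U_def)
  have US: "U \<subseteq> S"
  proof
    fix z assume z: "z \<in> U"
    show "z \<in> S"
    proof (cases "Re z \<ge> 0")
      case True then show ?thesis using holo(3) by auto
    next
      case False
      have "dist (\<i> * of_real (Im z)) z = \<bar>Re z\<bar>"
        by (simp add: dist_norm cmod_def)
      moreover have "\<i> * of_real (Im z) \<in> K" using z by (auto simp: K_def U_def)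
      ultimately show ?thesis using d z False by (force simp: U_def)
    qed
  qed
  have FU: "F holomorphic_on U" using holo(1) US holomorphic_on_subset by blast
  define A where "A = part_circlepath 0 R (-(pi/2)) (pi/2)"
  define B where "B = part_circlepath 0 R (pi/2) (3*pi/2)"
  have pA: "norm w = R \<and> Re w \<ge> 0 \<and> \<bar>Im w\<bar> \<le> R" if wA: "w \<in> path_image A" for w
  proof -
    obtain t where t: "t \<in> {-(pi/2)..pi/2}" "w = R * cis t"
      using wA R by (auto simp: A_def path_image_part_circlepath' closed_segment_eq_real_ivl)
    have n: "norm w = R" using R t by (simp add: norm_mult)
    have "cos t \<ge> 0" using t by (intro cos_ge_zero) auto
    then show ?thesis using t n R abs_Im_le_cmod[of w] by simp
  qed
  have pB: "norm w = R \<and> Re w \<le> 0 \<and> \<bar>Im w\<bar> \<le> R" if wB: "w \<in> path_image B" for w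
  proof -
    obtain t where t: "t \<in> {pi/2..3*pi/2}" "w = R * cis t"
      using wB R by (auto simp: B_def path_image_part_circlepath' closed_segment_eq_real_ivl)
    have n: "norm w = R" using R t by (simp add: norm_mult)
    have "cos (t - pi) \<ge> 0" using t by (intro cos_ge_zero) auto
    then have "cos t \<le> 0" by simp
    then show ?thesis using t n R abs_Im_le_cmod[of w] by (simp add: mult_nonneg_nonpos)
  qed
  \<comment> \<open>Newman's kernel times \<open>w\<close>. Since \<open>Q 0 = 1\<close>, inserting
    it does not change the value that Cauchy's formula extracts at 0.\<close>
  define Q where "Q = (\<lambda>w::complex. 1 + w\<^sup>2 / of_real (R\<^sup>2))"
  define Kb where "Kb = cbox (Complex (-d/2) (-R)) (Complex 0 R)"
  have KbU: "Kb \<subseteq> U" using d by (auto simp: Kb_def U_def in_cbox_complex_iff)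
  have "compact ((\<lambda>w. F w * Q w) ` Kb)"
    unfolding Q_def using FU KbU R
    by (intro compact_continuous_image continuous_intros holomorphic_on_imp_continuous_on holomorphic_on_subset[OF FU])
       (auto simp: Kb_def)
  then obtain M0 where "\<forall>x\<in>(\<lambda>w. F w * Q w) ` Kb. norm x \<le> M0"
    using compact_imp_bounded bounded_iff by metis
  then have M: "norm (F w * Q w) \<le> \<bar>M0\<bar> + 1" if "w \<in> Kb" for w using that by fastforce
  define M where "M = \<bar>M0\<bar> + 1"
  have M: "norm (F w * Q w) \<le> M" "M > 0" if "w \<in> Kb" for w using M[OF that] by (auto simp: M_def)
  have Mp: "M > 0" by (simp add: M_def)
  \<comment> \<open>\<open>d / 2\<close> keeps the box inside \<open>Kb\<close>. The other bound
    makes the two horizontal sides, of length \<open>\<delta>\<close> and with integrand at most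
    \<open>M / R\<close>, cost at most \<open>e / 4\<close> together. The vertical side carries
    \<open>N powr (-\<delta>)\<close> and disappears as \<open>N\<close> grows.\<close>
  define \<delta> where "\<delta> = min (d/2) (e * R / (8 * M))"
  have \<delta>: "\<delta> > 0" "\<delta> \<le> d / 2" "2 * M * \<delta> / R \<le> e / 4"
    using d e R Mp by (auto simp: \<delta>_def min_def field_simps)
  define a1 a2 where "a1 = \<i> * of_real R" and "a2 = - of_real \<delta> + \<i> * of_real R"
  define a3 a4 where "a3 = - of_real \<delta> - \<i> * of_real R" and "a4 = - \<i> * of_real R"
  define \<rho> where "\<rho> = linepath a1 a2 +++ linepath a2 a3 +++ linepath a3 a4"
  have seg: "w \<in> Kb \<and> (Im w \<noteq> 0 \<or> Re w < 0)"
    if "w \<in> closed_segment a1 a2 \<union> closed_segment a2 a3 \<union> closed_segment a3 a4" for w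
    using that closed_segment_coordinates[of w a1 a2] closed_segment_coordinates[of w a2 a3] closed_segment_coordinates[of w a3 a4] \<delta> R
    by (auto simp: Kb_def in_cbox_complex_iff a1_def a2_def a3_def a4_def)
  have \<rho>im: "path_image \<rho> = closed_segment a1 a2 \<union> closed_segment a2 a3 \<union> closed_segment a3 a4"
    by (auto simp: \<rho>_def path_image_join)
  have v\<rho>: "valid_path \<rho>" by (auto simp: \<rho>_def intro!: valid_path_join)
  have AU: "path_image A \<subseteq> U" using pA d R by (force simp: U_def)
  have main: "2 * pi * norm (F 0 - G N 0) \<le>
      (2 * C / R\<^sup>2) * R * pi + (2 * C / R\<^sup>2 + 2 * C / (R * N)) * R * pi
      + 2 * (M / R * \<delta>) + (M / \<delta>) * real N powr (-\<delta>) * (2 * R)" if N: "N \<ge> 1" for N :: nat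
  proof -
    \<comment> \<open>The modulus \<open>N powr Re w\<close> of the first factor cancels the order
      \<open>N powr (- Re w)\<close> both of the tail on the right and of the partial sum on the
      left.\<close>
    define E where "E = (\<lambda>w. of_nat N powr w * Q w)"
    have N0: "(of_nat N :: complex) \<noteq> 0" using N by simp
    have hE: "E holomorphic_on X" for X unfolding E_def Q_def using N0 R
      by (intro holomorphic_intros) auto
    have hG: "G N holomorphic_on X" for X unfolding G_def
      by (intro holomorphic_intros) (auto simp del: of_nat_Suc)
    have E0: "E 0 = 1" using N0 by (simp add: E_def Q_def)
    have kern: "norm (E w / w) = real N powr Re w * (2 * \<bar>Re w\<bar> / R\<^sup>2)" if "norm w = R" for w
    proof -
      have "norm (E w / w) = norm (of_nat N powr w :: complex) * norm ((1 + w\<^sup>2 / of_real (R\<^sup>2)) / w)"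
        by (simp add: E_def Q_def norm_mult norm_divide)
      then show ?thesis unfolding newman_kernel_norm[OF that R] using N norm_nat_powr[of N w] by simp
    qed
    have id1: "contour_integral A (\<lambda>w. F w * E w / w) + contour_integral \<rho> (\<lambda>w. F w * E w / w)
        = 2 * pi * \<i> * F 0"
    proof -
      have h: "(\<lambda>w. F w * E w) holomorphic_on U" by (intro holomorphic_intros FU hE)
      have "path_image \<rho> \<subseteq> U" using seg KbU \<rho>im by auto
      moreover have "Im w \<noteq> 0 \<or> Re w < 0" if "w \<in> path_image \<rho>" for w using seg[of w] that \<rho>im by auto
      moreover have "pathstart \<rho> = \<i> * of_real R" "pathfinish \<rho> = - \<i> * of_real R"
        by (simp_all add: \<rho>_def a1_def a4_def)
      ultimately show ?thesis
        using split_circle_cauchy[OF R oU cU zU h AU[unfolded A_def] v\<rho>] E0 by (simp add: A_def)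
    qed
    have id2: "contour_integral A (\<lambda>w. G N w * E w / w) + contour_integral B (\<lambda>w. G N w * E w / w)
        = 2 * pi * \<i> * G N 0"
    proof -
      have "contour_integral (part_circlepath 0 R (- (pi / 2)) (pi / 2)) (\<lambda>w. G N w * E w / w) +
         contour_integral B (\<lambda>w. G N w * E w / w) = 2 * pi * \<i> * (G N 0 * E 0)"
      proof (rule split_circle_cauchy[OF R, of UNIV])
        have e3: "3 * pi / 2 = pi / 2 + pi" by simp
        have c3: "cos (3 * pi / 2) = 0" "sin (3 * pi / 2) = -1"
          unfolding e3 cos_periodic_pi sin_periodic_pi by simp_all
        show "pathstart B = \<i> * of_real R" "pathfinish B = - \<i> * of_real R"
          by (simp_all add: B_def cis_conv_exp[symmetric] complex_eq_iff exp_eq_polar c3)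
        show "Im w \<noteq> 0 \<or> Re w < 0" if "w \<in> path_image B" for w
          using pB[OF that] R by (auto simp: cmod_def complex_eq_iff)
      qed (auto simp: B_def intro!: holomorphic_intros hG hE)
      then show ?thesis using E0 by (simp add: A_def)
    qed
    have vA: "valid_path A" and vB: "valid_path B" by (simp_all add: A_def B_def)
    have A0: "0 \<notin> path_image A" using pA[of 0] R by auto
    have B0: "0 \<notin> path_image B" using pB[of 0] R by auto
    have r0: "0 \<notin> path_image \<rho>" using seg[of 0] \<rho>im by auto
    have U0: "open (U - {0})" using oU by auto
    have iA: "g contour_integrable_on A" if "g holomorphic_on U - {0}" for g
      using contour_integrable_holomorphic_simple[OF that U0 vA] AU A0 by auto
    have iB: "g contour_integrable_on B" if "g holomorphic_on UNIV - {0}" for g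
      using contour_integrable_holomorphic_simple[OF that _ vB] B0 by auto
    have hF0: "(\<lambda>w. F w * E w / w) holomorphic_on U - {0}"
      by (intro holomorphic_intros hE holomorphic_on_subset[OF FU]) auto
    have hG0: "(\<lambda>w. G N w * E w / w) holomorphic_on X - {0}" for X
      by (intro holomorphic_intros hE hG) auto
    define I1 where "I1 = contour_integral A (\<lambda>w. (F w - G N w) * E w / w)"
    have I1: "contour_integral A (\<lambda>w. F w * E w / w) - contour_integral A (\<lambda>w. G N w * E w / w) = I1"
      unfolding I1_def contour_integral_diff[OF iA[OF hF0] iA[OF hG0], symmetric]
      by (simp add: algebra_simps diff_divide_distrib)
    have tail: "norm (F w - G N w) \<le> C * (real N powr (- Re w) / Re w)" if w: "Re w > 0" for w
    proof -
      have "(\<lambda>m. G m w - G N w) \<longlonglongrightarrow> F w - G N w"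
        using sums[OF w] by (intro tendsto_intros) (simp add: sums_def G_def)
      moreover have "eventually (\<lambda>m. norm (G m w - G N w) \<le> C * (real N powr (- Re w) / Re w)) sequentially"
      proof (rule eventually_sequentiallyI[of N])
        fix m assume m: "N \<le> m"
        have "G m w - G N w = (\<Sum>n=N..<m. b n * of_nat (Suc n) powr (-1 - w))"
          unfolding G_def using m by (simp add: sum_diff_nat_ivl lessThan_atLeast0 sum_diff_split)
        also have "norm \<dots> \<le> (\<Sum>n=N..<m. C * real (Suc n) powr (-1 - Re w))"
          using bnd by (intro sum_norm_le) (auto simp: norm_mult norm_nat_powr simp del: of_nat_Suc intro!: mult_right_mono)
        also have "\<dots> \<le> C * ((real N powr (-Re w) - real m powr (-Re w)) / Re w)"
          unfolding sum_distrib_left[symmetric] using sum_powr_tail_le[OF w N m] C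
          by (intro mult_left_mono) auto
        also have "\<dots> \<le> C * (real N powr (- Re w) / Re w)"
          using C w by (intro mult_left_mono divide_right_mono) auto
        finally show "norm (G m w - G N w) \<le> C * (real N powr (- Re w) / Re w)" .
      qed
      ultimately show ?thesis
        by (intro tendsto_upperbound[OF tendsto_norm]) auto
    qed
    have b1: "norm I1 \<le> (2 * C / R\<^sup>2) * R * (pi/2 - (-(pi/2)))"
      unfolding I1_def A_def
    proof (rule contour_integral_bound_part_circlepath_strong[where k = "{\<i> * of_real R, - \<i> * of_real R}"])
      show "(\<lambda>w. (F w - G N w) * E w / w) contour_integrable_on part_circlepath 0 R (- (pi / 2)) (pi / 2)"
        unfolding A_def[symmetric]
        by (intro iA holomorphic_intros hE hG holomorphic_on_subset[OF FU]) auto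
      fix w assume w: "w \<in> path_image (part_circlepath 0 R (- (pi / 2)) (pi / 2)) - {\<i> * of_real R, - \<i> * of_real R}"
      then have w1: "norm w = R" "Re w \<ge> 0" using pA[of w] by (auto simp: A_def)
      \<comment> \<open>The two endpoints of the semicircle are excepted from the bound because
        \<open>Re w = 0\<close> there, and the tail estimate divides by it.\<close>
      have "Re w \<noteq> 0"
      proof
        assume "Re w = 0"
        then have "\<bar>Im w\<bar> = R" using w1 by (simp add: cmod_def)
        then show False using w \<open>Re w = 0\<close> by (auto simp: complex_eq_iff abs_if split: if_splits)
      qed
      then have x: "Re w > 0" using w1 by simp
      have "norm ((F w - G N w) * E w / w) = norm (F w - G N w) * norm (E w / w)"
        by (simp add: norm_mult norm_divide)
      also have "\<dots> \<le> (C * (real N powr (- Re w) / Re w)) * (real N powr Re w * (2 * \<bar>Re w\<bar> / R\<^sup>2))"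
        unfolding kern[OF w1(1)] by (intro mult_right_mono tail x) auto
      also have "\<dots> = (real N powr (- Re w) * real N powr Re w) * (2 * C / R\<^sup>2)"
        using x by (simp add: field_simps)
      also have "\<dots> = 2 * C / R\<^sup>2" using N by (simp add: powr_add[symmetric])
      finally show "norm ((F w - G N w) * E w / w) \<le> 2 * C / R\<^sup>2" .
    qed (use C R in auto)
    have b2: "norm (contour_integral B (\<lambda>w. G N w * E w / w)) \<le> (2 * C / R\<^sup>2 + 2 * C / (R * N)) * R * (3*pi/2 - pi/2)"
      unfolding B_def
    proof (rule contour_integral_bound_part_circlepath_strong[where k = "{\<i> * of_real R, - \<i> * of_real R}"])
      show "(\<lambda>w. G N w * E w / w) contour_integrable_on part_circlepath 0 R (pi / 2) (3 * pi / 2)"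
        unfolding B_def[symmetric] by (intro iB hG0)
      fix w assume w: "w \<in> path_image (part_circlepath 0 R (pi / 2) (3 * pi / 2)) - {\<i> * of_real R, - \<i> * of_real R}"
      then have w1: "norm w = R" "Re w \<le> 0" using pB[of w] by (auto simp: B_def)
      have "Re w \<noteq> 0"
      proof
        assume "Re w = 0"
        then have "\<bar>Im w\<bar> = R" using w1 by (simp add: cmod_def)
        then show False using w \<open>Re w = 0\<close> by (auto simp: complex_eq_iff abs_if split: if_splits)
      qed
      define y where "y = - Re w"
      have y: "y > 0" "y \<le> R" "Re w = -y" using w1 \<open>Re w \<noteq> 0\<close> abs_Re_le_cmod[of w] by (auto simp: y_def)
      have "norm (G N w) \<le> (\<Sum>n<N. C * real (Suc n) powr (y - 1))" unfolding G_def
        using bnd by (intro sum_norm_le)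
          (auto simp: norm_mult norm_nat_powr y simp del: of_nat_Suc intro!: mult_right_mono)
      also have "\<dots> \<le> C * (real N powr y / y + real N powr (y - 1))"
        unfolding sum_distrib_left[symmetric] using sum_powr_head_le[OF y(1)] C by (intro mult_left_mono) auto
      finally have g: "norm (G N w) \<le> C * (real N powr y / y + real N powr (y - 1))" .
      have "norm (G N w * E w / w) = norm (G N w) * norm (E w / w)"
        by (simp add: norm_mult norm_divide)
      also have "\<dots> \<le> (C * (real N powr y / y + real N powr (y - 1))) * (real N powr (-y) * (2 * y / R\<^sup>2))"
        unfolding kern[OF w1(1)] using y C by (intro mult_mono g) auto
      also have "\<dots> = (real N powr y * real N powr (-y)) * (2 * C / R\<^sup>2)
           + (real N powr (y - 1) * real N powr (-y)) * (2 * C * y / R\<^sup>2)"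
        using y by (simp add: field_simps)
      also have "real N powr y * real N powr (-y) = 1" using N by (simp add: powr_add[symmetric])
      also have "real N powr (y - 1) * real N powr (-y) = 1 / N"
      proof -
        have e1: "y - 1 + - y = -1" by simp
        have "real N powr (y - 1) * real N powr (-y) = real N powr (-1)"
          unfolding powr_add[symmetric] e1 ..
        also have "\<dots> = 1 / N" using N by (simp add: powr_minus_divide)
        finally show ?thesis .
      qed
      also have "1 * (2 * C / R\<^sup>2) + 1 / N * (2 * C * y / R\<^sup>2) \<le> 2 * C / R\<^sup>2 + 1 / N * (2 * C * R / R\<^sup>2)"
        using y C by (intro add_mono mult_left_mono divide_right_mono) auto
      also have "\<dots> = 2 * C / R\<^sup>2 + 2 * C / (R * N)" using R by (simp add: field_simps power2_eq_square)
      finally show "norm (G N w * E w / w) \<le> 2 * C / R\<^sup>2 + 2 * C / (R * N)" .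
    qed (use C R in auto)
    have pw: "norm (F w * E w / w) \<le> M * real N powr Re w / norm w" if "w \<in> Kb" for w
    proof -
      have "norm (F w * E w / w) = norm (F w * Q w) * real N powr Re w / norm w"
        using norm_nat_powr[of N w] N by (simp add: E_def norm_mult norm_divide)
      also have "\<dots> \<le> M * real N powr Re w / norm w"
        by (intro divide_right_mono mult_right_mono M that) auto
      finally show ?thesis .
    qed
    have iL: "(\<lambda>w. F w * E w / w) contour_integrable_on linepath u v"
      if "closed_segment u v \<subseteq> path_image \<rho>" for u v
    proof (rule contour_integrable_holomorphic_simple[OF hF0 U0 valid_path_linepath])
      have "path_image \<rho> \<subseteq> U - {0}" using r0 seg KbU unfolding \<rho>im by blast
      then show "path_image (linepath u v) \<subseteq> U - {0}" using that by auto
    qed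
    have pR: "real N powr x \<le> 1" if "x \<le> 0" for x
      using powr_mono[OF that, of "real N"] N by simp
    have bl1: "norm (contour_integral (linepath a1 a2) (\<lambda>w. F w * E w / w)) \<le> M / R * norm (a2 - a1)"
    proof (rule contour_integral_bound_linepath[OF iL])
      fix w assume w: "w \<in> closed_segment a1 a2"
      then have "Im w = R" "Re w \<le> 0" using closed_segment_coordinates[of w a1 a2] \<delta>(1) by (auto simp: a1_def a2_def)
      then have "norm w \<ge> R" using abs_Im_le_cmod[of w] R by simp
      have "M * real N powr Re w / norm w \<le> M * 1 / R"
        using \<open>norm w \<ge> R\<close> R Mp pR[OF \<open>Re w \<le> 0\<close>] by (intro frac_le mult_left_mono) auto
      then show "norm (F w * E w / w) \<le> M / R" using pw[of w] seg[of w] w by simp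
    qed (use Mp R \<rho>im in auto)
    have bl3: "norm (contour_integral (linepath a3 a4) (\<lambda>w. F w * E w / w)) \<le> M / R * norm (a4 - a3)"
    proof (rule contour_integral_bound_linepath[OF iL])
      fix w assume w: "w \<in> closed_segment a3 a4"
      then have "Im w = -R" "Re w \<le> 0" using closed_segment_coordinates[of w a3 a4] \<delta>(1) by (auto simp: a3_def a4_def)
      then have "norm w \<ge> R" using abs_Im_le_cmod[of w] R by simp
      have "M * real N powr Re w / norm w \<le> M * 1 / R"
        using \<open>norm w \<ge> R\<close> R Mp pR[OF \<open>Re w \<le> 0\<close>] by (intro frac_le mult_left_mono) auto
      then show "norm (F w * E w / w) \<le> M / R" using pw[of w] seg[of w] w by simp
    qed (use Mp R \<rho>im in auto)
    have bl2: "norm (contour_integral (linepath a2 a3) (\<lambda>w. F w * E w / w)) \<le> (M / \<delta>) * real N powr (-\<delta>) * norm (a3 - a2)"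
    proof (rule contour_integral_bound_linepath[OF iL])
      fix w assume w: "w \<in> closed_segment a2 a3"
      then have "Re w = -\<delta>" using closed_segment_coordinates[of w a2 a3] by (auto simp: a2_def a3_def)
      then have "norm w \<ge> \<delta>" using abs_Re_le_cmod[of w] \<delta> by simp
      have "M * real N powr Re w / norm w \<le> M * real N powr (-\<delta>) / \<delta>"
        using \<open>norm w \<ge> \<delta>\<close> \<delta> Mp \<open>Re w = -\<delta>\<close> by (intro frac_le mult_left_mono) auto
      then show "norm (F w * E w / w) \<le> (M / \<delta>) * real N powr (-\<delta>)" using pw[of w] seg[of w] w by simp
    qed (use Mp \<delta> \<rho>im in auto)
    have "contour_integral \<rho> (\<lambda>w. F w * E w / w) = contour_integral (linepath a1 a2) (\<lambda>w. F w * E w / w)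
       + (contour_integral (linepath a2 a3) (\<lambda>w. F w * E w / w) + contour_integral (linepath a3 a4) (\<lambda>w. F w * E w / w))"
    proof -
      have i: "(\<lambda>w. F w * E w / w) contour_integrable_on linepath a1 a2"
        "(\<lambda>w. F w * E w / w) contour_integrable_on linepath a2 a3"
        "(\<lambda>w. F w * E w / w) contour_integrable_on linepath a3 a4"
        by (intro iL; use \<rho>im in auto)+
      show ?thesis unfolding \<rho>_def
        by (simp add: contour_integral_join contour_integrable_join i valid_path_join)
    qed
    moreover have "norm (a2 - a1) = \<delta>" "norm (a4 - a3) = \<delta>" "norm (a3 - a2) = 2 * R"
      using \<delta> R by (simp_all add: a1_def a2_def a3_def a4_def cmod_def real_sqrt_mult)
    ultimately have b3: "norm (contour_integral \<rho> (\<lambda>w. F w * E w / w))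
       \<le> 2 * (M / R * \<delta>) + (M / \<delta>) * real N powr (-\<delta>) * (2 * R)"
      using bl1 bl2 bl3 by (smt (verit) norm_triangle_ineq)
    have "2 * pi * \<i> * (F 0 - G N 0) = I1 + contour_integral \<rho> (\<lambda>w. F w * E w / w)
        - contour_integral B (\<lambda>w. G N w * E w / w)"
      unfolding right_diff_distrib id1[symmetric] id2[symmetric] I1[symmetric] by simp
    then have "norm (2 * pi * \<i> * (F 0 - G N 0)) \<le> norm I1 + norm (contour_integral \<rho> (\<lambda>w. F w * E w / w))
        + norm (contour_integral B (\<lambda>w. G N w * E w / w))"
      by (metis (no_types, lifting) norm_triangle_ineq4 norm_triangle_ineq order_trans add_right_mono)
    then show ?thesis using b1 b2 b3 by (simp add: norm_mult)
  qed
  have "(\<lambda>N. (2 * C / R\<^sup>2) * R * pi + (2 * C / R\<^sup>2 + 2 * C / (R * real N)) * R * pi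
      + 2 * (M / R * \<delta>) + (M / \<delta>) * real N powr (-\<delta>) * (2 * R)) \<longlonglongrightarrow>
      (2 * C / R\<^sup>2) * R * pi + (2 * C / R\<^sup>2 + 0) * R * pi + 2 * (M / R * \<delta>) + (M / \<delta>) * 0 * (2 * R)"
    using R \<delta>(1) by (intro tendsto_intros tendsto_divide_0[OF tendsto_const] tendsto_neg_powr
        filterlim_at_top_imp_at_infinity filterlim_tendsto_pos_mult_at_top[OF tendsto_const] filterlim_real_sequentially) auto
  moreover have "(2 * C / R\<^sup>2) * R * pi + (2 * C / R\<^sup>2 + 0) * R * pi + 2 * (M / R * \<delta>) + (M / \<delta>) * 0 * (2 * R) < 2 * pi * e"
  proof -
    have "(2 * C / R\<^sup>2) * R = 2 * C / R" using R by (simp add: power2_eq_square)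
    moreover have "2 * C / R \<le> e / 4" using C e by (simp add: R_def field_simps)
    ultimately have "(2 * C / R\<^sup>2) * R * pi + (2 * C / R\<^sup>2 + 0) * R * pi \<le> e / 4 * pi + e / 4 * pi"
      by (intro add_mono mult_right_mono) auto
    also have "\<dots> = (e * pi) / 2" by simp
    finally have X: "(2 * C / R\<^sup>2) * R * pi + (2 * C / R\<^sup>2 + 0) * R * pi \<le> (e * pi) / 2" (is "?X \<le> _") .
    have "e / 4 < e * pi" using e pi_gt3 by (simp add: field_simps)
    moreover have "2 * (M / R * \<delta>) \<le> e / 4" using \<delta>(3) by (simp add: mult.commute mult.left_commute)
    ultimately have "?X + 2 * (M / R * \<delta>) < e * pi / 2 + e * pi" using X by (intro add_le_less_mono) auto
    also have "\<dots> < 2 * pi * e" using e by simp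
    finally show ?thesis by simp
  qed
  ultimately have "eventually (\<lambda>N. (2 * C / R\<^sup>2) * R * pi + (2 * C / R\<^sup>2 + 2 * C / (R * real N)) * R * pi
      + 2 * (M / R * \<delta>) + (M / \<delta>) * real N powr (-\<delta>) * (2 * R) < 2 * pi * e) sequentially"
    by (rule order_tendstoD)
  then obtain N0 where N0: "\<And>N. N \<ge> N0 \<Longrightarrow> (2 * C / R\<^sup>2) * R * pi + (2 * C / R\<^sup>2 + 2 * C / (R * real N)) * R * pi
      + 2 * (M / R * \<delta>) + (M / \<delta>) * real N powr (-\<delta>) * (2 * R) < 2 * pi * e"
    by (auto simp: eventually_sequentially)
  have "norm ((\<Sum>n<N. b n / of_nat (Suc n)) - F 0) < e" if "N \<ge> max N0 1" for N
  proof -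
    have "2 * pi * norm (F 0 - G N 0) < 2 * pi * e"
      using main[of N] N0[of N] that by (meson le_less_trans max.boundedE)
    then have "norm (F 0 - G N 0) < e" by (subst (asm) mult_less_cancel_left_pos) auto
    moreover have "G N 0 = (\<Sum>n<N. b n / of_nat (Suc n))"
      unfolding G_def by (intro sum.cong refl) (simp add: powr_minus_divide del: of_nat_Suc)
    ultimately show ?thesis by (simp add: norm_minus_commute)
  qed
  then show "\<exists>N1. \<forall>N\<ge>N1. norm ((\<Sum>n<N. b n / of_nat (Suc n)) - F 0) < e" by blast
qed

section \<open>Chebyshev's bound and Dirichlet series\<close>

definition cheb_psi :: "nat \<Rightarrow> real" where "cheb_psi n = (\<Sum>k=1..n. mangoldt k)"

text \<open>Legendre's formula in logarithmic form. From \<open>n\<close> to \<open>n + 1\<close>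
  the quotient \<open>n div d\<close> grows by one exactly for the divisors \<open>d\<close> of
  \<open>n + 1\<close>, and over these \<open>mangoldt\<close> sums to
  \<open>ln (n + 1)\<close>.\<close>

lemma ln_fact_mangoldt: "ln (fact n :: real) = (\<Sum>d=1..n. mangoldt d * real (n div d))"
proof (induction n)
  case (Suc n)
  have "(\<Sum>d=1..Suc n. mangoldt d * real (Suc n div d)) =
     (\<Sum>d=1..Suc n. mangoldt d * real (n div d) + (if d dvd Suc n then mangoldt d else 0))"
    by (intro sum.cong refl) (auto simp: div_Suc dvd_eq_mod_eq_0 algebra_simps)
  also have "\<dots> = (\<Sum>d=1..n. mangoldt d * real (n div d)) + (\<Sum>d=1..Suc n. if d dvd Suc n then mangoldt d else 0)"
    by (simp add: sum.distrib)
  also have "(\<Sum>d=1..Suc n. if d dvd Suc n then mangoldt d else 0) = (\<Sum>d | d dvd Suc n. mangoldt d :: real)"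
    by (intro sum.mono_neutral_cong_right) (auto dest: dvd_imp_le intro!: Suc_leI dvd_pos_nat[of "Suc n"])
  also have "\<dots> = ln (real (Suc n))" by (subst mangoldt_sum) auto
  finally show ?case using Suc.IH by (simp add: ln_mult)
qed simp

text \<open>Chebyshev's argument: the logarithm of the central binomial coefficient is a sum of
  \<open>mangoldt d\<close> with weights \<open>2 * n div d - 2 * (n div d)\<close>, which are
  nonnegative and equal 1 for \<open>n < d \<le> 2 * n\<close>.\<close>

lemma cheb_psi_double: "cheb_psi (2 * n) - cheb_psi n \<le> 2 * real n * ln 2"
proof -
  have c: "real (2 * n choose n) * fact n * fact n = fact (2 * n)"
  proof -
    have "fact n * fact n * (2 * n choose n) = (fact (2 * n) :: nat)"
      using binomial_fact_lemma[of n "2 * n"] by (simp add: mult_2)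
    then have "real (fact n * fact n * (2 * n choose n)) = real (fact (2 * n))" by (rule arg_cong)
    then show ?thesis by (simp only: of_nat_mult of_nat_fact mult_ac)
  qed
  have pos: "real (2 * n choose n) > 0" by simp
  have "ln (fact (2 * n) :: real) = ln (real (2 * n choose n)) + ln (fact n) + ln (fact n)"
    unfolding c[symmetric] using pos by (simp add: ln_mult)
  moreover have "ln (real (2 * n choose n)) \<le> ln (2 ^ (2 * n))"
  proof -
    have "real (2 * n choose n) \<le> real (2 ^ (2 * n))" using binomial_le_pow2[of "2 * n" n] by (simp only: of_nat_le_iff)
    then show ?thesis using pos by (subst ln_le_cancel_iff) simp_all
  qed
  ultimately have 1: "ln (fact (2 * n) :: real) - 2 * ln (fact n) \<le> 2 * real n * ln 2"
    by (simp add: ln_realpow)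
  have "(\<Sum>d=1..n. mangoldt d * real (n div d)) = (\<Sum>d=1..2*n. mangoldt d * real (n div d))"
    by (intro sum.mono_neutral_left) auto
  then have "ln (fact (2 * n) :: real) - 2 * ln (fact n)
      = (\<Sum>d=1..2*n. mangoldt d * (real (2 * n div d) - 2 * real (n div d)))"
    unfolding ln_fact_mangoldt by (simp add: sum_distrib_left sum_subtractf[symmetric] algebra_simps)
  moreover have "(\<Sum>d\<in>{n<..2*n}. mangoldt d * (real (2 * n div d) - 2 * real (n div d))) \<le>
      (\<Sum>d=1..2*n. mangoldt d * (real (2 * n div d) - 2 * real (n div d)))"
  proof (rule sum_mono2)
    fix d
    have "2 * (n div d) \<le> 2 * n div d"
    proof (cases "d = 0")
      case False
      have "d * (n div d) \<le> n" by simp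
      then have "2 * (n div d) * d \<le> 2 * n" by (simp add: mult.commute)
      then show ?thesis using False by (simp add: less_eq_div_iff_mult_less_eq)
    qed simp
    then have "real (2 * (n div d)) \<le> real (2 * n div d)" by (simp only: of_nat_le_iff)
    then have "2 * real (n div d) \<le> real (2 * n div d)" by (simp only: of_nat_mult of_nat_numeral)
    then show "0 \<le> mangoldt d * (real (2 * n div d) - 2 * real (n div d))"
      by (intro mult_nonneg_nonneg mangoldt_nonneg) simp
  qed auto
  moreover have "(\<Sum>d\<in>{n<..2*n}. mangoldt d * (real (2 * n div d) - 2 * real (n div d))) = (\<Sum>d\<in>{n<..2*n}. mangoldt d)"
  proof (rule sum.cong)
    fix d assume d: "d \<in> {n<..2*n}"
    then have "2 * n div d = 1" by (intro div_nat_eqI) auto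
    then show "mangoldt d * (real (2 * n div d) - 2 * real (n div d)) = mangoldt d" using d by simp
  qed simp
  moreover have "(\<Sum>d\<in>{n<..2*n}. mangoldt d) = cheb_psi (2 * n) - cheb_psi n"
  proof -
    have "{1..2*n} = {1..n} \<union> {n<..2*n}" by auto
    then have "cheb_psi (2 * n) = cheb_psi n + (\<Sum>d\<in>{n<..2*n}. mangoldt d)"
      unfolding cheb_psi_def by (simp only:) (subst sum.union_disjoint; force)
    then show ?thesis by simp
  qed
  ultimately show ?thesis using 1 by linarith
qed

lemma mangoldt_le_self: "mangoldt n \<le> real n"
proof (cases "n = 0")
  case False
  then have "mangoldt n \<le> ln (real n)" by (intro mangoldt_le) auto
  also have "\<dots> \<le> real n" using False ln_le_minus_one[of "real n"] by simp
  finally show ?thesis .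
qed simp

lemma cheb_psi_Suc: "cheb_psi (Suc n) = cheb_psi n + mangoldt (Suc n)"
  by (simp add: cheb_psi_def)

lemma cheb_psi_mono: "m \<le> n \<Longrightarrow> cheb_psi m \<le> cheb_psi n"
  unfolding cheb_psi_def by (intro sum_mono2) (auto intro: mangoldt_nonneg)

lemma cheb_psi_nonneg: "cheb_psi n \<ge> 0"
  unfolding cheb_psi_def by (intro sum_nonneg mangoldt_nonneg)

text \<open>Halving: from \<open>m = n div 2\<close> to \<open>2 * m\<close> the doubling estimate
  adds at most \<open>2 * m\<close>, which gives \<open>6 * m \<le> 3 * n\<close>. The remaining
  unit of the constant pays for the crude bound on \<open>mangoldt n\<close> when \<open>n\<close>
  is odd.\<close>

lemma cheb_psi_le: "cheb_psi n \<le> 4 * real n"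
proof (induction n rule: less_induct)
  case (less n)
  show ?case
  proof (cases "n = 0")
    case True then show ?thesis by (simp add: cheb_psi_def)
  next
    case False
    define m where "m = n div 2"
    have "cheb_psi m \<le> 4 * real m" using False less[of m] by (simp add: m_def)
    moreover have "2 * real m * ln 2 \<le> 2 * real m * 1"
      using ln_le_minus_one[of "2::real"] by (intro mult_left_mono) auto
    ultimately have "cheb_psi (2 * m) \<le> 6 * real m" using cheb_psi_double[of m] by simp
    moreover have "cheb_psi n \<le> cheb_psi (2 * m) + real n"
    proof (cases "even n")
      case False
      then have "n = Suc (2 * m)" by (simp add: m_def)
      then show ?thesis using mangoldt_le_self[of n] by (simp add: cheb_psi_Suc)
    qed (simp add: m_def)
    moreover have "2 * m \<le> n" by (simp add: m_def)
    then have "6 * real m \<le> 3 * real n" by linarith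
    ultimately show ?thesis by linarith
  qed
qed

section \<open>Continuation of Dirichlet series past the line of convergence\<close>

text \<open>
  Summed over \<open>n\<close>, the first part gives \<open>(s - 1) \<zeta>(s)\<close> and the rest telescopes to \<open>- 1\<close>. Each term is
  a second-order Taylor remainder of \<open>t powr (1 - s)\<close>, so the series converges for \<open>Re s > 0\<close>.
\<close>

definition zterm :: "nat \<Rightarrow> complex \<Rightarrow> complex" where
  "zterm n s = (s - 1) * of_nat (Suc n) powr (-s) - of_nat (Suc n) powr (1 - s) + of_nat (Suc (Suc n)) powr (1 - s)"

lemma norm_zterm_le:
  assumes "Re s > -1"
  shows "norm (zterm n s) \<le> norm s * norm (s - 1) * real (Suc n) powr (- Re s - 1)"
proof -
  define m where "m = Suc n"
  define S where "S = closed_segment (of_nat m :: complex) (of_nat (Suc m))"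
  define f where "f = (\<lambda>i t::complex. if i = 0 then t powr (1 - s) else if i = (1::nat) then (1 - s) * t powr (-s)
     else (1 - s) * (-s) * t powr (-s - 1))"
  have S: "\<exists>t. x = of_real t \<and> real m \<le> t" if "x \<in> S" for x
  proof -
    from that obtain u where u: "0 \<le> u" "u \<le> 1" "x = (1 - u) *\<^sub>R of_nat m + u *\<^sub>R of_nat (Suc m)"
      by (auto simp: S_def closed_segment_def)
    then have "x = of_real (real m + u)" by (simp add: scaleR_conv_of_real algebra_simps)
    then show ?thesis using u by (intro exI[of _ "real m + u"]) auto
  qed
  have "cmod (f 0 (of_nat (Suc m)) - (\<Sum>i\<le>1. f i (of_nat m) * (of_nat (Suc m) - of_nat m) ^ i / fact i))
     \<le> (norm s * norm (s - 1) * real m powr (- Re s - 1)) * cmod (of_nat (Suc m) - of_nat m) ^ Suc 1 / fact 1"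
  proof (rule complex_Taylor[of S])
    show "convex S" by (simp add: S_def)
    fix x assume "x \<in> S"
    then obtain t where t: "x = of_real t" "real m \<le> t" using S by blast
    then have t0: "t > 0" by (simp add: m_def)
    then have xn: "x \<notin> \<real>\<^sub>\<le>\<^sub>0" using t by (simp add: complex_nonpos_Reals_iff)
    show "cmod (f (Suc 1) x) \<le> norm s * norm (s - 1) * real m powr (- Re s - 1)"
    proof -
      have "cmod (f (Suc 1) x) = norm (1 - s) * norm s * t powr (- Re s - 1)"
        using t t0 by (simp add: f_def norm_mult norm_powr_real_powr)
      \<comment> \<open>\<open>Re s > -1\<close> makes the exponent negative, so the second
        derivative is largest at the left end \<open>m\<close> of the segment.\<close>
      also have "\<dots> \<le> norm (1 - s) * norm s * real m powr (- Re s - 1)"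
        using t assms by (intro mult_left_mono powr_mono2') (auto simp: m_def)
      finally show ?thesis by (simp add: norm_minus_commute mult.commute)
    qed
    fix i :: nat assume "i \<le> 1"
    then have "i = 0 \<or> i = 1" by linarith
    moreover have "(f 0 has_field_derivative f (Suc 0) x) (at x within S)"
    proof -
      have "((\<lambda>t. t powr (1 - s)) has_field_derivative (1 - s) * x powr (1 - s - 1)) (at x within S)"
        by (rule DERIV_subset[OF has_field_derivative_powr[OF xn]]) simp
      then show ?thesis by (simp add: f_def)
    qed
    moreover have "(f 1 has_field_derivative f (Suc 1) x) (at x within S)"
    proof -
      have "((\<lambda>t. (1 - s) * t powr (-s)) has_field_derivative (1 - s) * (-s * x powr (-s - 1))) (at x within S)"
        by (intro DERIV_cmult DERIV_subset[OF has_field_derivative_powr[OF xn]]) simp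
      then show ?thesis by (simp add: f_def mult.assoc)
    qed
    ultimately show "(f i has_field_derivative f (Suc i) x) (at x within S)" by auto
  qed (auto simp: S_def)
  then show ?thesis by (simp add: f_def zterm_def m_def algebra_simps)
qed

text \<open>The weights may grow because two cases are needed: constant ones for zeta, and the error
  of Chebyshev's function with \<open>k = 1\<close>. \<open>zterm\<close> decays by one power more
  than \<open>n powr (-s)\<close>, so the half-plane is \<open>Re s > k\<close> rather than
  \<open>Re s > k + 1\<close>.\<close>

lemma zterm_series:
  fixes c :: "nat \<Rightarrow> complex"
  assumes c: "\<And>n. norm (c n) \<le> C * real (Suc n) powr k" and k: "k \<ge> 0"
  shows "(\<lambda>s. \<Sum>n. c n * zterm n s) holomorphic_on {s. Re s > k}"
    and "Re s > k \<Longrightarrow> summable (\<lambda>n. c n * zterm n s)"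
proof -
  define S where "S = {s. Re s > k}"
  have oS: "open S" by (simp add: S_def open_halfspace_Re_gt)
  have "norm (c 0) \<le> C" using c[of 0] by simp
  then have C: "C \<ge> 0" using norm_ge_zero order_trans by blast
  have "\<exists>g g'. \<forall>x\<in>S. ((\<lambda>n. c n * zterm n x) sums g x) \<and> ((\<lambda>n. deriv (\<lambda>s. c n * zterm n s) x) sums g' x)
      \<and> (g has_field_derivative g' x) (at x)"
  proof (rule series_and_derivative_comparison_local[OF oS])
    fix n x assume "x \<in> S"
    have "(\<lambda>s. c n * zterm n s) holomorphic_on UNIV" unfolding zterm_def
      by (intro holomorphic_intros) (auto simp del: of_nat_Suc)
    then show "((\<lambda>s. c n * zterm n s) has_field_derivative deriv (\<lambda>s. c n * zterm n s) x) (at x)"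
      by (rule holomorphic_derivI) auto
  next
    fix x assume x: "x \<in> S"
    define d where "d = (Re x - k) / 2"
    have d: "d > 0" using x by (simp add: d_def S_def)
    define h where "h = (\<lambda>n. C * ((norm x + d) * (norm x + d + 1)) * real (Suc n) powr (-1 - d))"
    have "summable (\<lambda>n. real n powr (-1 - d))" using d by (simp add: summable_real_powr_iff)
    then have sh: "summable h" unfolding h_def by (intro summable_mult) (subst summable_Suc_iff)
    have "norm (c n * zterm n y) \<le> h n" if y: "y \<in> ball x d" for n y
    proof -
      have ny: "norm (x - y) < d" using y by (simp add: dist_norm)
      have "\<bar>Re x - Re y\<bar> < d" using abs_Re_le_cmod[of "x - y"] ny by simp
      then have Ry: "Re y > k + d" by (simp add: d_def field_simps abs_if split: if_splits)
      have n1: "norm y \<le> norm x + d" using norm_triangle_sub[of y x] ny by (simp add: norm_minus_commute)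
      have n2: "norm (y - 1) \<le> norm x + d + 1" using norm_triangle_ineq4[of y 1] n1 by simp
      have "norm (c n * zterm n y) \<le> (C * real (Suc n) powr k) * (norm y * norm (y - 1) * real (Suc n) powr (- Re y - 1))"
        unfolding norm_mult[of "c n"] using Ry k d C
        by (intro mult_mono c norm_zterm_le) auto
      also have "\<dots> = C * (norm y * norm (y - 1)) * real (Suc n) powr (k - Re y - 1)"
        proof -
        have "real (Suc n) powr k * real (Suc n) powr (- Re y - 1) = real (Suc n) powr (k - Re y - 1)"
          unfolding powr_add[symmetric] by (simp del: of_nat_Suc add: algebra_simps)
        then have "(C * (norm y * norm (y - 1))) * (real (Suc n) powr k * real (Suc n) powr (- Re y - 1))
          = (C * (norm y * norm (y - 1))) * real (Suc n) powr (k - Re y - 1)" by (rule arg_cong)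
        then show ?thesis by (simp only: mult_ac)
      qed
      also have "\<dots> \<le> C * ((norm x + d) * (norm x + d + 1)) * real (Suc n) powr (-1 - d)"
        using Ry n1 n2 C d by (intro mult_mono powr_mono) auto
      finally show ?thesis by (simp add: h_def)
    qed
    then show "\<exists>d h. 0 < d \<and> summable h \<and> (\<forall>\<^sub>F n in sequentially. \<forall>y\<in>ball x d \<inter> S. norm (c n * zterm n y) \<le> h n)"
      using d sh by (intro exI[of _ d] exI[of _ h]) auto
  qed
  then obtain g g' where g: "\<And>x. x \<in> S \<Longrightarrow> (\<lambda>n. c n * zterm n x) sums g x"
    "\<And>x. x \<in> S \<Longrightarrow> (g has_field_derivative g' x) (at x)" by blast
  have "g holomorphic_on S" using g(2) oS by (auto simp: holomorphic_on_open)
  then show "(\<lambda>s. \<Sum>n. c n * zterm n s) holomorphic_on {s. Re s > k}"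
    unfolding S_def[symmetric] by (rule holomorphic_transform) (use g(1) in \<open>simp add: sums_iff\<close>)
  show "Re s > k \<Longrightarrow> summable (\<lambda>n. c n * zterm n s)"
    using g(1)[of s] by (auto simp: S_def sums_iff)
qed

section \<open>Dirichlet series with logarithmically bounded coefficients\<close>

lemma one_plus_ln_le:
  assumes "d > 0" "n > 0"
  shows "1 + ln (real n) \<le> (1 + 1 / d) * real n powr d"
proof -
  have "ln (real n) \<le> real n powr d / d" using assms by (intro ln_powr_bound) auto
  moreover have "1 \<le> real n powr d" using assms by (intro ge_one_powr_ge_zero) auto
  ultimately show ?thesis by (simp add: algebra_simps)
qed

text \<open>The bound \<open>1 + ln n\<close> covers the coefficients 1, \<open>ln\<close> and
  \<open>mangoldt\<close> at once; the logarithm is absorbed by giving up \<open>d\<close> of the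
  exponent.\<close>

lemma dirichlet_term_bound:
  fixes a :: complex
  assumes a: "norm a \<le> 1 + ln (real n)" and d: "d > 0" and s: "Re s \<ge> 1 + 2 * d"
  shows "norm (a * of_nat n powr (-s)) \<le> (1 + 1 / d) * real n powr (-1 - d)"
proof (cases "n = 0")
  case False
  have "norm (a * of_nat n powr (-s)) = norm a * real n powr (- Re s)"
    using False norm_nat_powr[of n "-s"] by (simp add: norm_mult)
  also have "\<dots> \<le> ((1 + 1 / d) * real n powr d) * real n powr (-1 - 2 * d)"
    using one_plus_ln_le[OF d, of n] a s d False by (intro mult_mono powr_mono) auto
  also have "\<dots> = (1 + 1 / d) * (real n powr d * real n powr (-1 - 2 * d))" by simp
  also have "\<dots> = (1 + 1 / d) * real n powr (-1 - d)"
  proof -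
    have "d + (-1 - 2 * d) = -1 - d" by simp
    then show ?thesis by (simp only: powr_add[symmetric])
  qed
  finally show ?thesis .
qed simp

lemma dirichlet_summable:
  fixes a :: "nat \<Rightarrow> complex"
  assumes a: "\<And>n. n > 0 \<Longrightarrow> norm (a n) \<le> 1 + ln (real n)" and s: "Re s > 1"
  shows "summable (\<lambda>n. norm (a n * of_nat n powr (-s)))"
proof (rule summable_comparison_test)
  define d where "d = (Re s - 1) / 2"
  have d: "d > 0" using s by (simp add: d_def)
  show "summable (\<lambda>n. (1 + 1 / d) * real n powr (-1 - d))"
    using d by (intro summable_mult) (simp add: summable_real_powr_iff)
  show "\<exists>N. \<forall>n\<ge>N. norm (norm (a n * of_nat n powr (-s))) \<le> (1 + 1 / d) * real n powr (-1 - d)"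
  proof (intro exI[of _ 1] allI impI)
    fix n :: nat assume "1 \<le> n"
    moreover have "1 + 2 * d \<le> Re s" by (simp add: d_def field_simps)
    ultimately show "norm (norm (a n * of_nat n powr (-s))) \<le> (1 + 1 / d) * real n powr (-1 - d)"
      using dirichlet_term_bound[OF a d, of n s] by simp
  qed
qed

lemma dirichlet_deriv:
  fixes a :: "nat \<Rightarrow> complex"
  assumes a: "\<And>n. n > 0 \<Longrightarrow> norm (a n) \<le> 1 + ln (real n)" and s: "Re s > 1"
  shows "summable (\<lambda>n. of_real (ln (real n)) * a n * of_nat n powr (-s))"
    and "((\<lambda>s. \<Sum>n. a n * of_nat n powr (-s)) has_field_derivative
      - (\<Sum>n. of_real (ln (real n)) * a n * of_nat n powr (-s))) (at s)"
proof -
  define S where "S = {s. Re s > 1}"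
  have oS: "open S" by (simp add: S_def open_halfspace_Re_gt)
  have "\<exists>g g'. \<forall>x\<in>S. ((\<lambda>n. a n * of_nat n powr (-x)) sums g x) \<and>
      ((\<lambda>n. - (of_real (ln (real n)) * a n * of_nat n powr (-x))) sums g' x)
      \<and> (g has_field_derivative g' x) (at x)"
  proof (rule series_and_derivative_comparison_local[OF oS])
    fix n :: nat and x assume "x \<in> S"
    show "((\<lambda>s. a n * of_nat n powr (-s)) has_field_derivative - (of_real (ln (real n)) * a n * of_nat n powr (-x))) (at x)"
    proof (cases "n = 0")
      case False
      have "((\<lambda>s. a n * exp (- s * of_real (ln (real n)))) has_field_derivative
          a n * (exp (- x * of_real (ln (real n))) * - of_real (ln (real n)))) (at x)"
        by (rule derivative_eq_intros refl | simp)+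
      then show ?thesis using False by (simp add: powr_def Ln_of_nat mult_ac)
    qed simp
  next
    fix x assume x: "x \<in> S"
    \<comment> \<open>A ball of radius \<open>d\<close> around \<open>x\<close> then stays in
      \<open>Re y \<ge> 1 + 2 * d\<close>, where the term bound applies uniformly.\<close>
    define d where "d = (Re x - 1) / 3"
    have d: "d > 0" using x by (simp add: d_def S_def)
    have "norm (a n * of_nat n powr (-y)) \<le> (1 + 1 / d) * real n powr (-1 - d)" if y: "y \<in> ball x d" and n: "n \<ge> 1" for n y
    proof -
      have ny: "norm (x - y) < d" using y by (simp add: dist_norm)
      have "\<bar>Re x - Re y\<bar> < d" using abs_Re_le_cmod[of "x - y"] ny by simp
      then have "Re y \<ge> 1 + 2 * d" by (simp add: d_def field_simps abs_if split: if_splits)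
      then show ?thesis using dirichlet_term_bound[OF a d, of n y] n by simp
    qed
    moreover have "summable (\<lambda>n. (1 + 1 / d) * real n powr (-1 - d))"
      using d by (intro summable_mult) (simp add: summable_real_powr_iff)
    ultimately show "\<exists>d h. 0 < d \<and> summable h \<and> (\<forall>\<^sub>F n in sequentially. \<forall>y\<in>ball x d \<inter> S. norm (a n * of_nat n powr (-y)) \<le> h n)"
      using d by (intro exI[of _ d] exI[of _ "\<lambda>n. (1 + 1 / d) * real n powr (-1 - d)"] conjI
          eventually_sequentiallyI[of 1]) auto
  qed
  then obtain g g' where g: "\<And>x. x \<in> S \<Longrightarrow> (\<lambda>n. a n * of_nat n powr (-x)) sums g x"
    "\<And>x. x \<in> S \<Longrightarrow> (\<lambda>n. - (of_real (ln (real n)) * a n * of_nat n powr (-x))) sums g' x"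
    "\<And>x. x \<in> S \<Longrightarrow> (g has_field_derivative g' x) (at x)" by blast
  have sS: "s \<in> S" using s by (simp add: S_def)
  have g'': "(\<lambda>n. (of_real (ln (real n)) * a n * of_nat n powr (-s))) sums (- g' s)"
    using sums_minus[OF g(2)[OF sS]] by simp
  then show "summable (\<lambda>n. of_real (ln (real n)) * a n * of_nat n powr (-s))" by (simp add: sums_iff)
  have "((\<lambda>s. \<Sum>n. a n * of_nat n powr (-s)) has_field_derivative g' s) (at s)"
    by (rule has_field_derivative_transform_within_open[OF g(3)[OF sS] oS sS])
      (use g(1) in \<open>simp add: sums_iff\<close>)
  then show "((\<lambda>s. \<Sum>n. a n * of_nat n powr (-s)) has_field_derivative
      - (\<Sum>n. of_real (ln (real n)) * a n * of_nat n powr (-s))) (at s)"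
    using g'' by (simp add: sums_iff)
qed

section \<open>The zeta function on the line of real part 1\<close>

lemma nat_powr_mult: "of_nat (a * b) powr z = (of_nat a powr z * of_nat b powr z :: complex)"
proof (cases "a = 0 \<or> b = 0")
  case False
  then have "Ln (of_nat (a * b)) = Ln (of_nat a) + Ln (of_nat b)"
    using ln_mult[of "real a" "real b"] by (simp add: Ln_of_nat del: of_nat_mult) (simp flip: of_real_add)
  then show ?thesis using False by (simp add: powr_def exp_add[symmetric] algebra_simps)
qed auto

text \<open>This is \<open>(s - 1) * zeta(s)\<close>, continued to \<open>Re s > 0\<close>. With the
  pole multiplied out, 1 becomes an ordinary point, of value 1.\<close>

definition zeta_reg :: "complex \<Rightarrow> complex" where "zeta_reg s = 1 + (\<Sum>n. zterm n s)"

definition zeta_series :: "complex \<Rightarrow> complex" where "zeta_series s = (\<Sum>n. of_nat n powr (-s))"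

text \<open>For \<open>Re s > 1\<close> this is the negative logarithmic derivative of zeta.\<close>

definition mangoldt_series :: "complex \<Rightarrow> complex" where
  "mangoldt_series s = (\<Sum>n. mangoldt n * of_nat n powr (-s))"

lemma zeta_reg_holomorphic: "zeta_reg holomorphic_on {s. Re s > 0}"
proof -
  have "(\<lambda>s. \<Sum>n. 1 * zterm n s) holomorphic_on {s. Re s > 0}"
    by (rule zterm_series(1)[of _ 1]) auto
  then show ?thesis unfolding zeta_reg_def by (intro holomorphic_intros) simp
qed

lemma zeta_reg_1: "zeta_reg 1 = 1"
proof -
  have "zterm n 1 = 0" for n by (simp add: zterm_def del: of_nat_Suc)
  then show ?thesis by (simp add: zeta_reg_def)
qed

lemma mangoldt_le_one_plus_ln: "n > 0 \<Longrightarrow> norm (mangoldt n :: complex) \<le> 1 + ln (real n)"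
  using mangoldt_le[of n] by simp

lemma zeta_norm_summable: "Re s > 1 \<Longrightarrow> summable (\<lambda>n. norm (of_nat n powr (-s) :: complex))"
  using dirichlet_summable[of "\<lambda>_. 1" s] by simp

lemma mangoldt_norm_summable: "Re s > 1 \<Longrightarrow> summable (\<lambda>n. norm (mangoldt n * of_nat n powr (-s) :: complex))"
  using dirichlet_summable[OF mangoldt_le_one_plus_ln, of s] .

lemma zeta_series_sums: "Re s > 1 \<Longrightarrow> (\<lambda>n. of_nat n powr (-s)) sums zeta_series s"
  unfolding zeta_series_def by (intro summable_sums summable_norm_cancel[OF zeta_norm_summable])

lemma mangoldt_series_sums: "Re s > 1 \<Longrightarrow> (\<lambda>n. mangoldt n * of_nat n powr (-s)) sums mangoldt_series s"
  unfolding mangoldt_series_def by (intro summable_sums summable_norm_cancel[OF mangoldt_norm_summable])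

lemma nat_powr_tendsto_0: "Re w < 0 \<Longrightarrow> (\<lambda>N. of_nat (Suc N) powr w :: complex) \<longlonglongrightarrow> 0"
proof (rule tendsto_norm_zero_cancel)
  assume w: "Re w < 0"
  have "(\<lambda>N. real (Suc N) powr Re w) \<longlonglongrightarrow> 0"
    by (rule tendsto_neg_powr[OF w]) (rule filterlim_compose[OF filterlim_real_sequentially filterlim_Suc])
  then show "(\<lambda>N. norm (of_nat (Suc N) powr w :: complex)) \<longlonglongrightarrow> 0"
    by (simp add: norm_nat_powr del: of_nat_Suc)
qed

lemma zeta_reg_eq:
  assumes s: "Re s > 1"
  shows "zeta_reg s = (s - 1) * zeta_series s"
proof -
  have part: "(\<Sum>n<N. zterm n s) = (s - 1) * (\<Sum>n<N. of_nat (Suc n) powr (-s)) - 1 + of_nat (Suc N) powr (1 - s)" for N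
  proof (induction N)
    case (Suc N)
    then show ?case by (simp add: zterm_def algebra_simps del: of_nat_Suc)
  qed simp
  have "(\<lambda>n. of_nat (Suc n) powr (-s)) sums zeta_series s"
    using zeta_series_sums[OF s] by (subst sums_Suc_iff) simp
  then have "(\<lambda>N. (s - 1) * (\<Sum>n<N. of_nat (Suc n) powr (-s)) - 1 + of_nat (Suc N) powr (1 - s))
     \<longlonglongrightarrow> (s - 1) * zeta_series s - 1 + 0"
    using s by (intro tendsto_intros nat_powr_tendsto_0) (simp_all add: sums_def)
  then have "(\<lambda>n. zterm n s) sums ((s - 1) * zeta_series s - 1)"
    unfolding sums_def part by simp
  then show ?thesis by (simp add: zeta_reg_def sums_iff)
qed

lemma infsum_pos_eq_suminf:
  fixes g :: "nat \<Rightarrow> complex"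
  assumes "summable (\<lambda>n. norm (g n))" "g 0 = 0"
  shows "infsum g {0<..} = suminf g" "(\<lambda>n. norm (g n)) summable_on {0<..}"
proof -
  have "(g has_sum suminf g) UNIV"
    by (rule norm_summable_imp_has_sum[OF assms(1)]) (rule summable_sums[OF summable_norm_cancel[OF assms(1)]])
  then have "infsum g UNIV = suminf g" by (rule infsumI)
  moreover have "infsum g {0<..} = infsum g UNIV"
    by (rule infsum_cong_neutral) (use assms(2) in \<open>auto simp: greaterThan_def\<close>)
  ultimately show "infsum g {0<..} = suminf g" by simp
  have "(\<lambda>n. norm (g n)) summable_on UNIV" using assms(1) by (intro norm_summable_imp_summable_on) simp
  then show "(\<lambda>n. norm (g n)) summable_on {0<..}" by (rule summable_on_subset_banach) simp
qed

text \<open>The Dirichlet convolution of \<open>mangoldt\<close> with 1 is \<open>ln\<close>: the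
  double series over \<open>(d, m)\<close> converges absolutely and is regrouped by the product
  \<open>k = d * m\<close>.\<close>

lemma zeta_mangoldt_product:
  assumes s: "Re s > 1"
  shows "zeta_series s * mangoldt_series s = (\<Sum>n. of_real (ln (real n)) * of_nat n powr (-s))"
proof -
  define f where "f = (\<lambda>d::nat. mangoldt d * of_nat d powr (-s) :: complex)"
  define h where "h = (\<lambda>d::nat. of_nat d powr (-s) :: complex)"
  define g where "g = (\<lambda>n::nat. of_real (ln (real n)) * of_nat n powr (-s) :: complex)"
  \<comment> \<open>Index 0 is dropped: every number divides it, so its set of divisors would be
    infinite. Its term is 0, hence no sum changes.\<close>
  define X where "X = {0::nat<..}"
  have f: "infsum f X = mangoldt_series s" "(\<lambda>n. norm (f n)) summable_on X"
    using infsum_pos_eq_suminf[of f] mangoldt_norm_summable[OF s] by (auto simp: f_def X_def mangoldt_series_def)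
  have h: "infsum h X = zeta_series s" "(\<lambda>n. norm (h n)) summable_on X"
    using infsum_pos_eq_suminf[of h] zeta_norm_summable[OF s] by (auto simp: h_def X_def zeta_series_def)
  have g: "infsum g X = suminf g"
    using infsum_pos_eq_suminf(1)[of g] dirichlet_summable[of "\<lambda>n. of_real (ln (real n))" s] s by (auto simp: g_def X_def)
  have P: "(\<lambda>x. norm ((\<lambda>(d, m). f d * h m) x)) summable_on (X \<times> X)"
    unfolding Infinite_Sum.abs_summable_on_Sigma_iff using f(2) h(2) infsum_nonneg[of X "\<lambda>y. norm (h y)"]
    by (auto simp: norm_mult abs_mult infsum_cmult_right' intro!: summable_on_cmult_right summable_on_cmult_left)
  have "infsum (\<lambda>(d, m). f d * h m) (X \<times> X) = infsum (\<lambda>d. infsum (\<lambda>m. f d * h m) X) X"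
    using infsum_Sigma'_banach[OF abs_summable_summable[OF P]] by simp
  also have "\<dots> = infsum f X * infsum h X"
    by (simp add: infsum_cmult_right' infsum_cmult_left')
  finally have 1: "infsum (\<lambda>(d, m). f d * h m) (X \<times> X) = infsum f X * infsum h X" .
  define \<phi> where "\<phi> = (\<lambda>(k::nat, d::nat). (d, k div d))"
  define Y where "Y = Sigma X (\<lambda>k. {d. d dvd k})"
  have bij: "bij_betw \<phi> Y (X \<times> X)"
    by (rule bij_betwI[where g = "\<lambda>(d, m). (d * m, d)"])
       (auto simp: \<phi>_def Y_def X_def div_greater_zero_iff intro: dvd_imp_le dvd_pos_nat)
  have 2: "infsum (\<lambda>y. (\<lambda>(d, m). f d * h m) (\<phi> y)) Y = infsum (\<lambda>(d, m). f d * h m) (X \<times> X)"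
    by (rule infsum_reindex_bij_betw[OF bij])
  have sY: "(\<lambda>y. (\<lambda>(d, m). f d * h m) (\<phi> y)) summable_on Y"
    unfolding summable_on_reindex_bij_betw[OF bij] by (rule abs_summable_summable[OF P])
  have "infsum (\<lambda>y. (\<lambda>(d, m). f d * h m) (\<phi> y)) Y = infsum (\<lambda>k. infsum (\<lambda>d. (\<lambda>(d, m). f d * h m) (\<phi> (k, d))) {d. d dvd k}) X"
    using infsum_Sigma_banach[OF sY[unfolded Y_def]] by (simp add: Y_def)
  also have "\<dots> = infsum g X"
  proof (rule infsum_cong)
    fix k assume k: "k \<in> X"
    have fin: "finite {d. d dvd k}" using k by (auto simp: X_def)
    have "infsum (\<lambda>d. (\<lambda>(d, m). f d * h m) (\<phi> (k, d))) {d. d dvd k} = (\<Sum>d | d dvd k. f d * h (k div d))"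
      using fin by (simp add: \<phi>_def)
    also have "\<dots> = (\<Sum>d | d dvd k. mangoldt d * of_nat k powr (-s))"
    proof (rule sum.cong)
      fix d assume "d \<in> {d. d dvd k}"
      then have "of_nat d powr (-s) * of_nat (k div d) powr (-s) = (of_nat k powr (-s) :: complex)"
        by (simp add: nat_powr_mult[symmetric] del: of_nat_mult)
      then show "f d * h (k div d) = mangoldt d * of_nat k powr (-s)" by (simp add: f_def h_def mult.assoc)
    qed simp
    also have "\<dots> = g k" using k mangoldt_sum[of k, where ?'a = complex] by (simp add: sum_distrib_right[symmetric] g_def X_def)
    finally show "infsum (\<lambda>d. (\<lambda>(d, m). f d * h m) (\<phi> (k, d))) {d. d dvd k} = g k" .
  qed
  finally show ?thesis using 1 2 f(1) h(1) g by (simp add: g_def mult.commute)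
qed

lemma zeta_series_deriv:
  assumes s: "Re s > 1"
  shows "(zeta_series has_field_derivative - (zeta_series s * mangoldt_series s)) (at s)"
proof -
  have "((\<lambda>s. \<Sum>n. 1 * of_nat n powr (-s)) has_field_derivative
      - (\<Sum>n. of_real (ln (real n)) * 1 * of_nat n powr (-s))) (at s)"
    by (rule dirichlet_deriv(2)[OF _ s]) simp
  then show ?thesis
    unfolding zeta_mangoldt_product[OF s] by (simp add: zeta_series_def[abs_def])
qed

lemma mangoldt_series_holomorphic: "mangoldt_series holomorphic_on {s. Re s > 1}"
proof -
  have "(mangoldt_series has_field_derivative - (\<Sum>n. of_real (ln (real n)) * mangoldt n * of_nat n powr (-s))) (at s)"
    if "Re s > 1" for s
    using dirichlet_deriv(2)[OF mangoldt_le_one_plus_ln that] unfolding mangoldt_series_def[abs_def] by simp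
  then show ?thesis by (auto simp: holomorphic_on_open open_halfspace_Re_gt)
qed

text \<open>The equation \<open>\<zeta>' = - \<zeta> L\<close> is linear, so a zero would force \<open>\<zeta>\<close> to vanish identically.\<close>

lemma zeta_reg_nonzero_gt1:
  assumes s: "Re s > 1"
  shows "zeta_reg s \<noteq> 0"
proof
  assume 0: "zeta_reg s = 0"
  have z0: "zeta_series s = 0" using 0 zeta_reg_eq[OF s] s by auto
  define H where "H = {s. Re s > 1}"
  have cH: "convex H" "open H" by (auto simp: H_def convex_halfspace_Re_gt open_halfspace_Re_gt)
  \<comment> \<open>\<open>exp (E x)\<close> is an integrating factor: the product
    \<open>zeta_series x * exp (E x)\<close> has derivative 0 and is constant on the
    half-plane.\<close>
  obtain E where E: "\<And>x. x \<in> H \<Longrightarrow> (E has_field_derivative mangoldt_series x) (at x)"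
    using holomorphic_convex_primitive'[OF cH mangoldt_series_holomorphic[folded H_def]]
    by (metis at_within_open cH(2))
  have "((\<lambda>x. zeta_series x * exp (E x)) has_field_derivative 0) (at x within H)" if "x \<in> H" for x
  proof -
    have "((\<lambda>x. zeta_series x * exp (E x)) has_field_derivative
        zeta_series x * (exp (E x) * mangoldt_series x) + - (zeta_series x * mangoldt_series x) * exp (E x)) (at x)"
      using that by (intro DERIV_mult'[OF zeta_series_deriv DERIV_chain2[OF DERIV_exp E]]) (simp_all add: H_def)
    then show ?thesis by (simp add: has_field_derivative_at_within algebra_simps)
  qed
  then have "\<exists>c. \<forall>x\<in>H. zeta_series x * exp (E x) = c"
    by (rule has_field_derivative_zero_constant[OF cH(1)])
  then obtain c where c: "\<And>x. x \<in> H \<Longrightarrow> zeta_series x * exp (E x) = c" by metis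
  have "c = 0" using c[of s] z0 s by (simp add: H_def)
  then have all0: "zeta_reg x = 0" if "x \<in> H" for x
    using that c[of x] zeta_reg_eq[of x] by (simp add: H_def)
  \<comment> \<open>Vanishing on the whole half-plane contradicts the value 1 at its boundary point
    1, by continuity.\<close>
  have "(\<lambda>n. zeta_reg (1 + of_real (inverse (real (Suc n))))) \<longlonglongrightarrow> zeta_reg 1"
  proof (rule isCont_tendsto_compose[of 1 zeta_reg])
    show "isCont zeta_reg 1"
      using holomorphic_on_imp_continuous_on[OF zeta_reg_holomorphic]
      by (simp add: continuous_on_eq_continuous_at open_halfspace_Re_gt)
    have "(\<lambda>n. 1 + complex_of_real (inverse (real (Suc n)))) \<longlonglongrightarrow> 1 + of_real 0"
      by (intro tendsto_intros LIMSEQ_inverse_real_of_nat)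
    then show "(\<lambda>n. 1 + complex_of_real (inverse (real (Suc n)))) \<longlonglongrightarrow> 1" by simp
  qed
  moreover have "zeta_reg (1 + of_real (inverse (real (Suc n)))) = 0" for n
    by (rule all0) (simp add: H_def)
  ultimately show False by (simp add: zeta_reg_1 LIMSEQ_const_iff)
qed

lemma mangoldt_series_eq:
  assumes s: "Re s > 1"
  shows "mangoldt_series s = 1 / (s - 1) - deriv zeta_reg s / zeta_reg s"
proof -
  have oH: "open {s. Re s > 1}" by (simp add: open_halfspace_Re_gt)
  have "((\<lambda>s. (s - 1) * zeta_series s) has_field_derivative
      (s - 1) * - (zeta_series s * mangoldt_series s) + 1 * zeta_series s) (at s)"
    by (rule DERIV_mult' zeta_series_deriv[OF s] derivative_eq_intros refl | simp)+
  then have "(zeta_reg has_field_derivative (s - 1) * - (zeta_series s * mangoldt_series s) + 1 * zeta_series s) (at s)"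
    by (rule has_field_derivative_transform_within_open[OF _ oH]) (use s in \<open>auto simp: zeta_reg_eq\<close>)
  then have "deriv zeta_reg s = zeta_series s - zeta_reg s * mangoldt_series s"
    by (simp add: DERIV_imp_deriv zeta_reg_eq[OF s] algebra_simps)
  moreover have "zeta_reg s \<noteq> 0" "s \<noteq> 1" using zeta_reg_nonzero_gt1[OF s] s by auto
  moreover have "zeta_series s = zeta_reg s / (s - 1)" using \<open>s \<noteq> 1\<close> by (simp add: zeta_reg_eq[OF s])
  ultimately show ?thesis by (simp add: field_simps)
qed

text \<open>The limit is the order of vanishing at \<open>z\<close>: the factorisation
  \<open>f w = (w - z)^n * g w\<close> splits \<open>n / (w - z)\<close> off the logarithmic
  derivative, and the rest is continuous at \<open>z\<close>. The point \<open>w\<close> excludes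
  that \<open>f\<close> vanishes identically.\<close>

lemma log_deriv_limit:
  assumes f: "f holomorphic_on S" "open S" "connected S" and z: "z \<in> S" and w: "w \<in> S" "f w \<noteq> 0"
  shows "\<exists>k::nat. (f z = 0 \<longrightarrow> k > 0) \<and>
     ((\<lambda>x::real. of_real x * (deriv f (z + of_real x) / f (z + of_real x))) \<longlongrightarrow> of_nat k) (at_right 0)"
proof -
  have lim: "((\<lambda>x::real. z + of_real x) \<longlongrightarrow> z + of_real 0) (at_right 0)" by (intro tendsto_intros)
  have comp: "((\<lambda>x::real. g (z + of_real x)) \<longlongrightarrow> g z) (at_right 0)" if "isCont g z" for g :: "complex \<Rightarrow> complex"
    using isCont_tendsto_compose[OF that, of "\<lambda>x::real. z + of_real x"] lim by simp
  have x0: "((\<lambda>x::real. complex_of_real x) \<longlongrightarrow> of_real 0) (at_right 0)" by (intro tendsto_intros)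
  show ?thesis
  proof (cases "f z = 0")
    case False
    have "isCont f z" "isCont (deriv f) z"
      using f z holomorphic_on_imp_continuous_on holomorphic_deriv continuous_on_eq_continuous_at by blast+
    then have "((\<lambda>x::real. of_real x * (deriv f (z + of_real x) / f (z + of_real x))) \<longlongrightarrow> of_real 0 * (deriv f z / f z)) (at_right 0)"
      using False by (intro tendsto_mult tendsto_divide comp x0)
    then show ?thesis using False by (intro exI[of _ 0]) simp
  next
    case True
    have nc: "\<not> f constant_on S" using True z w unfolding constant_on_def by metis
    obtain g r n where g: "0 < n" "0 < r" "ball z r \<subseteq> S" "g holomorphic_on ball z r"
        "\<And>w. w \<in> ball z r \<Longrightarrow> f w = (w - z)^n * g w" "\<And>w. w \<in> ball z r \<Longrightarrow> g w \<noteq> 0"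
      using holomorphic_factor_zero_nonconstant[OF f z True nc] by metis
    have gz: "g z \<noteq> 0" using g by simp
    have "isCont g z" "isCont (deriv g) z"
      using holomorphic_on_imp_continuous_on[OF g(4)] holomorphic_on_imp_continuous_on[OF holomorphic_deriv[OF g(4) open_ball]]
        centre_in_ball[of z r] g(2) by (simp_all only: continuous_on_eq_continuous_at[OF open_ball])
    then have "((\<lambda>x::real. of_nat n + of_real x * (deriv g (z + of_real x) / g (z + of_real x))) \<longlongrightarrow> of_nat n + of_real 0 * (deriv g z / g z)) (at_right 0)"
      using gz by (intro tendsto_add tendsto_const tendsto_mult tendsto_divide comp x0)
    moreover have "eventually (\<lambda>x::real. of_nat n + of_real x * (deriv g (z + of_real x) / g (z + of_real x))
       = of_real x * (deriv f (z + of_real x) / f (z + of_real x))) (at_right 0)"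
      unfolding eventually_at_right_field
    proof (intro exI[of _ r] conjI allI impI g(2))
      fix x :: real assume x: "0 < x" "x < r"
      define w where "w = z + of_real x"
      have wb: "w \<in> ball z r" using x by (simp add: w_def dist_norm)
      have wz: "w - z = of_real x" "w - z \<noteq> 0" using x by (simp_all add: w_def)
      have dg: "(g has_field_derivative deriv g w) (at w)"
        using g(4) wb holomorphic_derivI[of g "ball z r"] by auto
      have "((\<lambda>w. (w - z)^n * g w) has_field_derivative
           (w - z)^n * deriv g w + (of_nat n * (w - z)^(n - 1)) * g w) (at w)"
        by (rule DERIV_mult' dg derivative_eq_intros refl | simp)+
      then have "(f has_field_derivative (w - z)^n * deriv g w + (of_nat n * (w - z)^(n - 1)) * g w) (at w)"
        by (rule has_field_derivative_transform_within_open[OF _ open_ball wb]) (simp add: g(5))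
      then have df: "deriv f w = (w - z)^n * deriv g w + (of_nat n * (w - z)^(n - 1)) * g w"
        by (rule DERIV_imp_deriv)
      have pw: "(w - z) * (w - z)^(n - 1) = (w - z)^n" using g(1) by (metis power_minus_mult mult.commute)
      have "(w - z) * deriv f w = (w - z)^n * ((w - z) * deriv g w + of_nat n * g w)"
        unfolding df pw[symmetric] by (simp add: algebra_simps)
      then have "(w - z) * (deriv f w / f w) = of_nat n + (w - z) * (deriv g w / g w)"
        using g(5,6)[OF wb] wz by (simp add: field_simps)
      then show "of_nat n + of_real x * (deriv g (z + of_real x) / g (z + of_real x))
          = of_real x * (deriv f (z + of_real x) / f (z + of_real x))"
        unfolding wz(1) by (simp add: w_def)
    qed
    ultimately have "((\<lambda>x::real. of_real x * (deriv f (z + of_real x) / f (z + of_real x))) \<longlongrightarrow> of_nat n + of_real 0 * (deriv g z / g z)) (at_right 0)"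
      by (rule Lim_transform_eventually)
    then show ?thesis using g(1) by (intro exI[of _ n]) simp
  qed
qed

text \<open>The classical \<open>3 + 4 cos x + cos 2x = 2 (1 + cos x)^2 \<ge> 0\<close>, applied to
  each term with \<open>x = t * ln n\<close>.\<close>

lemma mangoldt_341:
  fixes \<sigma> t :: real
  assumes "\<sigma> > 0"
  shows "Re (3 * mangoldt_series (1 + of_real \<sigma>) + 4 * mangoldt_series (1 + \<i> * of_real t + of_real \<sigma>)
     + mangoldt_series (1 + \<i> * of_real (2 * t) + of_real \<sigma>)) \<ge> 0"
proof -
  have s: "(\<lambda>n. mangoldt n * of_nat n powr (- (1 + \<i> * of_real u + of_real \<sigma>)))
     sums mangoldt_series (1 + \<i> * of_real u + of_real \<sigma>)" for u
    using assms by (intro mangoldt_series_sums) simp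
  have tm: "Re (mangoldt n * of_nat n powr (- (1 + \<i> * of_real u + of_real \<sigma>)))
      = mangoldt n * real n powr (-1 - \<sigma>) * cos (u * ln (real n))" for n u
  proof (cases "n = 0")
    case False
    have ec: "exp (of_real A + \<i> * of_real B) = of_real (exp A) * cis B" for A B :: real
      by (simp add: exp_add exp_of_real cis_conv_exp)
    have "(of_nat n :: complex) powr (- (1 + \<i> * of_real u + of_real \<sigma>)) = exp (of_real ((-1 - \<sigma>) * ln (real n)) + \<i> * of_real (- (u * ln (real n))))"
      using False by (simp add: powr_def Ln_of_nat algebra_simps)
    then have e: "(of_nat n :: complex) powr (- (1 + \<i> * of_real u + of_real \<sigma>)) =
       of_real (real n powr (-1 - \<sigma>)) * cis (- (u * ln (real n)))"
      unfolding ec using False by (simp add: powr_def)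
    have m: "(mangoldt n :: complex) = of_real (mangoldt n)" by simp
    show ?thesis unfolding e m by simp
  qed simp
  have S: "(\<lambda>n. Re (3 * (mangoldt n * of_nat n powr (- (1 + \<i> * of_real 0 + of_real \<sigma>)))
     + 4 * (mangoldt n * of_nat n powr (- (1 + \<i> * of_real t + of_real \<sigma>)))
     + mangoldt n * of_nat n powr (- (1 + \<i> * of_real (2 * t) + of_real \<sigma>))))
    sums Re (3 * mangoldt_series (1 + \<i> * of_real 0 + of_real \<sigma>) + 4 * mangoldt_series (1 + \<i> * of_real t + of_real \<sigma>)
     + mangoldt_series (1 + \<i> * of_real (2 * t) + of_real \<sigma>))"
    by (intro sums_Re sums_add sums_mult s)
  have P: "0 \<le> Re (3 * (mangoldt n * of_nat n powr (- (1 + \<i> * of_real 0 + of_real \<sigma>)))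
     + 4 * (mangoldt n * of_nat n powr (- (1 + \<i> * of_real t + of_real \<sigma>)))
     + mangoldt n * of_nat n powr (- (1 + \<i> * of_real (2 * t) + of_real \<sigma>)))" for n
  proof -
    define c where "c = cos (t * ln (real n))"
    have r: "Re (3 * a + 4 * b + d) = 3 * Re a + 4 * Re b + Re d" for a b d :: complex by simp
    have d: "cos (2 * t * ln (real n)) = 2 * c\<^sup>2 - 1" unfolding c_def by (metis cos_double_cos mult.assoc)
    have "3 * (mangoldt n * real n powr (-1 - \<sigma>)) + 4 * (mangoldt n * real n powr (-1 - \<sigma>) * c) + mangoldt n * real n powr (-1 - \<sigma>) * (2 * c\<^sup>2 - 1)
       = mangoldt n * real n powr (-1 - \<sigma>) * (2 * (1 + c)\<^sup>2)"
      by (simp add: algebra_simps power2_eq_square)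
    also have "\<dots> \<ge> 0" by (intro mult_nonneg_nonneg mangoldt_nonneg) auto
    finally show ?thesis unfolding r tm d c_def[symmetric] by simp
  qed
  have "0 \<le> Re (3 * mangoldt_series (1 + \<i> * of_real 0 + of_real \<sigma>) + 4 * mangoldt_series (1 + \<i> * of_real t + of_real \<sigma>)
     + mangoldt_series (1 + \<i> * of_real (2 * t) + of_real \<sigma>))"
    by (rule sums_le[OF P sums_zero S])
  then show ?thesis by simp
qed

text \<open>Multiplied by the distance to the line, the 3-4-1 inequality becomes in the limit
  \<open>3 * (1 - k0) - 4 * k1 - k2 \<ge> 0\<close> for orders of vanishing, the 1 coming from the
  pole. A zero at \<open>s\<close> makes \<open>k1\<close> positive, which is impossible.\<close>

lemma zeta_reg_nonzero_line:
  assumes "Re s = 1"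
  shows "zeta_reg s \<noteq> 0"
proof
  assume 0: "zeta_reg s = 0"
  define t where "t = Im s"
  have s: "s = 1 + \<i> * of_real t" using assms by (simp add: t_def complex_eq_iff)
  have t: "t \<noteq> 0" using 0 s zeta_reg_1 by auto
  have oc: "open {s. Re s > 0}" "connected {s. Re s > 0}"
    by (auto simp: open_halfspace_Re_gt convex_halfspace_Re_gt convex_connected)
  have lim: "\<exists>k::nat. (zeta_reg (1 + \<i> * of_real u) = 0 \<longrightarrow> k > 0) \<and>
     ((\<lambda>x::real. of_real x * mangoldt_series (1 + \<i> * of_real u + of_real x)) \<longlongrightarrow> (if u = 0 then 1 else 0) - of_nat k) (at_right 0)" for u :: real
  proof -
    define z where "z = 1 + \<i> * of_real u"
    obtain k :: nat where k: "zeta_reg z = 0 \<longrightarrow> k > 0"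
      "((\<lambda>x::real. of_real x * (deriv zeta_reg (z + of_real x) / zeta_reg (z + of_real x))) \<longlongrightarrow> of_nat k) (at_right 0)"
      using log_deriv_limit[OF zeta_reg_holomorphic oc, of z 1] zeta_reg_1 by (auto simp: z_def)
    have "((\<lambda>x::real. of_real x / (\<i> * of_real u + of_real x)) \<longlongrightarrow> (if u = 0 then 1 else 0 :: complex)) (at_right 0)"
    proof (cases "u = 0")
      case True
      have "eventually (\<lambda>x::real. 1 = of_real x / (\<i> * of_real u + complex_of_real x)) (at_right 0)"
        using True by (auto simp: eventually_at_right_field intro: exI[of _ 1])
      then show ?thesis using True by (simp add: tendsto_eventually eventually_mono)
    next
      case False
      have "((\<lambda>x::real. complex_of_real x / (\<i> * of_real u + of_real x)) \<longlongrightarrow> of_real 0 / (\<i> * of_real u + of_real 0)) (at_right 0)"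
        using False by (intro tendsto_intros) auto
      then show ?thesis using False by simp
    qed
    from tendsto_diff[OF this k(2)]
    have "((\<lambda>x::real. of_real x / (\<i> * of_real u + of_real x) - of_real x * (deriv zeta_reg (z + of_real x) / zeta_reg (z + of_real x)))
        \<longlongrightarrow> (if u = 0 then 1 else 0) - of_nat k) (at_right 0)" .
    moreover have "eventually (\<lambda>x::real. of_real x / (\<i> * of_real u + of_real x) - of_real x * (deriv zeta_reg (z + of_real x) / zeta_reg (z + of_real x))
       = of_real x * mangoldt_series (z + of_real x)) (at_right 0)"
      unfolding eventually_at_right_field
    proof (intro exI[of _ 1] conjI allI impI)
      fix x :: real assume "0 < x" "x < 1"
      then have "Re (z + of_real x) > 1" by (simp add: z_def)
      from mangoldt_series_eq[OF this]
      show "of_real x / (\<i> * of_real u + of_real x) - of_real x * (deriv zeta_reg (z + of_real x) / zeta_reg (z + of_real x))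
       = of_real x * mangoldt_series (z + of_real x)"
        by (simp add: z_def right_diff_distrib)
    qed simp
    ultimately have "((\<lambda>x::real. of_real x * mangoldt_series (z + of_real x)) \<longlongrightarrow> (if u = 0 then 1 else 0) - of_nat k) (at_right 0)"
      by (rule Lim_transform_eventually)
    then show ?thesis using k(1) unfolding z_def by blast
  qed
  obtain k0 :: nat where k0: "((\<lambda>x::real. of_real x * mangoldt_series (1 + \<i> * of_real 0 + of_real x)) \<longlongrightarrow> 1 - of_nat k0) (at_right 0)"
    using lim[of 0] by auto
  obtain k1 :: nat where k1: "k1 > 0" "((\<lambda>x::real. of_real x * mangoldt_series (1 + \<i> * of_real t + of_real x)) \<longlongrightarrow> 0 - of_nat k1) (at_right 0)"
    using lim[of t] t 0 s by auto
  obtain k2 :: nat where k2: "((\<lambda>x::real. of_real x * mangoldt_series (1 + \<i> * of_real (2 * t) + of_real x)) \<longlongrightarrow> 0 - of_nat k2) (at_right 0)"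
    using lim[of "2 * t"] t by auto
  have "((\<lambda>x::real. Re (3 * (of_real x * mangoldt_series (1 + \<i> * of_real 0 + of_real x))
      + 4 * (of_real x * mangoldt_series (1 + \<i> * of_real t + of_real x))
      + of_real x * mangoldt_series (1 + \<i> * of_real (2 * t) + of_real x)))
     \<longlongrightarrow> Re (3 * (1 - of_nat k0) + 4 * (0 - of_nat k1) + (0 - of_nat k2))) (at_right 0)"
    by (intro tendsto_Re tendsto_add tendsto_mult tendsto_const k0 k1 k2)
  moreover have "eventually (\<lambda>x::real. 0 \<le> Re (3 * (of_real x * mangoldt_series (1 + \<i> * of_real 0 + of_real x))
      + 4 * (of_real x * mangoldt_series (1 + \<i> * of_real t + of_real x))
      + of_real x * mangoldt_series (1 + \<i> * of_real (2 * t) + of_real x))) (at_right 0)"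
    unfolding eventually_at_right_field
  proof (intro exI[of _ 1] conjI allI impI)
    fix x :: real assume x: "0 < x" "x < 1"
    have "0 \<le> x * Re (3 * mangoldt_series (1 + of_real x) + 4 * mangoldt_series (1 + \<i> * of_real t + of_real x)
     + mangoldt_series (1 + \<i> * of_real (2 * t) + of_real x))"
      using mangoldt_341[OF x(1), of t] x by (intro mult_nonneg_nonneg) auto
    then show "0 \<le> Re (3 * (of_real x * mangoldt_series (1 + \<i> * of_real 0 + of_real x))
      + 4 * (of_real x * mangoldt_series (1 + \<i> * of_real t + of_real x))
      + of_real x * mangoldt_series (1 + \<i> * of_real (2 * t) + of_real x))"
      by (simp add: algebra_simps)
  qed simp
  ultimately have "0 \<le> Re (3 * (1 - of_nat k0) + 4 * (0 - of_nat k1) + (0 - of_nat k2))"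
    by (rule tendsto_lowerbound) simp
  then show False using k1(1) by simp
qed

section \<open>Primes in short intervals\<close>

definition psi_err :: "nat \<Rightarrow> real" where "psi_err n = cheb_psi n - real n"

lemma psi_err_0 [simp]: "psi_err 0 = 0" by (simp add: psi_err_def cheb_psi_def)

lemma abs_psi_err_le: "\<bar>psi_err n\<bar> \<le> 4 * real n"
  using cheb_psi_le[of n] cheb_psi_nonneg[of n] by (simp add: psi_err_def abs_le_iff)

lemma psi_err_Suc: "psi_err (Suc n) = psi_err n + (mangoldt (Suc n) - 1)"
  by (simp add: psi_err_def cheb_psi_Suc)

text \<open>This is \<open>zeta(s) - 1 / (s - 1)\<close> with the removable singularity at 1 filled
  in, since \<open>zeta_reg 1 = 1\<close>.\<close>

definition zeta_quot :: "complex \<Rightarrow> complex" where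
  "zeta_quot s = (if s = 1 then deriv zeta_reg 1 else (zeta_reg s - zeta_reg 1) / (s - 1))"

text \<open>The accumulated error of replacing \<open>n^(-s) - (n + 1)^(-s)\<close> by
  \<open>s / n^(s + 1)\<close>, taken at \<open>w = 1 + s\<close>. Convergence for
  \<open>Re w > 1\<close> therefore reaches down to \<open>Re s > 0\<close>.\<close>

definition psi_corr :: "complex \<Rightarrow> complex" where
  "psi_corr w = (\<Sum>n. of_real (psi_err (Suc n)) * zterm n w)"

lemma psi_corr:
  shows "psi_corr holomorphic_on {s. Re s > 1}"
    and "Re s > 1 \<Longrightarrow> (\<lambda>n. of_real (psi_err (Suc n)) * zterm n s) sums psi_corr s"
proof -
  have c: "norm (of_real (psi_err (Suc n)) :: complex) \<le> 4 * real (Suc n) powr 1" for n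
    using abs_psi_err_le[of "Suc n"] by simp
  show "psi_corr holomorphic_on {s. Re s > 1}"
    using zterm_series(1)[OF c] by (simp add: psi_corr_def[abs_def])
  show "Re s > 1 \<Longrightarrow> (\<lambda>n. of_real (psi_err (Suc n)) * zterm n s) sums psi_corr s"
    unfolding psi_corr_def using zterm_series(2)[OF c, of s] by (intro summable_sums) simp
qed

text \<open>Summation by parts turns the series with coefficients \<open>mangoldt n - 1\<close> into
  one in \<open>psi_err n\<close> times differences of \<open>n^(-s)\<close>, and
  \<open>zterm\<close> corrects these to \<open>s / n^(s + 1)\<close>. In the result the poles at 1
  of the two Dirichlet series have cancelled, so it continues across the line.\<close>

lemma psi_dirichlet:
  assumes s: "Re s > 1"
  shows "(\<lambda>n. of_real (psi_err (Suc n) / real (Suc n)) * of_nat (Suc n) powr (-s)) sums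
     ((- zeta_quot s - deriv zeta_reg s / zeta_reg s + psi_corr (1 + s)) / s)"
proof -
  define u where "u = (\<lambda>n. of_nat (Suc n) powr (-s) :: complex)"
  define c where "c = (\<lambda>n. of_real (psi_err (Suc n)) :: complex)"
  have s0: "s \<noteq> 0" "s \<noteq> 1" using s by auto
  have LZ: "mangoldt_series s - zeta_series s = - zeta_quot s - deriv zeta_reg s / zeta_reg s"
    unfolding mangoldt_series_eq[OF s] zeta_quot_def zeta_reg_eq[OF s] using s0
    by (simp add: zeta_reg_1 field_simps zeta_reg_eq[OF s])
  have abel: "(\<Sum>n<N. (mangoldt (Suc n) - 1) * u n) = (\<Sum>n<N. c n * (u n - u (Suc n))) + of_real (psi_err N) * u N" for N
  proof (induction N)
    case (Suc N)
    have d: "(mangoldt (Suc N) - 1 :: complex) = of_real (psi_err (Suc N)) - of_real (psi_err N)"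
      by (simp add: psi_err_Suc)
    show ?case unfolding sum.lessThan_Suc Suc d by (simp add: c_def algebra_simps)
  qed simp
  have "(\<lambda>n. mangoldt (Suc n) * of_nat (Suc n) powr (-s)) sums mangoldt_series s"
    using mangoldt_series_sums[OF s] sums_Suc_iff[of "\<lambda>n. mangoldt n * of_nat n powr (-s)"] by simp
  moreover have "(\<lambda>n. of_nat (Suc n) powr (-s)) sums zeta_series s"
    using zeta_series_sums[OF s] sums_Suc_iff[of "\<lambda>n. of_nat n powr (-s)"] by simp
  ultimately have "(\<lambda>n. mangoldt (Suc n) * of_nat (Suc n) powr (-s) - of_nat (Suc n) powr (-s)) sums (mangoldt_series s - zeta_series s)"
    by (rule sums_diff)
  then have "(\<lambda>N. \<Sum>n<N. (mangoldt (Suc n) - 1) * u n) \<longlonglongrightarrow> mangoldt_series s - zeta_series s"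
    by (simp add: sums_def u_def algebra_simps del: of_nat_Suc)
  moreover have "(\<lambda>N. of_real (psi_err N) * u N) \<longlonglongrightarrow> 0"
  proof (rule Lim_null_comparison)
    have "(\<lambda>N. norm (of_nat (Suc N) powr (1 - s) :: complex)) \<longlonglongrightarrow> 0"
      using s by (intro tendsto_norm_zero nat_powr_tendsto_0) simp
    then show "(\<lambda>N. 4 * norm (of_nat (Suc N) powr (1 - s) :: complex)) \<longlonglongrightarrow> 0"
      by (rule tendsto_mult_right_zero)
    show "eventually (\<lambda>N. norm (of_real (psi_err N) * u N) \<le> 4 * norm (of_nat (Suc N) powr (1 - s) :: complex)) sequentially"
    proof (intro always_eventually allI)
      fix N
      have "norm (of_real (psi_err N) * u N) \<le> (4 * real (Suc N)) * real (Suc N) powr (- Re s)"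
        using abs_psi_err_le[of N] unfolding u_def norm_mult
        by (intro mult_mono) (simp_all add: norm_nat_powr del: of_nat_Suc, simp)
      also have "\<dots> = 4 * (real (Suc N) powr 1 * real (Suc N) powr (- Re s))" by simp
      also have "\<dots> = 4 * real (Suc N) powr (1 - Re s)" unfolding powr_add[symmetric] by simp
      finally show "norm (of_real (psi_err N) * u N) \<le> 4 * norm (of_nat (Suc N) powr (1 - s) :: complex)"
        by (simp add: norm_nat_powr del: of_nat_Suc)
    qed
  qed
  ultimately have "(\<lambda>N. (\<Sum>n<N. (mangoldt (Suc n) - 1) * u n) - of_real (psi_err N) * u N) \<longlonglongrightarrow> mangoldt_series s - zeta_series s - 0"
    by (rule tendsto_diff)
  then have A: "(\<lambda>n. c n * (u n - u (Suc n))) sums (mangoldt_series s - zeta_series s)"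
    unfolding abel by (simp add: sums_def)
  have B: "(\<lambda>n. c n * zterm n (1 + s)) sums psi_corr (1 + s)"
    using psi_corr(2)[of "1 + s"] s by (simp add: c_def)
  have eq: "(c n * (u n - u (Suc n)) + c n * zterm n (1 + s)) / s
      = of_real (psi_err (Suc n) / real (Suc n)) * of_nat (Suc n) powr (-s)" for n
  proof -
    define m :: complex where "m = of_nat (Suc n)"
    have m0: "m \<noteq> 0" unfolding m_def by (simp del: of_nat_Suc)
    have p: "m powr (- 1 - s) = m powr (-s) / m"
    proof -
      have e: "- 1 - s = - s - 1" by simp
      show ?thesis unfolding e using m0 powr_diff[of m "-s" 1] by simp
    qed
    have "c n * (u n - u (Suc n)) + c n * zterm n (1 + s) = c n * (s * m powr (- 1 - s))"
      by (simp add: u_def zterm_def m_def algebra_simps del: of_nat_Suc)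
    also have "\<dots> / s = c n / m * m powr (-s)" using s0 p by simp
    finally show ?thesis by (simp add: c_def m_def del: of_nat_Suc)
  qed
  have "(\<lambda>n. (c n * (u n - u (Suc n)) + c n * zterm n (1 + s)) / s) sums
     ((mangoldt_series s - zeta_series s + psi_corr (1 + s)) / s)"
    by (intro sums_divide sums_add A B)
  then show ?thesis unfolding eq LZ .
qed

text \<open>The Tauberian theorem with \<open>s = 1 + z\<close> and coefficients bounded by 4. The
  open set \<open>S\<close> is where \<open>zeta_reg (1 + z)\<close> does not vanish within
  \<open>Re (1 + z) > 0\<close>; by the results on zeros it contains the closed half-plane.\<close>

lemma summable_psi_err: "summable (\<lambda>n. psi_err (Suc n) / real (Suc n) ^ 2)"
proof -
  define b where "b = (\<lambda>n. of_real (psi_err (Suc n) / real (Suc n)) :: complex)"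
  define F where "F = (\<lambda>z. (- zeta_quot (1 + z) - deriv zeta_reg (1 + z) / zeta_reg (1 + z) + psi_corr (2 + z)) / (1 + z))"
  define H where "H = {s::complex. Re s > 0}"
  have oH: "open H" by (simp add: H_def open_halfspace_Re_gt)
  define S where "S = {z. 1 + z \<in> {s \<in> H. zeta_reg s \<noteq> 0}}"
  have oz: "open {s \<in> H. zeta_reg s \<noteq> 0}"
  proof -
    have "open (H \<inter> zeta_reg -` (- {0}))"
      using holomorphic_on_imp_continuous_on[OF zeta_reg_holomorphic, folded H_def] oH
      by (simp add: continuous_on_open_vimage Int_commute open_Compl)
    moreover have "{s \<in> H. zeta_reg s \<noteq> 0} = H \<inter> zeta_reg -` (- {0})" by auto
    ultimately show ?thesis by simp
  qed
  have "continuous_on UNIV (\<lambda>z::complex. 1 + z)" by (intro continuous_intros)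
  then have "open S" unfolding S_def using open_vimage[OF oz] by (simp add: vimage_def)
  have q: "zeta_quot holomorphic_on H"
    using pole_lemma_open[OF zeta_reg_holomorphic[folded H_def] oH, of 1] by (simp add: zeta_quot_def[abs_def])
  have sub: "(\<lambda>z. 1 + z) ` S \<subseteq> H" by (auto simp: S_def)
  have sub2: "(\<lambda>z. 2 + z) ` S \<subseteq> {s. Re s > 1}" by (auto simp: S_def H_def)
  have comp: "(\<lambda>z. g (1 + z)) holomorphic_on S" if "g holomorphic_on H" for g
  proof -
    have "(\<lambda>z. 1 + z) holomorphic_on S" by (intro holomorphic_intros)
    from holomorphic_on_compose_gen[OF this that sub] show ?thesis by (simp add: o_def)
  qed
  have comp2: "(\<lambda>z. psi_corr (2 + z)) holomorphic_on S"
  proof -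
    have "(\<lambda>z. 2 + z) holomorphic_on S" by (intro holomorphic_intros)
    from holomorphic_on_compose_gen[OF this psi_corr(1) sub2] show ?thesis by (simp add: o_def)
  qed
  have hF: "F holomorphic_on S" unfolding F_def
    using oH
    by (intro holomorphic_on_divide holomorphic_on_add holomorphic_on_diff holomorphic_on_minus comp comp2 q holomorphic_deriv
       zeta_reg_holomorphic[folded H_def] holomorphic_on_const holomorphic_on_ident) (auto simp: S_def H_def complex_eq_iff)
  have "{z. Re z \<ge> 0} \<subseteq> S"
  proof
    fix z :: complex assume "z \<in> {z. Re z \<ge> 0}"
    then have "Re (1 + z) = 1 \<or> Re (1 + z) > 1" by auto
    then have "zeta_reg (1 + z) \<noteq> 0" using zeta_reg_nonzero_line zeta_reg_nonzero_gt1 by blast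
    then show "z \<in> S" using \<open>z \<in> {z. Re z \<ge> 0}\<close> by (simp add: S_def H_def)
  qed
  moreover have "norm (b n) \<le> 4" for n
    using abs_psi_err_le[of "Suc n"] by (simp add: b_def norm_divide field_simps del: of_real_divide)
  moreover have "(\<lambda>n. b n * of_nat (Suc n) powr (-1 - z)) sums F z" if "Re z > 0" for z
    using psi_dirichlet[of "1 + z"] that by (simp add: b_def F_def add.assoc[symmetric] del: of_nat_Suc of_real_divide)
  ultimately have "(\<lambda>N. \<Sum>n<N. b n / of_nat (Suc n)) \<longlonglongrightarrow> F 0"
    using newman_tauberian[of b 4 F S] hF \<open>open S\<close> by blast
  then have "(\<lambda>n. b n / of_nat (Suc n)) sums F 0" by (simp add: sums_def)
  then have "(\<lambda>n. Re (b n / of_nat (Suc n))) sums Re (F 0)" by (rule sums_Re)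
  moreover have "Re (b n / of_nat (Suc n)) = psi_err (Suc n) / real (Suc n) ^ 2" for n
  proof -
    have "b n / of_nat (Suc n) = of_real (psi_err (Suc n) / real (Suc n) ^ 2)"
      by (simp add: b_def power2_eq_square del: of_nat_Suc)
    then show ?thesis by (simp only: Re_complex_of_real)
  qed
  ultimately show ?thesis by (simp add: sums_iff)
qed

section \<open>From convergence to the prime number theorem\<close>

text \<open>As Chebyshev's function is nondecreasing, an error above \<open>\<eta> * x\<close> stays
  above half of that up to \<open>(1 + \<eta> / 2) * x\<close>; a deficit persists likewise to the
  left of \<open>x\<close>. Such a block has at least \<open>\<eta> * x / 4\<close> terms of size at
  least \<open>\<eta> / (8 * x)\<close>, too much for the Cauchy criterion.\<close>

lemma psi_err_small:
  assumes \<eta>: "0 < \<eta>" "\<eta> < 1"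
  shows "eventually (\<lambda>x. \<bar>psi_err x\<bar> \<le> \<eta> * real x) sequentially"
proof -
  define f where "f = (\<lambda>n. psi_err (Suc n) / real (Suc n) ^ 2)"
  obtain N where N: "\<And>m n. m \<ge> N \<Longrightarrow> norm (sum f {m..<n}) < \<eta>\<^sup>2 / 32"
    using summable_psi_err[folded f_def] \<eta> unfolding summable_Cauchy
    by (meson divide_pos_pos zero_less_numeral zero_less_power)
  \<comment> \<open>\<open>4 / \<eta>\<close> keeps the block long enough after rounding its end;
    \<open>2 * N\<close> puts the left block, which begins no earlier than \<open>x / 2\<close>,
    beyond \<open>N\<close>.\<close>
  have "\<bar>psi_err x\<bar> \<le> \<eta> * real x" if x: "x \<ge> nat \<lceil>4 / \<eta>\<rceil> + 2 * N + 1" for x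
  proof (rule ccontr)
    assume "\<not> \<bar>psi_err x\<bar> \<le> \<eta> * real x"
    then consider "psi_err x > \<eta> * real x" | "psi_err x < - \<eta> * real x" by linarith
    then show False
    proof cases
      case 1
      define m where "m = nat \<lfloor>(1 + \<eta> / 2) * real x\<rfloor>"
      have x4: "real x \<ge> 4 / \<eta>" using x by linarith
      have x0: "real x > 0" using x by simp
      have mf: "real m \<le> (1 + \<eta> / 2) * real x" "real m > (1 + \<eta> / 2) * real x - 1"
      proof -
        have mr: "real m = of_int \<lfloor>(1 + \<eta> / 2) * real x\<rfloor>" using \<eta> x0 by (simp add: m_def)
        show "real m \<le> (1 + \<eta> / 2) * real x" "real m > (1 + \<eta> / 2) * real x - 1"
          unfolding mr by linarith+
      qed
      have ex: "\<eta> * real x \<ge> 4" using x4 \<eta> by (simp add: field_simps)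
      have cnt: "real m - real x \<ge> \<eta> * real x / 4" using mf ex by (simp add: algebra_simps)
      have "\<eta> / (8 * real x) \<le> f n" if n: "n \<in> {x..<m}" for n
      proof -
        have "real (Suc n) \<le> real m" using n by (simp del: of_nat_Suc)
        then have n1: "real (Suc n) \<le> (1 + \<eta> / 2) * real x" using mf by linarith
        also have "\<dots> \<le> 2 * real x" using \<eta> x0 by (intro mult_right_mono) auto
        finally have n2: "real (Suc n) \<le> 2 * real x" .
        have "cheb_psi x \<le> cheb_psi (Suc n)" using n by (intro cheb_psi_mono) auto
        then have e: "psi_err (Suc n) \<ge> \<eta> * real x / 2" using 1 n1 by (simp add: psi_err_def algebra_simps)
        have "\<eta> * real x / 2 \<ge> 0" using \<eta> x0 by simp
        then have e0: "psi_err (Suc n) \<ge> 0" using e by linarith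
        have "\<eta> / (8 * real x) = (\<eta> * real x / 2) / (2 * real x) ^ 2" using x0 by (simp add: power2_eq_square)
        also have "\<dots> \<le> psi_err (Suc n) / real (Suc n) ^ 2"
          using e e0 n2 \<eta> x0 by (intro frac_le power_mono) (auto simp del: of_nat_Suc)
        finally show ?thesis by (simp add: f_def)
      qed
      then have s1: "(\<Sum>n\<in>{x..<m}. \<eta> / (8 * real x)) \<le> sum f {x..<m}" by (intro sum_mono)
      have "\<eta>\<^sup>2 / 32 = (\<eta> * real x / 4) * (\<eta> / (8 * real x))" using x0 by (simp add: power2_eq_square)
      also have "\<dots> \<le> real (m - x) * (\<eta> / (8 * real x))"
        using cnt \<eta> x0 by (intro mult_right_mono) (linarith, simp)
      also have "\<dots> = (\<Sum>n\<in>{x..<m}. \<eta> / (8 * real x))" by simp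
      also note s1
      finally have "\<eta>\<^sup>2 / 32 \<le> sum f {x..<m}" .
      moreover have "norm (sum f {x..<m}) < \<eta>\<^sup>2 / 32" using x by (intro N) auto
      ultimately show False by simp
    next
      case 2
      define m where "m = nat \<lceil>(1 - \<eta> / 2) * real x\<rceil>"
      have x4: "real x \<ge> 4 / \<eta>" using x by linarith
      have x0: "real x > 0" using x by simp
      have mf: "real m \<ge> (1 - \<eta> / 2) * real x" "real m < (1 - \<eta> / 2) * real x + 1"
        using \<eta> x0 unfolding m_def by (auto simp: of_nat_nat ceiling_less_iff) linarith+
      have ex: "\<eta> * real x \<ge> 4" using x4 \<eta> by (simp add: field_simps)
      have cnt: "real x - real m \<ge> \<eta> * real x / 4" using mf ex by (simp add: algebra_simps)
      have mN: "m \<ge> N"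
      proof -
        have "(1 - \<eta> / 2) * real x \<ge> (1 / 2) * real x" using \<eta> x0 by (intro mult_right_mono) auto
        moreover have "real x \<ge> 2 * real N" using x by linarith
        ultimately show ?thesis using mf by linarith
      qed
      have "\<eta> / (8 * real x) \<le> - f n" if n: "n \<in> {m..<x}" for n
      proof -
        have n2: "real (Suc n) \<le> real x" using n by (simp del: of_nat_Suc)
        have n1: "real (Suc n) \<ge> (1 - \<eta> / 2) * real x" using n mf by auto
        have "cheb_psi (Suc n) \<le> cheb_psi x" using n by (intro cheb_psi_mono) auto
        then have e: "- psi_err (Suc n) \<ge> \<eta> * real x / 2" using 2 n1 by (simp add: psi_err_def algebra_simps)
        have "\<eta> * real x / 2 \<ge> 0" using \<eta> x0 by simp
        then have e0: "- psi_err (Suc n) \<ge> 0" using e by linarith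
        have "\<eta> / (8 * real x) \<le> (\<eta> * real x / 2) / (real x) ^ 2" using x0 \<eta> by (simp add: power2_eq_square field_simps)
        also have "\<dots> \<le> - psi_err (Suc n) / real (Suc n) ^ 2"
          using e e0 n2 \<eta> x0 by (intro frac_le power_mono) (auto simp del: of_nat_Suc)
        finally show ?thesis by (simp add: f_def)
      qed
      then have s1: "(\<Sum>n\<in>{m..<x}. \<eta> / (8 * real x)) \<le> (\<Sum>n\<in>{m..<x}. - f n)" by (intro sum_mono)
      have "\<eta>\<^sup>2 / 32 = (\<eta> * real x / 4) * (\<eta> / (8 * real x))" using x0 by (simp add: power2_eq_square)
      also have "\<dots> \<le> real (x - m) * (\<eta> / (8 * real x))"
        using cnt \<eta> x0 by (intro mult_right_mono) (linarith, simp)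
      also have "\<dots> = (\<Sum>n\<in>{m..<x}. \<eta> / (8 * real x))" by simp
      also note s1
      finally have "\<eta>\<^sup>2 / 32 \<le> - sum f {m..<x}" by (simp add: sum_negf)
      moreover have "norm (sum f {m..<x}) < \<eta>\<^sup>2 / 32" by (intro N mN)
      ultimately show False by simp
    qed
  qed
  then show ?thesis by (auto simp: eventually_sequentially)
qed

lemma card_proper_prime_powers:
  assumes "n > 0"
  shows "real (card {k. k \<le> n \<and> primepow k \<and> \<not> prime k}) \<le> (sqrt (real n) + 1) * (log 2 (real n) + 1)"
proof -
  define s where "s = nat \<lfloor>sqrt (real n)\<rfloor>"
  define l where "l = nat \<lfloor>log 2 (real n)\<rfloor>"
  have l0: "log 2 (real n) \<ge> 0" using assms by simp
  have sub: "{k. k \<le> n \<and> primepow k \<and> \<not> prime k} \<subseteq> (\<lambda>(a, j). a ^ j) ` ({..s} \<times> {..l})"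
  proof
    fix k assume k: "k \<in> {k. k \<le> n \<and> primepow k \<and> \<not> prime k}"
    then obtain p j where pj: "prime p" "j > 0" "k = p ^ j" by (auto simp: primepow_def)
    have "j \<noteq> 1" using k pj by auto
    then have j2: "j \<ge> 2" using pj by auto
    have p2: "p \<ge> 2" using pj(1) by (rule prime_ge_2_nat)
    have "p ^ 2 \<le> p ^ j" using j2 p2 by (intro power_increasing) auto
    then have "real (p ^ 2) \<le> real n" using k pj by (simp del: of_nat_power)
    then have "real p \<le> sqrt (real n)" by (simp add: real_le_rsqrt)
    then have ps: "p \<le> s" by (simp add: s_def le_nat_floor)
    have "2 ^ j \<le> p ^ j" using p2 by (intro power_mono) auto
    also have "p ^ j \<le> n" using k pj by simp
    finally have "real (2 ^ j) \<le> real n" by (simp only: of_nat_le_iff)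
    then have "2 powr real j \<le> real n" by (simp add: powr_realpow)
    then have "real j \<le> log 2 (real n)" using assms by (simp add: le_log_iff)
    then have "j \<le> l" by (simp add: l_def le_nat_floor)
    then show "k \<in> (\<lambda>(a, j). a ^ j) ` ({..s} \<times> {..l})" using pj ps by force
  qed
  have "card {k. k \<le> n \<and> primepow k \<and> \<not> prime k} \<le> card ((\<lambda>(a, j). a ^ j) ` ({..s} \<times> {..l}))"
    by (intro card_mono sub finite_imageI) auto
  also have "\<dots> \<le> card ({..s} \<times> {..l})" by (intro card_image_le) auto
  also have "\<dots> = (s + 1) * (l + 1)" by (simp add: card_cartesian_product)
  finally have "real (card {k. k \<le> n \<and> primepow k \<and> \<not> prime k}) \<le> real ((s + 1) * (l + 1))" by (simp only: of_nat_le_iff)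
  also have "\<dots> = (real s + 1) * (real l + 1)" by (simp only: of_nat_mult of_nat_add of_nat_1)
  also have "\<dots> \<le> (sqrt (real n) + 1) * (log 2 (real n) + 1)"
    using l0 by (intro mult_mono add_right_mono) (auto simp: s_def l_def of_nat_nat)
  finally show ?thesis .
qed

text \<open>Chebyshev's function grows by at least \<open>\<delta> / 2 * n\<close> over the
  interval, while proper prime powers contribute only on the order of
  \<open>sqrt n * (ln n)^2\<close>; the rest must come from primes.\<close>

lemma prime_in_short_interval:
  assumes \<delta>: "0 < \<delta>" "\<delta> < 1"
  shows "eventually (\<lambda>n. \<exists>p. prime p \<and> (1 - \<delta>) * real n < real p \<and> p \<le> n) sequentially"
proof -
  define m where "m = (\<lambda>n. nat \<lfloor>(1 - \<delta>) * real n\<rfloor>)"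
  \<comment> \<open>An error of \<open>\<delta> / 4 * n\<close> at each end leaves half of the
    expected growth \<open>\<delta> * n\<close>.\<close>
  have e1: "eventually (\<lambda>x. \<bar>psi_err x\<bar> \<le> (\<delta> / 4) * real x) sequentially"
    using \<delta> by (intro psi_err_small) auto
  have "filterlim m at_top sequentially" unfolding m_def using \<delta> by real_asymp
  then have e2: "eventually (\<lambda>n. \<bar>psi_err (m n)\<bar> \<le> (\<delta> / 4) * real (m n)) sequentially"
    using e1 by (rule eventually_compose_filterlim[rotated])
  have e3: "eventually (\<lambda>n. ln (real n) * ((sqrt (real n) + 1) * (log 2 (real n) + 1)) < (\<delta> / 4) * real n) sequentially"
    using \<delta> by real_asymp
  show ?thesis
    using e1 e2 e3 eventually_gt_at_top[of 0]
  proof eventually_elim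
    case (elim n)
    have mn: "real (m n) \<le> (1 - \<delta>) * real n" using \<delta> by (simp add: m_def of_nat_nat)
    also have "\<dots> \<le> 1 * real n" using \<delta> by (intro mult_right_mono) auto
    finally have mn': "m n \<le> n" by simp
    have "cheb_psi n - cheb_psi (m n) \<ge> (\<delta> / 2) * real n"
    proof -
      have "cheb_psi n \<ge> real n - (\<delta> / 4) * real n" using elim(1) unfolding psi_err_def by linarith
      moreover have "cheb_psi (m n) \<le> real (m n) + (\<delta> / 4) * real (m n)" using elim(2) unfolding psi_err_def by linarith
      moreover have "(\<delta> / 4) * real (m n) \<le> (\<delta> / 4) * real n" using mn' \<delta> by (intro mult_left_mono) auto
      ultimately show ?thesis using mn by (simp add: algebra_simps)
    qed
    moreover have "cheb_psi n - cheb_psi (m n) = (\<Sum>k\<in>{m n<..n}. mangoldt k)"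
    proof -
      have "{1..n} = {1..m n} \<union> {m n<..n}" using mn' by auto
      then have "cheb_psi n = cheb_psi (m n) + (\<Sum>k\<in>{m n<..n}. mangoldt k)"
        unfolding cheb_psi_def by (simp only:) (subst sum.union_disjoint; force)
      then show ?thesis by simp
    qed
    ultimately have big: "(\<Sum>k\<in>{m n<..n}. mangoldt k) \<ge> (\<delta> / 2) * real n" by simp
    show ?case
    proof (rule ccontr)
      assume no: "\<not> ?thesis"
      define A where "A = {k. k \<le> n \<and> primepow k \<and> \<not> prime k}"
      have fA: "finite A" by (rule finite_subset[of _ "{..n}"]) (auto simp: A_def)
      have "mangoldt k = (0::real)" if "k \<in> {m n<..n} - A" for k
      proof (rule ccontr)
        assume "mangoldt k \<noteq> (0::real)"
        then have "primepow k" by (auto simp: mangoldt_def split: if_splits)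
        then have "prime k" "k \<le> n" using that by (auto simp: A_def)
        moreover have "(1 - \<delta>) * real n < real k" using that unfolding m_def by simp linarith
        ultimately show False using no by blast
      qed
      then have "(\<Sum>k\<in>{m n<..n}. mangoldt k) = (\<Sum>k\<in>{m n<..n} \<inter> A. mangoldt k :: real)"
        by (intro sum.mono_neutral_right) auto
      also have "\<dots> \<le> (\<Sum>k\<in>A. mangoldt k)" using fA by (intro sum_mono2) (auto intro: mangoldt_nonneg)
      also have "\<dots> \<le> (\<Sum>k\<in>A. ln (real n))"
      proof (rule sum_mono)
        fix k assume k: "k \<in> A"
        then have "k > 0" using primepow_gt_Suc_0[of k] by (auto simp: A_def)
        then have "mangoldt k \<le> ln (real k)" by (intro mangoldt_le)
        also have "\<dots> \<le> ln (real n)" using k \<open>k > 0\<close> by (subst ln_le_cancel_iff) (auto simp: A_def)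
        finally show "mangoldt k \<le> ln (real n)" .
      qed
      also have "\<dots> = ln (real n) * real (card A)" by simp
      also have "\<dots> \<le> ln (real n) * ((sqrt (real n) + 1) * (log 2 (real n) + 1))"
        using card_proper_prime_powers[OF elim(4)] elim(4) unfolding A_def by (intro mult_left_mono) auto
      also have "\<dots> < (\<delta> / 4) * real n" by (rule elim(3))
      also have "\<dots> \<le> (\<delta> / 2) * real n" using \<delta> by (intro mult_right_mono) auto
      finally show False using big by simp
    qed
  qed
qed

section \<open>Bose--Chowla sets\<close>

definition ring_ideal :: "'a::comm_ring_1 set \<Rightarrow> bool" where
  "ring_ideal I \<longleftrightarrow> 0 \<in> I \<and> (\<forall>x\<in>I. \<forall>y\<in>I. x + y \<in> I) \<and> (\<forall>x\<in>I. \<forall>r. r * x \<in> I)"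

lemma ring_idealD:
  assumes "ring_ideal I"
  shows "0 \<in> I" "x \<in> I \<Longrightarrow> y \<in> I \<Longrightarrow> x + y \<in> I" "x \<in> I \<Longrightarrow> r * x \<in> I"
  using assms by (auto simp: ring_ideal_def)

text \<open>Zorn's lemma gives an ideal maximal among the proper ones above \<open>I\<close>.
  Adjoining an outside element \<open>a\<close> to it produces 1, and multiplying
  \<open>1 = x + r * a\<close> by \<open>b\<close> puts \<open>b\<close> inside whenever
  \<open>a * b\<close> is.\<close>

lemma prime_ideal_exists:
  fixes I :: "'a::comm_ring_1 set"
  assumes I: "ring_ideal I" "1 \<notin> I"
  shows "\<exists>P. ring_ideal P \<and> I \<subseteq> P \<and> 1 \<notin> P \<and> (\<forall>a b. a * b \<in> P \<longrightarrow> a \<in> P \<or> b \<in> P)"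
proof -
  define A where "A = {J. ring_ideal J \<and> I \<subseteq> J \<and> 1 \<notin> J}"
  have "\<exists>M\<in>A. \<forall>X\<in>A. M \<subseteq> X \<longrightarrow> X = M"
  proof (rule subset_Zorn_nonempty)
    show "A \<noteq> {}" using I by (auto simp: A_def)
    fix C assume C: "C \<noteq> {}" "subset.chain A C"
    then have CA: "C \<subseteq> A" and ch: "\<And>x y. x \<in> C \<Longrightarrow> y \<in> C \<Longrightarrow> x \<subseteq> y \<or> y \<subseteq> x"
      by (auto simp: subset.chain_def subset_chain_def)
    have "ring_ideal (\<Union>C)" unfolding ring_ideal_def
    proof (intro conjI ballI allI)
      show "0 \<in> \<Union>C" using C(1) CA by (auto simp: A_def ring_ideal_def)
      fix x assume "x \<in> \<Union>C"
      then obtain J where J: "J \<in> C" "x \<in> J" by auto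
      have idC: "\<And>J. J \<in> C \<Longrightarrow> ring_ideal J" using CA by (auto simp: A_def)
      show "r * x \<in> \<Union>C" for r using J ring_idealD(3)[OF idC[OF J(1)] J(2)] by blast
      fix y assume "y \<in> \<Union>C"
      then obtain K where K: "K \<in> C" "y \<in> K" by auto
      show "x + y \<in> \<Union>C" using ch[OF J(1) K(1)]
      proof
        assume "J \<subseteq> K"
        then have "x + y \<in> K" using J K ring_idealD(2)[OF idC[OF K(1)]] by blast
        then show ?thesis using K by auto
      next
        assume "K \<subseteq> J"
        then have "x + y \<in> J" using J K ring_idealD(2)[OF idC[OF J(1)]] by blast
        then show ?thesis using J by auto
      qed
    qed
    moreover have "I \<subseteq> \<Union>C" "1 \<notin> \<Union>C" using C(1) CA by (auto simp: A_def)
    ultimately show "\<Union>C \<in> A" by (simp add: A_def)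
  qed
  then obtain P where P: "P \<in> A" "\<And>X. X \<in> A \<Longrightarrow> P \<subseteq> X \<Longrightarrow> X = P" by blast
  have idP: "ring_ideal P" using P(1) by (simp add: A_def)
  have "b \<in> P" if ab: "a * b \<in> P" and a: "a \<notin> P" for a b
  proof -
    define J where "J = {x + r * a | x r. x \<in> P}"
    have JI: "x + r * a \<in> J" if "x \<in> P" for x r using that by (auto simp: J_def)
    have PJ: "P \<subseteq> J" using JI[of _ 0] by auto
    have aJ: "a \<in> J" using JI[of 0 1] ring_idealD(1)[OF idP] by simp
    have "ring_ideal J" unfolding ring_ideal_def
    proof (intro conjI ballI allI)
      show "0 \<in> J" using PJ idP by (auto simp: ring_ideal_def)
      fix x assume "x \<in> J"
      then obtain x1 r1 where x: "x = x1 + r1 * a" "x1 \<in> P" by (auto simp: J_def)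
      show "r * x \<in> J" for r
        using JI[of "r * x1" "r * r1"] ring_idealD(3)[OF idP x(2)] by (simp add: x(1) algebra_simps)
      fix y assume "y \<in> J"
      then obtain y1 s1 where y: "y = y1 + s1 * a" "y1 \<in> P" by (auto simp: J_def)
      show "x + y \<in> J"
        using JI[of "x1 + y1" "r1 + s1"] ring_idealD(2)[OF idP x(2) y(2)] by (simp add: x(1) y(1) algebra_simps)
    qed
    moreover have "J \<noteq> P" using aJ a by auto
    ultimately have "1 \<in> J" using P PJ by (auto simp: A_def)
    then obtain x r where "1 = x + r * a" "x \<in> P" by (auto simp: J_def)
    then have "b = b * x + r * (a * b)" by (metis (no_types, opaque_lifting) distrib_left mult.assoc mult.commute mult.right_neutral)
    then show ?thesis using ab \<open>x \<in> P\<close> idP by (metis ring_ideal_def)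
  qed
  then show ?thesis using P(1) by (auto simp: A_def)
qed

section \<open>Integer polynomials at a complex root of unity\<close>

definition ipoly_eval :: "complex \<Rightarrow> int poly \<Rightarrow> complex" where
  "ipoly_eval z f = poly (map_poly of_int f) z"

lemma ipoly_eval_0 [simp]: "ipoly_eval z 0 = 0"
  by (simp add: ipoly_eval_def)

lemma ipoly_eval_pCons [simp]: "ipoly_eval z (pCons a f) = of_int a + z * ipoly_eval z f"
  by (simp add: ipoly_eval_def map_poly_pCons)

lemma ipoly_eval_1 [simp]: "ipoly_eval z 1 = 1"
  by (simp add: one_pCons)

lemma ipoly_eval_add [simp]: "ipoly_eval z (f + g) = ipoly_eval z f + ipoly_eval z g"
  by (induction f g rule: poly_induct2) (simp_all add: algebra_simps)

lemma ipoly_eval_minus [simp]: "ipoly_eval z (- f) = - ipoly_eval z f"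
  by (induction f) (simp_all add: algebra_simps)

lemma ipoly_eval_diff [simp]: "ipoly_eval z (f - g) = ipoly_eval z f - ipoly_eval z g"
  using ipoly_eval_add[of z f "-g"] by simp

lemma ipoly_eval_smult [simp]: "ipoly_eval z (smult c f) = of_int c * ipoly_eval z f"
  by (induction f) (simp_all add: algebra_simps)

lemma ipoly_eval_mult [simp]: "ipoly_eval z (f * g) = ipoly_eval z f * ipoly_eval z g"
  by (induction f) (simp_all add: algebra_simps)

lemma ipoly_eval_power [simp]: "ipoly_eval z (f ^ n) = ipoly_eval z f ^ n"
  by (induction n) simp_all

lemma ipoly_eval_of_nat [simp]: "ipoly_eval z (of_nat n) = of_nat n"
  by (simp add: of_nat_poly)

lemma ipoly_eval_sum [simp]: "ipoly_eval z (sum f A) = (\<Sum>x\<in>A. ipoly_eval z (f x))"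
  by (induction A rule: infinite_finite_induct) simp_all

lemma ipoly_eval_prod [simp]: "ipoly_eval z (prod f A) = (\<Prod>x\<in>A. ipoly_eval z (f x))"
  by (induction A rule: infinite_finite_induct) simp_all

text \<open>
  If \<open>1 / p\<close> were in \<open>\<int>[z]\<close>, so would be all its powers; but a polynomial of minimal degree
  vanishing at \<open>z\<close> bounds the denominators occurring in \<open>\<int>[z]\<close>.
\<close>

lemma root_of_unity_not_unit:
  fixes z :: complex
  assumes z: "z ^ N = 1" "N > 0" and p: "p \<ge> (2::nat)"
  shows "of_nat p * ipoly_eval z f \<noteq> 1"
proof
  assume f: "of_nat p * ipoly_eval z f = 1"
  define Q where "Q = (\<lambda>d. \<exists>g. g \<noteq> 0 \<and> ipoly_eval z g = 0 \<and> degree g = d)"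
  define X where "X = ([:0, 1:] :: int poly)"
  have "ipoly_eval z (X ^ N - 1) = 0" using z by (simp add: X_def)
  moreover have "X ^ N - 1 \<noteq> 0"
  proof
    assume "X ^ N - 1 = 0"
    then have "poly (X ^ N - 1) 0 = 0" by simp
    then show False using z(2) by (simp add: X_def power_0_left)
  qed
  ultimately have "Q (degree (X ^ N - 1))" unfolding Q_def by blast
  define d where "d = (LEAST d. Q d)"
  have "Q d" unfolding d_def by (rule LeastI) fact
  then obtain g where g: "g \<noteq> 0" "ipoly_eval z g = 0" "degree g = d" by (auto simp: Q_def)
  have min: "w = 0" if "degree w < d" "ipoly_eval z w = 0" for w
    using that not_less_Least[of "degree w" Q] by (auto simp: d_def Q_def)
  define c where "c = lead_coeff g"
  have c0: "c \<noteq> 0" using g(1) by (simp add: c_def)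
  have d0: "d > 0"
  proof (rule ccontr)
    assume "\<not> d > 0"
    then obtain a where "g = [:a:]" using g(3) degree_eq_zeroE[of g] by auto
    then show False using g by simp
  qed
  have deg_lt: "degree (v + w) < d" "degree (smult a v) < d" if "degree v < d" "degree w < d" for v w :: "int poly" and a
    using that degree_add_less[of v d w] degree_smult_le[of a v] by auto
  \<comment> \<open>The polynomial \<open>g\<close> need not be monic, so each reduction of a power
    of \<open>z\<close> modulo \<open>g\<close> costs one factor \<open>c\<close>, its leading
    coefficient.\<close>
  have pw: "\<exists>w. degree w < d \<and> of_int (c ^ i) * z ^ i = ipoly_eval z w" for i
  proof (induction i)
    case 0
    show ?case using d0 by (intro exI[of _ 1]) simp
  next
    case (Suc i)
    then obtain w where w: "degree w < d" "of_int (c ^ i) * z ^ i = ipoly_eval z w" by blast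
    define v where "v = smult c (pCons 0 w) - smult (coeff (pCons 0 w) d) g"
    have "degree (pCons 0 w) \<le> d" using w(1) by (simp add: degree_pCons_eq_if)
    then have "degree v \<le> d" unfolding v_def using g(3)
      by (intro degree_diff_le) (auto intro: order_trans[OF degree_smult_le])
    moreover have "coeff v d = 0" unfolding v_def
      using g(3) by (simp add: c_def coeff_pCons mult.commute split: nat.splits)
    ultimately have "degree v < d" using d0 by (metis eq_zero_or_degree_less gr0I degree_0)
    moreover have "ipoly_eval z v = of_int (c ^ Suc i) * z ^ Suc i"
      using w(2) g(2) by (simp add: v_def algebra_simps)
    ultimately show ?case by metis
  qed
  \<comment> \<open>Powers of \<open>z\<close> repeat with period \<open>N\<close>, so the single
    denominator \<open>c ^ N\<close> serves all of them.\<close>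
  have pw2: "\<exists>w. degree w < d \<and> of_int (c ^ N) * z ^ j = ipoly_eval z w" for j
  proof -
    define i where "i = j mod N"
    have i: "i < N" using z by (simp add: i_def)
    have "z ^ j = z ^ (N * (j div N) + i)" by (simp add: i_def)
    also have "\<dots> = z ^ i" by (simp add: power_add power_mult z(1))
    finally have zj: "z ^ j = z ^ i" .
    obtain w where w: "degree w < d" "of_int (c ^ i) * z ^ i = ipoly_eval z w" using pw by blast
    have "c ^ N = c ^ (N - i) * c ^ i" using i by (simp add: power_add[symmetric])
    then have "of_int (c ^ N) * z ^ j = ipoly_eval z (smult (c ^ (N - i)) w)"
      using w(2) by (simp add: zj)
    then show ?thesis using deg_lt(2)[OF w(1) w(1)] by blast
  qed
  have all: "\<exists>w. degree w < d \<and> of_int (c ^ N) * (z ^ j * ipoly_eval z f) = ipoly_eval z w" for j f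
  proof (induction f arbitrary: j)
    case 0
    show ?case using d0 by (intro exI[of _ 0]) simp
  next
    case (pCons a f)
    obtain w where w: "degree w < d" "of_int (c ^ N) * (z ^ Suc j * ipoly_eval z f) = ipoly_eval z w"
      using pCons(2) by blast
    obtain v where v: "degree v < d" "of_int (c ^ N) * z ^ j = ipoly_eval z v" using pw2 by blast
    have "of_int (c ^ N) * (z ^ j * ipoly_eval z (pCons a f)) = of_int a * (of_int (c ^ N) * z ^ j) + of_int (c ^ N) * (z ^ Suc j * ipoly_eval z f)"
      by (simp add: algebra_simps)
    also have "\<dots> = ipoly_eval z (smult a v + w)" unfolding w(2) v(2) by simp
    finally have "of_int (c ^ N) * (z ^ j * ipoly_eval z (pCons a f)) = ipoly_eval z (smult a v + w)" .
    then show ?case using deg_lt(1)[OF deg_lt(2)[OF v(1) v(1)] w(1)] by blast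
  qed
  \<comment> \<open>With \<open>f ^ m\<close> as inverse of \<open>p ^ m\<close>, the constant
    \<open>c ^ N\<close> equals \<open>p ^ m\<close> times a value of a polynomial of degree below
    \<open>d\<close>. By minimality of \<open>d\<close> this is an identity of polynomials, and the
    constant coefficients give divisibility.\<close>
  have dv: "int p ^ m dvd c ^ N" for m
  proof -
    obtain w where w: "degree w < d" "of_int (c ^ N) * (z ^ 0 * ipoly_eval z (f ^ m)) = ipoly_eval z w"
      using all by blast
    have "of_nat p ^ m * ipoly_eval z (f ^ m) = 1" using f by (simp add: power_mult_distrib[symmetric])
    then have "of_int (c ^ N) = of_nat p ^ m * ipoly_eval z w"
      unfolding w(2)[symmetric] by (simp add: mult.left_commute)
    then have "ipoly_eval z ([:c ^ N:] - smult (int p ^ m) w) = 0" by simp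
    moreover have "degree ([:c ^ N:] - smult (int p ^ m) w) < d"
      using w(1) d0 by (intro degree_diff_less) (auto intro: le_less_trans[OF degree_smult_le])
    ultimately have "[:c ^ N:] - smult (int p ^ m) w = 0" using min by blast
    then have "coeff [:c ^ N:] 0 = coeff (smult (int p ^ m) w) 0" by simp
    then show ?thesis by simp
  qed
  define m where "m = nat \<bar>c ^ N\<bar>"
  have "\<bar>int p ^ m\<bar> \<le> \<bar>c ^ N\<bar>" using dv[of m] c0 by (intro dvd_imp_le_int) auto
  then have "int (p ^ m) \<le> int m" by (simp add: m_def)
  then have "p ^ m \<le> m" by (simp only: of_nat_le_iff)
  moreover have "2 ^ m \<le> p ^ m" using p by (intro power_mono) auto
  moreover have "m < 2 ^ m" by (rule less_exp)
  ultimately show False by linarith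
qed

text \<open>As polynomials in \<open>x\<close> both sides are monic of degree \<open>N\<close> with
  the same \<open>N\<close> roots, so their difference has smaller degree and too many
  roots.\<close>

lemma prod_roots_of_unity:
  fixes z :: complex
  assumes N: "N > 0" and z: "z = cis (2 * pi / real N)"
  shows "(\<Prod>i<N. x - z ^ i) = x ^ N - 1"
proof -
  have zi: "z ^ i = cis (2 * pi * real i / real N)" for i unfolding z by (simp add: Complex.DeMoivre mult.commute)
  have inj: "inj_on (\<lambda>i. z ^ i) {..<N}" and root: "\<And>i. i < N \<Longrightarrow> (z ^ i) ^ N = 1"
    using Complex.bij_betw_roots_unity[OF N] unfolding zi[symmetric] by (auto simp: bij_betw_def)
  define f where "f = (\<Prod>i<N. [:- (z ^ i), 1:])"
  define g where "g = (monom 1 N - 1 :: complex poly)"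
  have f: "degree f = N" "lead_coeff f = 1"
  proof -
    show "degree f = N"
      unfolding f_def using degree_prod_eq_sum_degree[of "{..<N}" "\<lambda>i. [:- (z ^ i), 1:]"] by simp
    show "lead_coeff f = 1" unfolding f_def lead_coeff_prod by simp
  qed
  have cg: "coeff g N = 1" using N by (simp add: g_def)
  have dg: "degree g \<le> N" unfolding g_def by (intro degree_diff_le) (auto simp: degree_monom_le)
  have "f - g = 0"
  proof (rule ccontr)
    assume ne: "f - g \<noteq> 0"
    have "degree (f - g) \<le> N" using f dg by (intro degree_diff_le) auto
    moreover have "coeff (f - g) N = 0" using f cg by simp
    ultimately have "degree (f - g) < N" using ne by (metis eq_zero_or_degree_less)
    moreover have "(\<lambda>i. z ^ i) ` {..<N} \<subseteq> {x. poly (f - g) x = 0}"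
      using root by (auto simp: f_def g_def poly_prod poly_monom)
    then have "card ((\<lambda>i. z ^ i) ` {..<N}) \<le> card {x. poly (f - g) x = 0}"
      by (intro card_mono poly_roots_finite ne)
    then have "N \<le> card {x. poly (f - g) x = 0}" by (simp add: card_image inj)
    ultimately show False using card_poly_roots_bound[OF ne] by linarith
  qed
  then have "poly f x = poly g x" by simp
  then show ?thesis by (simp add: f_def g_def poly_prod poly_monom)
qed

section \<open>Arithmetic modulo a prime ideal of integer polynomials\<close>

text \<open>The last three assumptions are traces of a primitive root of unity of order
  \<open>p ^ h - 1\<close>. The geometric sums show that \<open>X\<close> has this full order, and
  the product makes every element of order dividing it a power of \<open>X\<close>.\<close>

locale finite_field_ideal =
  fixes P :: "int poly set" and p h :: nat
  assumes prime_p: "prime p" and h2: "h \<ge> 2"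
    and ideal: "ring_ideal P" and one_notin: "1 \<notin> P"
    and primeD: "f * g \<in> P \<Longrightarrow> f \<in> P \<or> g \<in> P"
    and of_nat_p_in: "of_nat p \<in> P"
    and geometric_in: "0 < d \<Longrightarrow> d < p ^ h - 1 \<Longrightarrow> (\<Sum>i<p ^ h - 1. ([:0, 1:] ^ d) ^ i) \<in> P"
    and X_pow_in: "[:0, 1:] ^ (p ^ h - 1) - 1 \<in> P"
    and roots_in: "(\<Prod>i<p ^ h - 1. f - [:0, 1:] ^ i) - (f ^ (p ^ h - 1) - 1) \<in> P"
begin

abbreviation X :: "int poly" where "X \<equiv> [:0, 1:]"

definition N :: nat where "N = p ^ h - 1"

definition eqv :: "int poly \<Rightarrow> int poly \<Rightarrow> bool" (infix "\<simeq>" 50) where "f \<simeq> g \<longleftrightarrow> f - g \<in> P"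

lemmas idealD = ring_idealD[OF ideal]

lemma p_ge_2: "p \<ge> 2" using prime_p by (rule prime_ge_2_nat)

lemma Suc_N: "Suc N = p ^ h"
  using p_ge_2 by (simp add: N_def)

lemma N_pos: "N > 0"
proof -
  have "p ^ 1 \<le> p ^ h" using p_ge_2 h2 by (intro power_increasing) auto
  then show ?thesis using p_ge_2 by (simp add: N_def)
qed

lemma minus_in: "f \<in> P \<Longrightarrow> - f \<in> P" using idealD(3)[of f "-1"] by simp
lemma diff_in: "f \<in> P \<Longrightarrow> g \<in> P \<Longrightarrow> f - g \<in> P" using idealD(2)[of f "-g"] minus_in by simp
lemma mult_in: "f \<in> P \<Longrightarrow> f * g \<in> P" using idealD(3)[of f g] by (simp add: mult.commute)

lemma eqv_refl [simp]: "f \<simeq> f" using idealD(1) by (simp add: eqv_def)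
lemma eqv_sym: "f \<simeq> g \<Longrightarrow> g \<simeq> f" using minus_in[of "f - g"] by (simp add: eqv_def)
lemma eqv_trans [trans]: "f \<simeq> g \<Longrightarrow> g \<simeq> k \<Longrightarrow> f \<simeq> k"
  using idealD(2)[of "f - g" "g - k"] by (simp add: eqv_def)
lemma eqv_add: "f \<simeq> g \<Longrightarrow> f' \<simeq> g' \<Longrightarrow> f + f' \<simeq> g + g'"
  using idealD(2)[of "f - g" "f' - g'"] by (simp add: eqv_def algebra_simps)
lemma eqv_mult: "f \<simeq> g \<Longrightarrow> f' \<simeq> g' \<Longrightarrow> f * f' \<simeq> g * g'"
  using idealD(2)[OF idealD(3)[of "f - g" f'] idealD(3)[of "f' - g'" g]] by (simp add: eqv_def algebra_simps)
lemma eqv_power: "f \<simeq> g \<Longrightarrow> f ^ n \<simeq> g ^ n"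
  by (induction n) (auto intro: eqv_mult)
lemma eqv_prod: "(\<And>x. x \<in> A \<Longrightarrow> f x \<simeq> g x) \<Longrightarrow> prod f A \<simeq> prod g A"
  by (induction A rule: infinite_finite_induct) (auto intro: eqv_mult)
lemma eqv_sum: "(\<And>x. x \<in> A \<Longrightarrow> f x \<simeq> g x) \<Longrightarrow> sum f A \<simeq> sum g A"
  by (induction A rule: infinite_finite_induct) (auto intro: eqv_add)

lemma dvd_coeffs_in:
  assumes "\<And>i. int p dvd coeff f i"
  shows "f \<in> P"
proof -
  have "[:int p:] dvd f" using assms by (simp add: const_poly_dvd_iff)
  then obtain g where "f = [:int p:] * g" by (elim dvdE)
  then show ?thesis using mult_in[OF of_nat_p_in, of g] by (simp add: of_nat_poly)
qed

lemma X_pow_N: "X ^ N \<simeq> 1" using X_pow_in by (simp add: eqv_def N_def)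

lemma X_pow_monom: "X ^ n = monom 1 n"
  by (induction n) (simp_all add: monom_Suc)

lemma of_nat_N: "\<not> of_nat N \<in> P"
proof
  assume "of_nat N \<in> P"
  moreover have "of_nat (p ^ h) \<in> P"
  proof -
    have "p ^ h = p * p ^ (h - 1)" using h2 by (cases h) auto
    then show ?thesis using mult_in[OF of_nat_p_in, of "of_nat (p ^ (h - 1))"] by simp
  qed
  ultimately have "of_nat (p ^ h) - of_nat N \<in> P" by (intro diff_in)
  moreover have "of_nat (p ^ h) - of_nat N = (1 :: int poly)" unfolding Suc_N[symmetric] by simp
  ultimately show False using one_notin by simp
qed

lemma X_pow_notin: "X ^ i \<notin> P"
proof
  assume "X ^ i \<in> P"
  then have "X \<in> P"
  proof (induction i)
    case (Suc i) then show ?case using primeD[of X "X ^ i"] by (metis power_Suc)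
  qed (use one_notin in simp)
  then have "X ^ (N - 1) * X \<in> P" by (rule idealD(3))
  then have "X ^ N \<in> P" using N_pos by (metis power_minus_mult)
  from diff_in[OF this X_pow_N[unfolded eqv_def]] show False using one_notin by simp
qed

text \<open>If \<open>X ^ d\<close> were congruent to 1, the geometric sum, which lies in
  \<open>P\<close>, would be congruent to \<open>N\<close>. But \<open>N\<close> is congruent to -1
  because \<open>p ^ h\<close> lies in \<open>P\<close>.\<close>

lemma X_pow_inj:
  assumes "i < j" "j < N"
  shows "\<not> X ^ i \<simeq> X ^ j"
proof
  assume "X ^ i \<simeq> X ^ j"
  then have "X ^ i * (1 - X ^ (j - i)) \<in> P" using assms by (simp add: eqv_def algebra_simps power_add[symmetric])
  then have "1 - X ^ (j - i) \<in> P" using primeD X_pow_notin by blast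
  then have "X ^ (j - i) \<simeq> 1" using eqv_sym by (simp add: eqv_def)
  then have "(\<Sum>k<N. (X ^ (j - i)) ^ k) \<simeq> (\<Sum>k<N. 1 ^ k)" by (intro eqv_sum eqv_power)
  moreover have A: "(\<Sum>k<N. (X ^ (j - i)) ^ k) \<in> P" using geometric_in[of "j - i"] assms by (simp add: N_def)
  ultimately have "(\<Sum>k<N. (X ^ (j - i)) ^ k) - (\<Sum>k<N. 1 ^ k) \<in> P" by (simp only: eqv_def)
  from diff_in[OF A this] show False using of_nat_N by simp
qed

text \<open>
  A relation of degree \<open>d < h\<close> would leave at most \<open>p ^ d\<close> residue classes, but zero and the
  powers of \<open>X\<close> already occupy \<open>p ^ h\<close> of them.
\<close>

lemma low_degree_in:
  assumes f: "f \<in> P" "degree f < h"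
  shows "int p dvd coeff f i"
proof (rule ccontr)
  assume i: "\<not> int p dvd coeff f i"
  define B where "B = {i. \<not> int p dvd coeff f i}"
  have Bsub: "B \<subseteq> {..degree f}" using le_degree[of f] by (force simp: B_def)
  then have fB: "finite B" by (rule finite_subset) simp
  \<comment> \<open>The degree of \<open>f\<close> modulo \<open>p\<close>. An inverse
    \<open>c\<close> of its leading coefficient there turns \<open>f\<close> into a rule expressing
    \<open>X ^ d\<close> through lower powers.\<close>
  define d where "d = Max B"
  have dB: "d \<in> B" unfolding d_def using fB i by (intro Max_in) (auto simp: B_def)
  have dh: "d < h" using dB Bsub f(2) by auto
  have above: "int p dvd coeff f k" if "k > d" for k
  proof (rule ccontr)
    assume "\<not> int p dvd coeff f k"
    then have "k \<le> d" unfolding d_def using fB by (intro Max_ge) (simp_all add: B_def)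
    then show False using that by simp
  qed
  have "coprime (coeff f d) (int p)"
    using dB prime_p by (simp add: B_def coprime_commute prime_imp_coprime)
  then obtain c where c: "[coeff f d * c = 1] (mod int p)" using cong_solve_coprime_int by blast
  define g where "g = smult c f"
  have gP: "g \<in> P" unfolding g_def using idealD(3)[OF f(1), of "[:c:]"] by simp
  define r0 where "r0 = - poly_cutoff d g"
  have Xd: "X ^ d \<simeq> r0"
  proof -
    have "X ^ d - r0 - g \<in> P"
    proof (rule dvd_coeffs_in)
      fix k
      have 1: "int p dvd 1 - c * coeff f d" using c by (simp add: cong_iff_dvd_diff dvd_diff_commute mult.commute)
      have cg: "coeff (X ^ d - r0 - g) k = (if k = d then 1 else 0) + (if k < d then c * coeff f k else 0) - c * coeff f k"
        by (simp add: r0_def coeff_poly_cutoff g_def X_pow_monom)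
      consider "k < d" | "k = d" | "k > d" by linarith
      then show "int p dvd coeff (X ^ d - r0 - g) k"
        unfolding cg by cases (use 1 above[of k] in auto)
    qed
    from idealD(2)[OF this gP] show ?thesis by (simp add: eqv_def)
  qed
  define Low where "Low = {r :: int poly. \<forall>k\<ge>d. coeff r k = 0}"
  have r0L: "r0 \<in> Low" by (simp add: Low_def r0_def coeff_poly_cutoff)
  have step: "\<exists>r\<in>Low. X * q \<simeq> r" if q: "q \<in> Low" for q
  proof -
    define b where "b = coeff (X * q) d"
    define r where "r = poly_cutoff d (X * q) + smult b r0"
    have "r \<in> Low" using r0L by (simp add: Low_def r_def coeff_poly_cutoff)
    moreover have "X * q = poly_cutoff d (X * q) + smult b (X ^ d)"
      using q by (intro poly_eqI) (auto simp: coeff_poly_cutoff b_def Low_def coeff_pCons X_pow_monom split: nat.splits)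
    moreover have "poly_cutoff d (X * q) + smult b (X ^ d) \<simeq> r"
      unfolding r_def using eqv_add[OF eqv_refl eqv_mult[OF eqv_refl Xd, of "[:b:]"]] by simp
    ultimately show ?thesis by metis
  qed
  have red: "\<exists>r\<in>Low. X ^ j \<simeq> r" for j
  proof (induction j)
    case 0
    show ?case
    proof (cases "d = 0")
      case True then show ?thesis using Xd r0L by auto
    next
      case False
      then have "1 \<in> Low" by (simp add: Low_def)
      then show ?thesis by (intro bexI[of _ 1]) simp
    qed
  next
    case (Suc j)
    then obtain q where q: "q \<in> Low" "X ^ j \<simeq> q" by blast
    obtain r where r: "r \<in> Low" "X * q \<simeq> r" using step[OF q(1)] by blast
    have "X ^ Suc j \<simeq> X * q" using eqv_mult[OF eqv_refl q(2), of X] by simp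
    then show ?case using r eqv_trans by blast
  qed
  \<comment> \<open>Reduced representatives: at most \<open>p ^ d\<close> of them, being determined
    by \<open>d\<close> coefficients in \<open>[0, p)\<close>.\<close>
  define W where "W = {r \<in> Low. \<forall>k. 0 \<le> coeff r k \<and> coeff r k < int p}"
  have redW: "\<exists>r\<in>W. X ^ j \<simeq> r" for j
  proof -
    obtain q where q: "q \<in> Low" "X ^ j \<simeq> q" using red by blast
    define r where "r = map_poly (\<lambda>x. x mod int p) q"
    have cr: "coeff r k = coeff q k mod int p" for k by (simp add: r_def coeff_map_poly)
    have "r \<in> W" using q(1) p_ge_2 by (auto simp: W_def Low_def cr)
    moreover have "q \<simeq> r" unfolding eqv_def
      by (rule dvd_coeffs_in) (simp add: cr minus_mod_eq_mult_div)
    ultimately show ?thesis using q(2) eqv_trans by blast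
  qed
  then obtain R where R: "\<And>j. R j \<in> W" "\<And>j. X ^ j \<simeq> R j" by metis
  \<comment> \<open>Index \<open>N\<close> stands for the class of zero, which contains no power of
    \<open>X\<close>; it brings the count to \<open>Suc N = p ^ h\<close>.\<close>
  define T where "T = (\<lambda>j. if j < N then R j else 0)"
  have TW: "T j \<in> W" for j using R p_ge_2 by (auto simp: T_def W_def Low_def)
  have "T i \<noteq> T j" if ij: "i < j" "j \<le> N" for i j
  proof
    assume eq: "T i = T j"
    show False
    proof (cases "j < N")
      case True
      then have "R i = R j" using eq ij by (simp add: T_def)
      then have "X ^ i \<simeq> R j" using R(2)[of i] by simp
      then have "X ^ i \<simeq> X ^ j" using eqv_trans[of "X ^ i" "R j" "X ^ j"] eqv_sym[OF R(2)[of j]] by blast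
      then show False using X_pow_inj ij True by blast
    next
      case False
      then have "R i = 0" using eq ij by (simp add: T_def)
      then have "X ^ i \<simeq> 0" using R(2)[of i] by simp
      then show False using X_pow_notin by (simp add: eqv_def)
    qed
  qed
  then have injT: "inj_on T {..N}" unfolding inj_on_def by (metis atMost_iff linorder_neqE_nat)
  define F where "F = (\<lambda>r :: int poly. restrict (coeff r) {..<d})"
  have "inj_on F W"
  proof (rule inj_onI)
    fix r q assume rq: "r \<in> W" "q \<in> W" "F r = F q"
    show "r = q"
    proof (rule poly_eqI)
      fix k show "coeff r k = coeff q k"
      proof (cases "k < d")
        case True
        then show ?thesis using fun_cong[OF rq(3), of k] by (simp add: F_def)
      next
        case False then show ?thesis using rq by (simp add: W_def Low_def)
      qed
    qed
  qed
  moreover have Fsub: "F ` W \<subseteq> {..<d} \<rightarrow>\<^sub>E {0..<int p}" 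
  proof (rule image_subsetI)
    fix r assume "r \<in> W"
    then show "F r \<in> {..<d} \<rightarrow>\<^sub>E {0..<int p}" unfolding F_def restrict_PiE_iff by (simp add: W_def)
  qed
  have finPi: "finite ({..<d} \<rightarrow>\<^sub>E {0..<int p})" by (intro finite_PiE) auto
  ultimately have "card (T ` {..N}) \<le> card ({..<d} \<rightarrow>\<^sub>E {0..<int p})"
    using TW Fsub finPi
    by (intro card_inj_on_le[of F]) (auto intro: inj_on_subset)
  then have "Suc N \<le> p ^ d" using injT by (simp add: card_image card_PiE)
  then have "p ^ h \<le> p ^ d" unfolding Suc_N .
  then have "h \<le> d" using p_ge_2 by (simp add: power_increasing_iff)
  then show False using dh by simp
qed

lemma frobenius: "(f + g) ^ p \<simeq> f ^ p + g ^ p"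
proof -
  have "(f + g) ^ p = (\<Sum>k\<le>p. of_nat (p choose k) * f ^ k * g ^ (p - k))" by (rule binomial_ring)
  also have "{..p} = insert 0 (insert p {0<..<p})" using p_ge_2 by auto
  also have "(\<Sum>k\<in>insert 0 (insert p {0<..<p}). of_nat (p choose k) * f ^ k * g ^ (p - k))
     = g ^ p + (f ^ p + (\<Sum>k\<in>{0<..<p}. of_nat (p choose k) * f ^ k * g ^ (p - k)))"
    using p_ge_2 by simp
  finally have e: "(f + g) ^ p = g ^ p + (f ^ p + (\<Sum>k\<in>{0<..<p}. of_nat (p choose k) * f ^ k * g ^ (p - k)))" .
  have "(\<Sum>k\<in>{0<..<p}. of_nat (p choose k) * f ^ k * g ^ (p - k)) \<simeq> (\<Sum>k\<in>{0<..<p}. 0)"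
  proof (rule eqv_sum)
    fix k assume k: "k \<in> {0<..<p}"
    have "p dvd (p choose k)" using k prime_p by (intro dvd_choose_prime) auto
    then obtain m where m: "p choose k = p * m" by (elim dvdE)
    have "of_nat (p choose k) * f ^ k * g ^ (p - k) = of_nat p * (of_nat m * f ^ k * g ^ (p - k))"
      unfolding m by (simp only: of_nat_mult mult.assoc)
    then show "of_nat (p choose k) * f ^ k * g ^ (p - k) \<simeq> 0"
      using mult_in[OF of_nat_p_in, of "of_nat m * f ^ k * g ^ (p - k)"] by (simp only: eqv_def diff_zero)
  qed
  from eqv_add[OF eqv_refl eqv_add[OF eqv_refl this], of "g ^ p" "f ^ p"]
  show ?thesis unfolding e by (simp add: add.commute)
qed

lemma of_nat_pow_p: "of_nat a ^ p \<simeq> of_nat a"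
proof (induction a)
  case 0 then show ?case using p_ge_2 by (simp add: power_0_left)
next
  case (Suc a)
  have "(1 + of_nat a) ^ p \<simeq> 1 ^ p + of_nat a ^ p" by (rule frobenius)
  also have "1 ^ p + of_nat a ^ p \<simeq> 1 + of_nat a" using eqv_add[OF eqv_refl Suc] by simp
  finally show ?case by simp
qed

lemma linear_pow: "(X + of_nat a) ^ (p ^ k) \<simeq> X ^ (p ^ k) + of_nat a"
proof (induction k)
  case (Suc k)
  have "(X + of_nat a) ^ (p ^ Suc k) = ((X + of_nat a) ^ (p ^ k)) ^ p"
    by (simp add: power_mult[symmetric] mult.commute)
  also have "\<dots> \<simeq> (X ^ (p ^ k) + of_nat a) ^ p" by (rule eqv_power[OF Suc])
  also have "\<dots> \<simeq> (X ^ (p ^ k)) ^ p + of_nat a ^ p" by (rule frobenius)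
  also have "\<dots> \<simeq> (X ^ (p ^ k)) ^ p + of_nat a" by (intro eqv_add eqv_refl of_nat_pow_p)
  also have "(X ^ (p ^ k)) ^ p = X ^ (p ^ Suc k)" by (simp add: power_mult[symmetric] mult.commute)
  finally show ?case .
qed simp

text \<open>The discrete logarithm of \<open>X + a\<close>. By Frobenius the element equals its own
  \<open>p ^ h\<close>-th power; being nonzero it has \<open>N\<close>-th power 1, and primality of
  \<open>P\<close> picks a vanishing factor from the product over the powers of
  \<open>X\<close>.\<close>

lemma linear_eq_X_pow: "\<exists>i<N. X + of_nat a \<simeq> X ^ i"
proof -
  define Y where "Y = X + of_nat a"
  have YX: "Y = [:int a, 1:]" by (simp add: Y_def of_nat_poly)
  have "Y ^ Suc N \<simeq> X ^ Suc N + of_nat a" unfolding Y_def Suc_N by (rule linear_pow)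
  also have "\<dots> \<simeq> Y"
    using eqv_add[OF eqv_mult[OF eqv_refl X_pow_N, of X] eqv_refl[of "of_nat a"]] by (simp add: Y_def)
  finally have "Y * (Y ^ N - 1) \<in> P" by (simp add: eqv_def algebra_simps)
  moreover have "Y \<notin> P"
  proof
    assume "Y \<in> P"
    moreover have "degree Y < h" using h2 by (simp add: YX)
    ultimately have "int p dvd coeff Y 1" by (rule low_degree_in)
    then show False using p_ge_2 by (simp add: YX)
  qed
  ultimately have "Y ^ N - 1 \<in> P" using primeD by blast
  then have prod: "(\<Prod>i<N. Y - X ^ i) \<in> P"
    using idealD(2)[OF roots_in[of Y, folded N_def]] by fastforce
  have "\<exists>i<n. Y - X ^ i \<in> P" if "(\<Prod>i<n. Y - X ^ i) \<in> P" for n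
    using that
  proof (induction n)
    case 0 then show ?case using one_notin by simp
  next
    case (Suc n) then show ?case using primeD less_Suc_eq by (metis prod.lessThan_Suc)
  qed
  then show ?thesis using prod by (simp add: eqv_def Y_def)
qed

text \<open>Equal weighted sums of logarithms make two products of linear factors congruent. Both
  are monic of the same degree, at most \<open>h\<close>, so their difference has degree below
  \<open>h\<close> and all its coefficients are divisible by \<open>p\<close>. At the root
  \<open>-a\<close> of the first, \<open>p\<close> must then divide the second, which forces
  \<open>v a\<close> to be positive as well.\<close>

lemma bose_chowla_exponents:
  assumes e: "\<And>a. X + of_nat a \<simeq> X ^ e a"
    and disj: "\<And>a. a < p \<Longrightarrow> u a = 0 \<or> v a = (0::nat)"
    and sums: "(\<Sum>a<p. u a) = (\<Sum>a<p. v a)" "(\<Sum>a<p. u a) \<le> h"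
    and weighted: "(\<Sum>a<p. u a * e a) = (\<Sum>a<p. v a * e a)"
    and a: "a < p"
  shows "u a = 0"
proof (rule ccontr)
  assume ua: "u a \<noteq> 0"
  define G where "G = (\<lambda>w. \<Prod>b<p. [:int b, 1:] ^ w b)"
  have lin: "X + of_nat b = [:int b, 1:]" for b by (simp add: of_nat_poly)
  have GX: "G w \<simeq> X ^ (\<Sum>b<p. w b * e b)" for w
  proof -
    have "G w \<simeq> (\<Prod>b<p. (X ^ e b) ^ w b)"
      unfolding G_def lin[symmetric] by (intro eqv_prod eqv_power e)
    also have "(\<Prod>b<p. (X ^ e b) ^ w b) = X ^ (\<Sum>b<p. w b * e b)"
      by (simp add: power_sum power_mult[symmetric] mult.commute)
    finally show ?thesis .
  qed
  have deg: "degree (G w) = (\<Sum>b<p. w b)" for w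
    unfolding G_def by (subst degree_prod_eq_sum_degree) (auto simp: degree_power_eq)
  have lc: "lead_coeff (G w) = 1" for w unfolding G_def lead_coeff_prod by (simp add: lead_coeff_power)
  have "G u \<simeq> G v" using GX[of u] eqv_sym[OF GX[of v]] eqv_trans unfolding weighted by blast
  then have in_P: "G u - G v \<in> P" by (simp add: eqv_def)
  define S where "S = (\<Sum>b<p. u b)"
  have "u a \<le> S" unfolding S_def using a by (intro member_le_sum) auto
  then have S0: "S > 0" using ua by simp
  have "degree (G u - G v) < S"
  proof (rule ccontr)
    assume ge: "\<not> degree (G u - G v) < S"
    have dle: "degree (G u - G v) \<le> S" using deg[of u] deg[of v] sums by (intro degree_diff_le) (auto simp: S_def)
    then have "degree (G u - G v) = S" using ge by simp
    moreover have "coeff (G u - G v) S = 0" using lc[of u] lc[of v] deg[of u] deg[of v] sums by (simp add: S_def)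
    ultimately have "G u - G v = 0" by (metis leading_coeff_0_iff)
    then show False using ge S0 by simp
  qed
  then have "int p dvd coeff (G u - G v) i" for i
    using sums(2) by (intro low_degree_in in_P) (simp add: S_def)
  then have "[:int p:] dvd G u - G v" by (simp add: const_poly_dvd_iff)
  then obtain q where q: "G u - G v = [:int p:] * q" by (elim dvdE)
  have "poly (G u) (- int a) = 0" using ua a by (auto simp: G_def poly_prod intro!: prod_zero bexI[of _ a])
  then have "poly (G v) (- int a) = - int p * poly q (- int a)"
    using arg_cong[OF q, of "\<lambda>f. poly f (- int a)"] by simp
  then have "int p dvd poly (G v) (- int a)" by simp
  then have "int p dvd (\<Prod>b<p. (int b - int a) ^ v b)" by (simp add: G_def poly_prod)
  then obtain b where b: "b < p" "int p dvd (int b - int a) ^ v b"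
    using prime_p by (auto simp: prime_dvd_prod_iff)
  have "v b \<noteq> 0"
  proof
    assume "v b = 0"
    then have "int p dvd 1" using b(2) by simp
    then show False using p_ge_2 by simp
  qed
  have "int p dvd int b - int a" using b(2) prime_p by (auto intro: prime_dvd_power)
  then have "[int b = int a] (mod int p)" by (simp add: cong_iff_dvd_diff)
  then have "b = a" using a b(1) by (simp add: cong_def)
  then show False using disj[OF a] ua \<open>v b \<noteq> 0\<close> by simp
qed

lemma bose_chowla_ideal:
  "\<exists>e. (\<forall>a<p. e a < p ^ h) \<and> (\<forall>u v. (\<forall>a<p. u a = 0 \<or> v a = (0::nat)) \<longrightarrow>
     (\<Sum>a<p. u a) = (\<Sum>a<p. v a) \<longrightarrow> (\<Sum>a<p. u a) \<le> h \<longrightarrow>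
     (\<Sum>a<p. u a * e a) = (\<Sum>a<p. v a * e a) \<longrightarrow> (\<forall>a<p. u a = 0 \<and> v a = 0))"
proof -
  obtain e where e: "\<And>a. e a < N" "\<And>a. X + of_nat a \<simeq> X ^ e a" using linear_eq_X_pow by metis
  have "\<forall>a<p. u a = 0 \<and> v a = 0"
    if disj: "\<forall>a<p. u a = 0 \<or> v a = (0::nat)" and s: "(\<Sum>a<p. u a) = (\<Sum>a<p. v a)" "(\<Sum>a<p. u a) \<le> h"
      and w: "(\<Sum>a<p. u a * e a) = (\<Sum>a<p. v a * e a)" for u v
  proof -
    have "u a = 0" if "a < p" for a
      using bose_chowla_exponents[OF e(2), of u v a] disj s w that by auto
    moreover have "v a = 0" if "a < p" for a
    proof -
      have "v a = 0 \<or> u a = 0" if "a < p" for a using disj that by auto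
      then show ?thesis using bose_chowla_exponents[OF e(2), of v u a] s w that by auto
    qed
    ultimately show ?thesis by simp
  qed
  moreover have "\<forall>a<p. e a < p ^ h" using e(1) Suc_N by (metis less_SucI)
  ultimately show ?thesis by (intro exI[of _ e] conjI) (assumption | blast)+
qed

end

text \<open>The starting point is the preimage of \<open>p * Z[z]\<close> under evaluation at
  \<open>z\<close>. It contains \<open>p\<close> and every polynomial vanishing at \<open>z\<close>,
  and it is proper because \<open>p\<close> is not a unit of \<open>Z[z]\<close>; a prime ideal
  above it inherits all three.\<close>

lemma finite_field_ideal_exists:
  assumes p: "prime p" and h: "h \<ge> 2"
  shows "\<exists>P. finite_field_ideal P p h"
proof -
  define N where "N = p ^ h - 1"
  have p2: "p \<ge> 2" using p by (rule prime_ge_2_nat)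
  have "2 ^ 2 \<le> (2::nat) ^ h" using h by (intro power_increasing) auto
  also have "\<dots> \<le> p ^ h" using p2 by (intro power_mono) auto
  finally have N0: "N > 0" by (simp add: N_def)
  define z where "z = cis (2 * pi / real N)"
  have zN: "z ^ N = 1" using N0 by (simp add: z_def Complex.DeMoivre)
  define I where "I = {f. \<exists>g. ipoly_eval z f = of_nat p * ipoly_eval z g}"
  have I0: "f \<in> I" if "ipoly_eval z f = 0" for f using that by (auto simp: I_def intro: exI[of _ 0])
  have "ring_ideal I" unfolding ring_ideal_def
  proof (intro conjI ballI allI)
    show "0 \<in> I" by (rule I0) simp
    fix x assume "x \<in> I"
    then obtain g where g: "ipoly_eval z x = of_nat p * ipoly_eval z g" by (auto simp: I_def)
    show "r * x \<in> I" for r unfolding I_def using g by (auto intro!: exI[of _ "r * g"])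
    fix y assume "y \<in> I"
    then obtain k where k: "ipoly_eval z y = of_nat p * ipoly_eval z k" by (auto simp: I_def)
    show "x + y \<in> I" unfolding I_def using g k by (auto intro!: exI[of _ "g + k"] simp: algebra_simps)
  qed
  moreover have "1 \<notin> I" using root_of_unity_not_unit[OF zN N0 p2] by (fastforce simp: I_def)
  ultimately obtain P where P: "ring_ideal P" "I \<subseteq> P" "1 \<notin> P" "\<And>a b. a * b \<in> P \<Longrightarrow> a \<in> P \<or> b \<in> P"
    using prime_ideal_exists by metis
  have zero_in: "f \<in> P" if "ipoly_eval z f = 0" for f using I0[OF that] P(2) by blast
  have "finite_field_ideal P p h"
  proof
    show "of_nat p \<in> P" using P(2) by (auto simp: I_def intro!: exI[of _ 1])
    show "(\<Sum>i<p ^ h - 1. ([:0, 1:] ^ d) ^ i) \<in> P" if "0 < d" "d < p ^ h - 1" for d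
    proof (rule zero_in)
      have "z ^ d \<noteq> z ^ 0"
      proof
        assume eq: "z ^ d = z ^ 0"
        have "z ^ i = cis (2 * pi * real i / real N)" for i unfolding z_def by (simp add: Complex.DeMoivre mult.commute)
        then have "inj_on (\<lambda>i. z ^ i) {..<N}" using Complex.bij_betw_roots_unity[OF N0] by (simp add: bij_betw_def)
        from inj_onD[OF this eq] show False using that N0 by (simp add: N_def)
      qed
      moreover have "(z ^ d) ^ N = 1" by (metis power_mult mult.commute zN power_one)
      ultimately have "(\<Sum>i<N. (z ^ d) ^ i) = 0" by (subst sum_gp_strict) simp
      then show "ipoly_eval z (\<Sum>i<p ^ h - 1. ([:0, 1:] ^ d) ^ i) = 0" by (simp add: N_def)
    qed
    show "[:0, 1:] ^ (p ^ h - 1) - 1 \<in> P" by (rule zero_in) (use zN in \<open>simp add: N_def\<close>)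
    show "(\<Prod>i<p ^ h - 1. f - [:0, 1:] ^ i) - (f ^ (p ^ h - 1) - 1) \<in> P" for f
      by (rule zero_in) (use prod_roots_of_unity[OF N0 z_def, of "ipoly_eval z f"] in \<open>simp add: N_def\<close>)
  qed (use p h P in auto)
  then show ?thesis by blast
qed

text \<open>Disjoint supports are what the positive and negative parts of a combination provide. For
  \<open>h = 1\<close> the field has \<open>p\<close> elements, so some \<open>X + a\<close> would
  be zero and have no logarithm; the exponents \<open>e a = a\<close> work instead, as each side has
  at most one term.\<close>

lemma bose_chowla:
  assumes p: "prime p" and h: "h \<ge> 1"
  shows "\<exists>e. (\<forall>a<p. e a < p ^ h) \<and> (\<forall>u v. (\<forall>a<p. u a = 0 \<or> v a = (0::nat)) \<longrightarrow>
     (\<Sum>a<p. u a) = (\<Sum>a<p. v a) \<longrightarrow> (\<Sum>a<p. u a) \<le> h \<longrightarrow>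
     (\<Sum>a<p. u a * e a) = (\<Sum>a<p. v a * e a) \<longrightarrow> (\<forall>a<p. u a = 0 \<and> v a = 0))"
proof (cases "h = 1")
  case True
  have "\<forall>a<p. u a = 0 \<and> v a = 0"
    if disj: "\<forall>a<p. u a = 0 \<or> v a = (0::nat)" and s: "(\<Sum>a<p. u a) = (\<Sum>a<p. v a)" "(\<Sum>a<p. u a) \<le> 1"
      and w: "(\<Sum>a<p. u a * a) = (\<Sum>a<p. v a * a)" for u v
  proof (cases "(\<Sum>a<p. u a) = 0")
    case True then show ?thesis using s(1) by auto
  next
    case False
    then have u1: "(\<Sum>a<p. u a) = 1" "(\<Sum>a<p. v a) = 1" using s by linarith+
    obtain a where a: "a < p" "u a = 1" "\<And>b. b < p \<Longrightarrow> b \<noteq> a \<Longrightarrow> u b = 0"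
      using u1(1) sum_eq_1_iff[of "{..<p}" u] by auto
    obtain a' where a': "a' < p" "v a' = 1" "\<And>b. b < p \<Longrightarrow> b \<noteq> a' \<Longrightarrow> v b = 0"
      using u1(2) sum_eq_1_iff[of "{..<p}" v] by auto
    have "(\<Sum>b<p. u b * b) = (\<Sum>b<p. if b = a then a else 0)" using a by (intro sum.cong) auto
    moreover have "(\<Sum>b<p. v b * b) = (\<Sum>b<p. if b = a' then a' else 0)" using a' by (intro sum.cong) auto
    ultimately have "a = a'" using w a(1) a'(1) by simp
    then show ?thesis using disj a a' by auto
  qed
  moreover have "\<forall>a<p. a < p ^ 1" by simp
  ultimately show ?thesis unfolding True by (intro exI[of _ "\<lambda>a. a"] conjI) (assumption | blast)+
next
  case False
  then have h2: "h \<ge> 2" using h by simp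
  obtain P where "finite_field_ideal P p h" using finite_field_ideal_exists[OF p h2] by blast
  then show ?thesis using finite_field_ideal.bose_chowla_ideal by blast
qed

section \<open>Independent sets in cyclic groups\<close>

lemma finprod_integer_mod_group:
  assumes "finite A" "f \<in> A \<rightarrow> carrier (integer_mod_group n)"
  shows "finprod (integer_mod_group n) f A = (\<Sum>a\<in>A. f a) mod int n"
proof -
  interpret comm_group "integer_mod_group n" by (rule abelian_integer_mod_group)
  show ?thesis using assms
  proof (induction A rule: finite_induct)
    case (insert x F)
    then show ?case by (simp add: mod_add_right_eq Pi_iff)
  qed simp
qed

lemma t_independent_integer_mod_groupI:
  assumes n: "n > 0" and A: "A \<subseteq> {0..<int n}" "A \<noteq> {}"
    and ind: "\<And>c a. int n dvd (\<Sum>a\<in>A. c a * a) \<Longrightarrow> (\<Sum>a\<in>A. \<bar>c a\<bar>) \<le> int t \<Longrightarrow> a \<in> A \<Longrightarrow> c a = 0"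
  shows "t_independent (integer_mod_group n) t A"
proof -
  have car: "carrier (integer_mod_group n) = {0..<int n}" using n by (simp add: carrier_integer_mod_group)
  have fin: "finite A" using A(1) finite_subset by blast
  have "finprod (integer_mod_group n) (\<lambda>a. a [^]\<^bsub>integer_mod_group n\<^esub> c a) A = (\<Sum>a\<in>A. c a * a) mod int n" for c :: "int \<Rightarrow> int"
  proof -
    have pw: "a [^]\<^bsub>integer_mod_group n\<^esub> c a = (c a * a) mod int n" if "a \<in> A" for a
      using that A(1) n by (intro int_pow_integer_mod_group)
    have "finprod (integer_mod_group n) (\<lambda>a. a [^]\<^bsub>integer_mod_group n\<^esub> c a) A = (\<Sum>a\<in>A. a [^]\<^bsub>integer_mod_group n\<^esub> c a) mod int n"
      by (rule finprod_integer_mod_group[OF fin]) (use n in \<open>auto simp: pw car\<close>)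
    also have "(\<Sum>a\<in>A. a [^]\<^bsub>integer_mod_group n\<^esub> c a) = (\<Sum>a\<in>A. (c a * a) mod int n)"
      by (intro sum.cong refl pw)
    also have "\<dots> mod int n = (\<Sum>a\<in>A. c a * a) mod int n" by (rule mod_sum_eq)
    finally show ?thesis .
  qed
  then have "c a = 0" if "finprod (integer_mod_group n) (\<lambda>a. a [^]\<^bsub>integer_mod_group n\<^esub> c a) A = \<one>\<^bsub>integer_mod_group n\<^esub>"
      "(\<Sum>a\<in>A. \<bar>c a\<bar>) \<le> int t" "a \<in> A" for c a
    using that by (intro ind[of c a]) (simp_all add: dvd_eq_mod_eq_0)
  then show ?thesis using A fin unfolding t_independent_def car by blast
qed

lemma card_le_max_t_independent:
  assumes "n > 0" "t_independent (integer_mod_group n) t A"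
  shows "card A \<le> max_t_independent (integer_mod_group n) t"
proof -
  have "{card A | A. t_independent (integer_mod_group n) t A} \<subseteq> card ` Pow {0..<int n}"
    using assms(1) by (auto simp: t_independent_def carrier_integer_mod_group)
  then have "finite {card A | A. t_independent (integer_mod_group n) t A}"
    by (rule finite_subset) auto
  then show ?thesis unfolding max_t_independent_def using assms(2) by (intro Max_ge) auto
qed

text \<open>
  In an unbalanced combination of elements of \<open>[qM + 1, (q + 1)M]\<close>, the at most \<open>q\<close> negative terms
  cannot cancel the surplus of positive ones.
\<close>

lemma unbalanced_sum_less:
  fixes u v e :: "nat \<Rightarrow> nat"
  assumes e: "\<And>a. a \<in> I \<Longrightarrow> e a < M" and uv: "sum v I < sum u I" "sum v I \<le> q"
  shows "(\<Sum>a\<in>I. v a * (q * M + 1 + e a)) < (\<Sum>a\<in>I. u a * (q * M + 1 + e a))"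
proof -
  have "(\<Sum>a\<in>I. v a * e a) \<le> (\<Sum>a\<in>I. v a * M)" using e by (intro sum_mono mult_left_mono) (auto simp: less_imp_le)
  also have "\<dots> = sum v I * M" by (simp add: sum_distrib_right)
  also have "\<dots> \<le> q * M" using uv(2) by (rule mult_right_mono) simp
  finally have "(\<Sum>a\<in>I. v a * e a) < q * M + 1" by simp
  moreover have "(\<Sum>a\<in>I. v a * (q * M + 1 + e a)) = sum v I * (q * M + 1) + (\<Sum>a\<in>I. v a * e a)"
    by (simp only: distrib_left sum.distrib sum_distrib_right)
  ultimately have "(\<Sum>a\<in>I. v a * (q * M + 1 + e a)) < Suc (sum v I) * (q * M + 1)" by simp
  also have "\<dots> \<le> sum u I * (q * M + 1)" using uv(1) by (intro mult_right_mono) auto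
  also have "\<dots> = (\<Sum>a\<in>I. u a * (q * M + 1))" by (simp only: sum_distrib_right)
  also have "\<dots> \<le> (\<Sum>a\<in>I. u a * (q * M + 1 + e a))" by (intro sum_mono mult_left_mono) auto
  finally show ?thesis .
qed

lemma prime_le_max_t_independent:
  assumes p: "prime p" and t: "t \<ge> 2" and n: "p ^ (t div 2) * (t * ((t + 1) div 2)) < n"
  shows "p \<le> max_t_independent (integer_mod_group n) t"
proof -
  define k where "k = t div 2"
  \<comment> \<open>In an unbalanced combination of weight at most \<open>t\<close>, the lighter
    side has weight at most \<open>q\<close>, the largest \<open>b\<close> with
    \<open>2 * b + 1 \<le> t\<close>.\<close>
  define q where "q = (t - 1) div 2"
  define M where "M = p ^ k"
  have k: "k \<ge> 1" "2 * k \<le> t" "t < 2 * k + 2" using t by (auto simp: k_def)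
  have q1: "q + 1 = (t + 1) div 2" using t by (auto simp: q_def)
  have q2: "b \<le> q" if "a + b \<le> t" "b < a" for a b using that by (auto simp: q_def)
  have p0: "p > 0" using p by (rule prime_gt_0_nat)
  have nM: "t * ((q + 1) * M) < n" using n unfolding q1 by (simp add: M_def k_def mult_ac)
  obtain e where e': "\<forall>a<p. e a < p ^ k"
    and indep': "\<forall>u v. (\<forall>a<p. u a = 0 \<or> v a = (0::nat)) \<longrightarrow>
     (\<Sum>a<p. u a) = (\<Sum>a<p. v a) \<longrightarrow> (\<Sum>a<p. u a) \<le> k \<longrightarrow>
     (\<Sum>a<p. u a * e a) = (\<Sum>a<p. v a * e a) \<longrightarrow> (\<forall>a<p. u a = 0 \<and> v a = 0)"
    using bose_chowla[OF p k(1)] by (elim exE conjE)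
  have e: "e a < M" if "a < p" for a using e' that by (simp add: M_def)
  have indep: "\<forall>a<p. u a = 0 \<and> v a = 0"
    if "\<And>a. a < p \<Longrightarrow> u a = 0 \<or> v a = (0::nat)" "(\<Sum>a<p. u a) = (\<Sum>a<p. v a)" "(\<Sum>a<p. u a) \<le> k"
      "(\<Sum>a<p. u a * e a) = (\<Sum>a<p. v a * e a)" for u v
    using indep'[rule_format, of u v] that by simp
  \<comment> \<open>The extra 1 makes the comparison strict: the offsets \<open>e a\<close> of at
    most \<open>q\<close> terms sum to at most \<open>q * M\<close>, less than one base value
    \<open>q * M + 1\<close>.\<close>
  define g where "g = (\<lambda>a. q * M + 1 + e a)"
  have gM: "g a \<le> (q + 1) * M" if "a < p" for a using e[OF that] by (simp add: g_def)
  have g0: "g a > 0" for a by (simp add: g_def)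
  have n0: "n > 0" using nM by simp
  have gn: "g a < n" if "a < p" for a
  proof -
    have "1 * ((q + 1) * M) \<le> t * ((q + 1) * M)" using t by (intro mult_right_mono) auto
    then show ?thesis using gM[OF that] nM by linarith
  qed
  \<comment> \<open>Equal values at two indices would be a forbidden relation with a single term on
    each side; distinctness gives the set its \<open>p\<close> elements.\<close>
  have inj_e: "a = b" if ab: "a < p" "b < p" "g a = g b" for a b
  proof (rule ccontr)
    assume "a \<noteq> b"
    define u where "u = (\<lambda>x. if x = a then 1 else 0 :: nat)"
    define v where "v = (\<lambda>x. if x = b then 1 else 0 :: nat)"
    have s: "(\<Sum>x<p. u x) = 1" "(\<Sum>x<p. v x) = 1" using ab by (simp_all add: u_def v_def)
    have "(\<Sum>x<p. u x * e x) = (\<Sum>x<p. if x = a then e a else 0)" by (intro sum.cong) (auto simp: u_def)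
    moreover have "(\<Sum>x<p. v x * e x) = (\<Sum>x<p. if x = b then e b else 0)" by (intro sum.cong) (auto simp: v_def)
    ultimately have w: "(\<Sum>x<p. u x * e x) = (\<Sum>x<p. v x * e x)" using ab by (simp add: g_def)
    have "\<forall>x<p. u x = 0 \<and> v x = 0"
      by (rule indep) (use s w k \<open>a \<noteq> b\<close> in \<open>auto simp: u_def v_def\<close>)
    then have "u a = 0" using ab(1) by blast
    then show False by (simp add: u_def)
  qed
  define A where "A = (\<lambda>a. int (g a)) ` {..<p}"
  have inj: "inj_on (\<lambda>a. int (g a)) {..<p}" using inj_e by (auto simp: inj_on_def)
  have cardA: "card A = p" unfolding A_def using inj by (simp add: card_image)
  have "t_independent (integer_mod_group n) t A"
  proof (rule t_independent_integer_mod_groupI[OF n0])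
    show "A \<subseteq> {0..<int n}" using gn by (auto simp: A_def)
    show "A \<noteq> {}" using p0 by (auto simp: A_def)
    fix c x assume dvd: "int n dvd (\<Sum>a\<in>A. c a * a)" and small: "(\<Sum>a\<in>A. \<bar>c a\<bar>) \<le> int t" and x: "x \<in> A"
    define u where "u = (\<lambda>a. nat (c (int (g a))))"
    define v where "v = (\<lambda>a. nat (- c (int (g a))))"
    define S where "S = (\<lambda>w. \<Sum>a<p. w a * g a)"
    have uvc: "c (int (g a)) = int (u a) - int (v a)" "\<bar>c (int (g a))\<bar> = int (u a) + int (v a)" for a
      by (auto simp: u_def v_def)
    have "(\<Sum>a\<in>A. c a * a) = (\<Sum>a<p. c (int (g a)) * int (g a))"
      unfolding A_def by (subst sum.reindex[OF inj]) simp
    also have "\<dots> = int (S u) - int (S v)"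
      unfolding uvc S_def by (simp add: left_diff_distrib sum_subtractf)
    finally have d: "int n dvd int (S u) - int (S v)" using dvd by simp
    have "(\<Sum>a\<in>A. \<bar>c a\<bar>) = (\<Sum>a<p. \<bar>c (int (g a))\<bar>)"
      unfolding A_def by (subst sum.reindex[OF inj]) simp
    also have "\<dots> = int ((\<Sum>a<p. u a) + (\<Sum>a<p. v a))" unfolding uvc(2) by (simp add: sum.distrib)
    finally have tb: "(\<Sum>a<p. u a) + (\<Sum>a<p. v a) \<le> t" using small by (simp only: of_nat_le_iff)
    have Sn: "S w < n" if "(\<Sum>a<p. w a) \<le> t" for w
    proof -
      have "S w \<le> (\<Sum>a<p. w a * ((q + 1) * M))" unfolding S_def using gM by (intro sum_mono mult_left_mono) auto
      also have "\<dots> = (\<Sum>a<p. w a) * ((q + 1) * M)" by (simp only: sum_distrib_right)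
      also have "\<dots> \<le> t * ((q + 1) * M)" using that by (rule mult_right_mono) simp
      finally show ?thesis using nM by simp
    qed
    \<comment> \<open>Both sums lie in \<open>[0, n)\<close>, so congruence modulo \<open>n\<close>
      is equality.\<close>
    have "S u < n" "S v < n" using Sn tb by simp_all
    then have "\<bar>int (S u) - int (S v)\<bar> < int n" by linarith
    then have "int (S u) - int (S v) = 0" using d dvd_imp_le_int[of "int (S u) - int (S v)" "int n"] by force
    then have Suv: "S u = S v" by simp
    have "\<not> (\<Sum>a<p. v a) < (\<Sum>a<p. u a)"
      using unbalanced_sum_less[of "{..<p}" e M v u q] e q2[of "sum u {..<p}" "sum v {..<p}"] tb Suv
      by (auto simp: S_def g_def)
    moreover have "\<not> (\<Sum>a<p. u a) < (\<Sum>a<p. v a)"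
      using unbalanced_sum_less[of "{..<p}" e M u v q] e q2[of "sum v {..<p}" "sum u {..<p}"] tb Suv
      by (auto simp: S_def g_def add.commute)
    ultimately have bal: "(\<Sum>a<p. u a) = (\<Sum>a<p. v a)" by simp
    have "S w = (\<Sum>a<p. w a) * (q * M + 1) + (\<Sum>a<p. w a * e a)" for w
      unfolding S_def g_def by (simp only: distrib_left sum.distrib sum_distrib_right)
    then have "(\<Sum>a<p. u a * e a) = (\<Sum>a<p. v a * e a)" using Suv bal by simp
    \<comment> \<open>Twice the common weight is at most \<open>t\<close>, and
      \<open>t < 2 * k + 2\<close>.\<close>
    moreover have "(\<Sum>a<p. u a) \<le> k" using tb bal k(3) by linarith
    moreover have "u a = 0 \<or> v a = 0" for a by (auto simp: u_def v_def)
    ultimately have z: "\<forall>a<p. u a = 0 \<and> v a = 0" using bal by (intro indep)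
    obtain a where "a < p" "x = int (g a)" using x by (auto simp: A_def)
    then show "c x = 0" using z uvc(1)[of a] by simp
  qed
  then show ?thesis using card_le_max_t_independent[OF n0] cardA by metis
qed

theorem theorem3:
  fixes \<epsilon> :: real and t :: nat
  assumes "\<epsilon> > 0" and "t \<ge> 2"
  shows "\<exists>n0 :: nat. \<forall>n\<ge>n0.
    real (max_t_independent (integer_mod_group n) t)
      > root (t div 2) ((1 - \<epsilon>) / (real t * real ((t + 1) div 2)) * real n)"
proof -
  define k where "k = t div 2"
  define D where "D = t * ((t + 1) div 2)"
  have k: "k > 0" using assms(2) by (simp add: k_def)
  have D: "D > 0" using assms(2) by (simp add: D_def)
  have bound: "p \<le> max_t_independent (integer_mod_group n) t" if "prime p" "p ^ k * D < n" for p n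
    using prime_le_max_t_independent[OF that(1) assms(2)] that(2) by (simp add: k_def D_def)
  have goal_eq: "(1 - \<epsilon>) / (real t * real ((t + 1) div 2)) * real n = (1 - \<epsilon>) * (real n / real D)" for n
    by (simp add: D_def)
  show ?thesis
  proof (cases "\<epsilon> \<ge> 1")
    \<comment> \<open>Here the right-hand side is nonpositive, since \<open>root\<close> maps
      nonpositive arguments to nonpositive values; any independent set suffices, and the prime 2
      supplies one.\<close>
    case True
    have "root k ((1 - \<epsilon>) * (real n / real D)) < real (max_t_independent (integer_mod_group n) t)"
      if "n \<ge> 2 ^ k * D + 1" for n
    proof -
      have "(1 - \<epsilon>) * (real n / real D) \<le> 0" using True by (intro mult_nonpos_nonneg) auto
      then have "root k ((1 - \<epsilon>) * (real n / real D)) \<le> 0" using k by simp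
      moreover have "2 \<le> max_t_independent (integer_mod_group n) t" using that by (intro bound) auto
      ultimately show ?thesis by simp
    qed
    then show ?thesis unfolding goal_eq k_def[symmetric] by blast
  next
    case False
    define \<rho> where "\<rho> = root k (1 - \<epsilon>)"
    have \<rho>: "0 < \<rho>" "\<rho> < 1" using False assms(1) k by (auto simp: \<rho>_def)
    \<comment> \<open>Half of the gap between \<open>\<rho>\<close> and 1 is spent on the distance
      to the next lower prime, the other half on rounding.\<close>
    define \<delta> where "\<delta> = (1 - \<rho>) / 2"
    have \<delta>: "0 < \<delta>" "\<delta> < 1" "1 - \<delta> - \<rho> = \<delta>" using \<rho> by (auto simp: \<delta>_def field_simps)
    obtain N where N: "\<And>m. m \<ge> N \<Longrightarrow> \<exists>p. prime p \<and> (1 - \<delta>) * real m < real p \<and> p \<le> m"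
      using prime_in_short_interval[OF \<delta>(1,2)] by (auto simp: eventually_sequentially)
    \<comment> \<open>\<open>N + 2\<close> keeps the rounded \<open>m\<close> beyond the threshold
      for primes; \<open>1 / \<delta>\<close> makes \<open>\<delta> * w \<ge> 1\<close>, which
      covers the rounding.\<close>
    define W where "W = real N + 2 + 1 / \<delta>"
    have W: "W > 0" "W \<ge> real N + 2" "W \<ge> 1 / \<delta>" using \<delta> by (auto simp: W_def add_pos_pos intro: add_nonneg_pos)
    have "root k ((1 - \<epsilon>) * (real n / real D)) < real (max_t_independent (integer_mod_group n) t)"
      if n: "n \<ge> nat \<lceil>real D * W ^ k\<rceil>" for n
    proof -
      define w where "w = root k (real n / real D)"
      have "real n \<ge> real D * W ^ k" using n by linarith
      then have "W ^ k \<le> real n / real D" using D by (simp add: field_simps)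
      then have "root k (W ^ k) \<le> w" unfolding w_def using k by simp
      then have wW: "w \<ge> W" using k W(1) by (simp add: real_root_power_cancel)
      have wk: "w ^ k = real n / real D" unfolding w_def using k by simp
      \<comment> \<open>The largest integer strictly below \<open>w\<close>.
        \<open>\<lfloor>w\<rfloor>\<close> could equal \<open>w\<close>, and then
        \<open>p ^ k * D < n\<close> might fail.\<close>
      define m where "m = nat (\<lceil>w\<rceil> - 1)"
      have c: "real_of_int \<lceil>w\<rceil> < w + 1" "w \<le> real_of_int \<lceil>w\<rceil>" by linarith+
      have "real N + 2 \<le> w" using wW W(2) by simp
      then have "1 \<le> \<lceil>w\<rceil>" using c by linarith
      then have "real m = real_of_int \<lceil>w\<rceil> - 1" by (simp add: m_def)
      then have m: "real m < w" "real m \<ge> w - 1" using c by simp_all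
      have "m \<ge> N" using m(2) \<open>real N + 2 \<le> w\<close> by linarith
      then obtain p where p: "prime p" "(1 - \<delta>) * real m < real p" "p \<le> m" using N by blast
      have "real p < w" using p(3) m(1) by linarith
      then have "real p ^ k < w ^ k" using k by (intro power_strict_mono) auto
      then have "real (p ^ k * D) < real n" using D by (simp add: wk field_simps)
      then have "p \<le> max_t_independent (integer_mod_group n) t" using p(1) by (intro bound) (simp_all only: of_nat_less_iff)
      moreover have "root k ((1 - \<epsilon>) * (real n / real D)) = \<rho> * w"
        unfolding \<rho>_def w_def by (rule real_root_mult)
      moreover have "\<rho> * w < real p"
      proof -
        have "1 \<le> \<delta> * W" using W(3) \<delta>(1) by (simp add: field_simps)
        also have "\<dots> \<le> \<delta> * w" using wW \<delta>(1) by (intro mult_left_mono) auto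
        finally have "1 \<le> \<delta> * w" .
        moreover have r: "\<rho> = 1 - 2 * \<delta>" using \<delta>(3) by simp
        have "(1 - \<delta>) * (w - 1) - \<rho> * w = \<delta> * w - 1 + \<delta>" unfolding r by (simp add: algebra_simps)
        ultimately have "\<rho> * w \<le> (1 - \<delta>) * (w - 1)" using \<delta>(1) by linarith
        also have "\<dots> \<le> (1 - \<delta>) * real m" using m(2) \<delta> by (intro mult_left_mono) auto
        finally show ?thesis using p(2) by linarith
      qed
      ultimately show ?thesis by linarith
    qed
    then show ?thesis unfolding goal_eq k_def[symmetric] by blast
  qed
qed

end
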